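(* Let $\alpha\in[0,1)$ and $C_0>0$. There exists $\varepsilon_0>0$ such that the following holds for every $\varepsilon\in(0,\varepsilon_0]$ and every kernel $K$ satisfying the standing kernel assumptions (described in the context) with parameters $\alpha,\varepsilon,C_0$: if $f_1$ and $f_2$ are two self-similar profiles for $K$ with the same mass, i.e. $\int_0^\infty x f_1(x)\,dx=\int_0^\infty x f_2(x)\,dx=M$ for some $M>0$, then $f_1=f_2$.
   Context: Standing kernel assumptions: $K:(0,\infty)^2\to[0,\infty)$ is symmetric, homogeneous of degree zero ($K(\lambda x,\lambda y)=K(x,y)$ for all $x,y,\lambda>0$), differentiable, and with $W(x,y):=K(x,y)-2$ it satisfies for all $x,y>0$: $W(x,y)\ge-\varepsilon$; $W(x,y)\le \varepsilon\big((x/y)^{\alpha}+(y/x)^{\alpha}\big)$; and $|\partial_x K(x,y)|\le \frac{C_0\varepsilon}{x}\big((x/y)^{\alpha}+(y/x)^{\alpha}\big)$. A self-similar profile (with finite mass) for $K$ is a function $f\in L^1_{loc}(0,\infty)$, $f\ge0$, with $\int_0^\infty x f(x)\,dx<\infty$, satisfying for almost every $x>0$ $$x^2 f(x)=\int_0^x dy\int_{x-y}^\infty dz\, K(y,z)\, y\, f(y) f(z).$$ (Such $f$ gives the self-similar solution $\phi(\xi,t)=t^{-2}f(\xi/t)$ of Smoluchowski's coagulation equation.) *)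

theory Defs
  imports "HOL-Analysis.Analysis"
begin

definition kernel_assms :: "real \<Rightarrow> real \<Rightarrow> real \<Rightarrow> (real \<Rightarrow> real \<Rightarrow> real) \<Rightarrow> bool" where
  "kernel_assms \<alpha> \<epsilon> C0 K \<longleftrightarrow>
     (\<forall>x>0. \<forall>y>0. K x y \<ge> 0) \<and>
     (\<forall>x>0. \<forall>y>0. K x y = K y x) \<and>
     (\<forall>x>0. \<forall>y>0. \<forall>l>0. K (l * x) (l * y) = K x y) \<and>
     (\<forall>x>0. \<forall>y>0. (\<lambda>(u, v). K u v) differentiable (at (x, y))) \<and>
     (\<forall>x>0. \<forall>y>0. K x y - 2 \<ge> - \<epsilon>) \<and>
     (\<forall>x>0. \<forall>y>0. K x y - 2 \<le> \<epsilon> * ((x / y) powr \<alpha> + (y / x) powr \<alpha>)) \<and>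
     (\<forall>x>0. \<forall>y>0. \<bar>deriv (\<lambda>t. K t y) x\<bar> \<le> C0 * \<epsilon> / x * ((x / y) powr \<alpha> + (y / x) powr \<alpha>))"

definition loc_integrable_pos :: "(real \<Rightarrow> real) \<Rightarrow> bool" where
  "loc_integrable_pos f \<longleftrightarrow> (\<forall>a b. 0 < a \<longrightarrow> set_integrable lborel {a..b} f)"

text \<open>Self-similar profile with finite mass.  The integrand is nonnegative,
  so the double integral is taken as a nonnegative (extended) integral.\<close>
definition self_similar_profile :: "(real \<Rightarrow> real \<Rightarrow> real) \<Rightarrow> (real \<Rightarrow> real) \<Rightarrow> bool" where
  "self_similar_profile K f \<longleftrightarrow>
     loc_integrable_pos f \<and>
     (\<forall>x>0. f x \<ge> 0) \<and>
     (\<integral>\<^sup>+ x. ennreal (indicator {0<..} x * (x * f x)) \<partial>lborel) < \<infinity> \<and>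
     (AE x in lborel. x > 0 \<longrightarrow>
        ennreal (x\<^sup>2 * f x) =
        (\<integral>\<^sup>+ y. indicator {0<..<x} y *
           (\<integral>\<^sup>+ z. indicator {x - y<..} z * ennreal (K y z * y * f y * f z) \<partial>lborel) \<partial>lborel))"

definition mass :: "(real \<Rightarrow> real) \<Rightarrow> real" where
  "mass f = (LINT x:{0<..}|lborel. x * f x)"

end

theory Submission
  imports Defs
begin

text \<open>
  After rescaling to mass one, let \<open>f\<^sub>1, f\<^sub>2\<close> be two profiles, \<open>g = f\<^sub>1 - f\<^sub>2\<close> and \<open>s = (f\<^sub>1 + f\<^sub>2) / 2\<close>.
  The weak form of the equation is quadratic, so \<open>g\<close> annihilates \<open>A \<psi>\<close> for every test function \<open>\<psi>\<close>, where
  \<open>A \<psi> x = \<psi> x - x \<psi>' x + \<integral> K x y s y (\<psi> (x + y) - \<psi> x - \<psi> y) dy\<close>. For the constant kernel \<open>2\<close> and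
  \<open>s y = exp (- y)\<close> the equation \<open>A \<psi> = \<phi> - c x\<close> can be solved explicitly, and the solution gains a derivative:
  \<open>x \<psi>'\<close> is controlled by \<open>\<phi>\<close>. This gain makes the shift terms of the perturbation \<open>K - 2\<close> small in the space
  weighted by \<open>1 + x\<close>, although \<open>K - 2\<close> is unbounded; the one term that stays singular, the loss at small sizes, has
  a good sign and is put into the operator that is inverted. Since \<open>\<integral> x g = 0\<close>, this gives
  \<open>\<integral> \<bar>g\<bar> (1 + x) \<le> 1/2 \<integral> \<bar>g\<bar> (1 + x)\<close>, hence \<open>g = 0\<close>.

  The argument needs \<open>s\<close> to be close to \<open>exp (- y)\<close>. The Laplace transform \<open>F p = \<integral> (1 - exp (- p x)) f\<close> of a profile
  satisfies the ordinary differential equation of the constant kernel up to \<open>O(\<epsilon>)\<close>, which yields moment bounds and closeness of \<open>F p\<close> to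
  \<open>p / (1 + p)\<close>; Bernstein polynomials in \<open>exp (- x)\<close> turn this into weak closeness, uniformly for Lipschitz
  test functions.
\<close>

section \<open>Weak form of the profile equation\<close>

text \<open>Two obstacles shape the argument. Near 0 the loss rate caused by \<open>K - 2\<close>
  may be as large as a multiple of \<open>\<epsilon> * x powr (- \<alpha>)\<close>, unbounded for
  every \<epsilon> > 0, so shrinking \<epsilon> does not remove it. The operator has to be inverted
  with a constant that is uniform over all nonnegative loss rates below a fixed multiple of
  \<open>1 + x powr (- \<alpha>)\<close>; only after this constant is fixed is \<epsilon> made
  small. Secondly, profiles are close to the exponential only weakly, so
  \<open>\<psi> (x + y) - \<psi> x - \<psi> y\<close> must be Lipschitz in y on compact intervals,
  with a constant linear in x, while moments control what happens near 0 and near infinity. The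
  multiple c x is the price of solvability: the constant-kernel profiles
  \<open>exp (- x / M) / M\<close> form a family whose tangent at M = 1,
  \<open>(x - 1) * exp (- x)\<close>, annihilates the range of the constant-kernel operator, and c x
  corrects for it. Equal masses make the correction invisible.\<close>

locale coag_kernel =
  fixes \<alpha> \<epsilon> :: real and K :: "real \<Rightarrow> real \<Rightarrow> real"
  assumes alpha: "0 \<le> \<alpha>" "\<alpha> < 1"
    and eps: "0 < \<epsilon>" "\<epsilon> \<le> 1"
    and K_cont: "continuous_on ({0<..} \<times> {0<..}) (\<lambda>p. K (fst p) (snd p))"
    and K_sym: "\<And>x y. K x y = K y x"
    and K_zero: "\<And>x y. \<not> (0 < x \<and> 0 < y) \<Longrightarrow> K x y = 0"
    and K_lower: "\<And>x y. 0 < x \<Longrightarrow> 0 < y \<Longrightarrow> 2 - \<epsilon> \<le> K x y"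
    and K_upper: "\<And>x y. 0 < x \<Longrightarrow> 0 < y \<Longrightarrow>
      K x y \<le> 2 + \<epsilon> * ((x / y) powr \<alpha> + (y / x) powr \<alpha>)"
begin

lemma K_meas_pair [measurable]:
  "(\<lambda>p. K (fst p) (snd p)) \<in> borel_measurable (borel \<Otimes>\<^sub>M borel)"
proof -
  have o: "{0<..} \<times> {0<..} \<in> sets (borel :: (real \<times> real) measure)"
    by (intro borel_open open_Times) auto
  have "(\<lambda>p. if p \<in> {0<..} \<times> {0<..} then K (fst p) (snd p) else 0) \<in> borel_measurable borel"
    by (rule borel_measurable_continuous_on_if[OF o K_cont continuous_on_const])
  also have "(\<lambda>p. if p \<in> {0<..} \<times> {0<..} then K (fst p) (snd p) else 0) = (\<lambda>p. K (fst p) (snd p))"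
    by (auto simp: K_zero fun_eq_iff)
  finally show ?thesis by (simp add: borel_prod)
qed

lemma K_meas2 [measurable (raw)]:
  assumes [measurable]: "g \<in> borel_measurable M" "h \<in> borel_measurable M"
  shows "(\<lambda>x. K (g x) (h x)) \<in> borel_measurable M"
proof -
  have "(\<lambda>x. (\<lambda>p. K (fst p) (snd p)) (g x, h x)) \<in> borel_measurable M"
    by (rule measurable_compose[OF _ K_meas_pair]) simp
  then show ?thesis by simp
qed

lemma K_nonneg: "0 \<le> K x y"
  using K_lower[of x y] K_zero[of x y] eps by (cases "0 < x \<and> 0 < y") auto

end

abbreviation "lborel2 \<equiv> (lborel \<Otimes>\<^sub>M lborel :: (real \<times> real) measure)"

text \<open>With \<open>f\<close> and \<open>K\<close> set to zero off the positive axis and the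
  open quadrant, the iterated integral becomes one integral over the plane with the condition y < x
  < y + z as an indicator, which is the form that Fubini needs. The mass is scaled to 1 once and for
  all.\<close>

locale coag_profile = coag_kernel +
  fixes f :: "real \<Rightarrow> real"
  assumes f_measurable [measurable]: "f \<in> borel_measurable borel"
    and f_nonneg: "\<And>x. 0 \<le> f x"
    and f_zero: "\<And>x. x \<le> 0 \<Longrightarrow> f x = 0"
    and f_mass: "has_bochner_integral lborel (\<lambda>x. x * f x) 1"
    and f_eq: "AE x in lborel. ennreal (x\<^sup>2 * f x) =
      (\<integral>\<^sup>+p. ennreal (K (fst p) (snd p) * fst p * f (fst p) * f (snd p)) *
         indicator {fst p<..<fst p + snd p} x \<partial>lborel2)"
begin

lemma triple_measurable [measurable]:
  "(\<lambda>(x, p). indicator {fst p<..<fst p + snd p} x :: real) \<in> borel_measurable (lborel \<Otimes>\<^sub>M lborel2)"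
  "(\<lambda>(x, p). indicator {fst p<..<fst p + snd p} x :: ennreal) \<in> borel_measurable (lborel \<Otimes>\<^sub>M lborel2)"
  unfolding greaterThanLessThan_iff indicator_def by measurable

text \<open>The equation is multiplied by \<open>\<xi>\<close>, which is minus the derivative of
  \<open>\<psi> x / x\<close>, and integrated in x; over y < x < y + z this telescopes. The
  unsymmetrised form is kept because the second moment estimate treats y and z differently.\<close>

lemma weak_form_aux:
  assumes der: "\<And>x. 0 < x \<Longrightarrow> (\<psi> has_real_derivative \<psi>' x) (at x)"
    and cont: "continuous_on {0<..} \<psi>'"
    and int: "integrable lborel (\<lambda>x. f x * (\<psi> x - x * \<psi>' x))"
  shows "integrable lborel2 (\<lambda>(y, z). K y z * f y * f z * (\<psi> y - y * \<psi> (y + z) / (y + z)))"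
    and "(\<integral>x. f x * (\<psi> x - x * \<psi>' x) \<partial>lborel) =
      (\<integral>(y, z). K y z * f y * f z * (\<psi> y - y * \<psi> (y + z) / (y + z)) \<partial>lborel2)"
proof -
  interpret T: pair_sigma_finite lborel lborel2
    by (simp add: pair_sigma_finite.intro lborel.sigma_finite_measure_axioms lborel_pair.sigma_finite_measure_axioms)
  define \<xi> where "\<xi> x = (if x \<in> {0<..} then (\<psi> x - x * \<psi>' x) / x\<^sup>2 else 0)" for x
  have cont\<psi>: "continuous_on {0<..} \<psi>"
    using der by (auto intro!: continuous_at_imp_continuous_on DERIV_isCont)
  have [measurable]: "\<xi> \<in> borel_measurable borel" unfolding \<xi>_def
    by (intro borel_measurable_continuous_on_if continuous_intros cont cont\<psi>) auto
  have x2\<xi>: "x\<^sup>2 * f x * \<xi> x = f x * (\<psi> x - x * \<psi>' x)" for x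
    using f_zero[of x] by (cases "0 < x") (auto simp: \<xi>_def)
  define h where "h x p = K (fst p) (snd p) * fst p * f (fst p) * f (snd p) *
     indicator {fst p<..<fst p + snd p} x * \<xi> x" for x and p :: "real \<times> real"
  have coef: "0 \<le> K (fst p) (snd p) * fst p * f (fst p) * f (snd p)" for p
    using K_nonneg f_nonneg K_zero[of "fst p"] by (cases "0 < fst p") (auto)
  have hm [measurable]: "(\<lambda>(x,p). h x p) \<in> borel_measurable (lborel \<Otimes>\<^sub>M lborel2)"
    unfolding h_def by measurable
  have "(\<integral>\<^sup>+x. (\<integral>\<^sup>+p. ennreal (norm (h x p)) \<partial>lborel2) \<partial>lborel) =
     (\<integral>\<^sup>+x. ennreal (x\<^sup>2 * f x) * ennreal (\<bar>\<xi> x\<bar>) \<partial>lborel)"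
    using f_eq
  proof (intro nn_integral_cong_AE, eventually_elim)
    case (elim x)
    have "(\<integral>\<^sup>+p. ennreal (norm (h x p)) \<partial>lborel2) = 
      (\<integral>\<^sup>+p. ennreal (K (fst p) (snd p) * fst p * f (fst p) * f (snd p)) *
         indicator {fst p<..<fst p + snd p} x * ennreal (\<bar>\<xi> x\<bar>) \<partial>lborel2)"
      using coef by (intro nn_integral_cong)
        (simp add: h_def abs_mult[of _ "\<xi> x"] ennreal_mult'[of _ "\<bar>\<xi> x\<bar>"] ennreal_mult'' split: split_indicator)
    also have "\<dots> = ennreal (x\<^sup>2 * f x) * ennreal (\<bar>\<xi> x\<bar>)"
      unfolding elim by (rule nn_integral_multc) measurable
    finally show ?case .
  qed
  also have "\<dots> = (\<integral>\<^sup>+x. ennreal (norm (f x * (\<psi> x - x * \<psi>' x))) \<partial>lborel)"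
    by (intro nn_integral_cong)
       (auto simp: x2\<xi>[symmetric] abs_mult ennreal_mult f_nonneg)
  also have "\<dots> < \<infinity>" using int by (auto simp: integrable_iff_bounded)
  finally have fin: "(\<integral>\<^sup>+x. (\<integral>\<^sup>+p. ennreal (norm (h x p)) \<partial>lborel2) \<partial>lborel) < \<infinity>" .
  \<comment> \<open>All factors except \<open>\<xi>\<close> are nonnegative, so the equation itself
    turned the absolute integral of \<open>h\<close> into that of
    \<open>f x * (\<psi> x - x * \<psi>' x)\<close>. The assumed integrability of the latter is all
    that Fubini needs.\<close>
  have inth: "integrable (lborel \<Otimes>\<^sub>M lborel2) (case_prod h)"
  proof (rule integrableI_bounded)
    show "(\<integral>\<^sup>+ x. ennreal (norm (case x of (x, xa) \<Rightarrow> h x xa)) \<partial>(lborel \<Otimes>\<^sub>M lborel2)) < \<infinity>"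
      using fin by (subst sigma_finite_measure.nn_integral_fst[OF lborel_pair.sigma_finite_measure_axioms, symmetric]) auto
  qed measurable
  have in1: "AE x in lborel. (\<integral>p. h x p \<partial>lborel2) = f x * (\<psi> x - x * \<psi>' x)"
    using f_eq
  proof eventually_elim
    case (elim x)
    have "(\<integral>p. K (fst p) (snd p) * fst p * f (fst p) * f (snd p) * indicator {fst p<..<fst p + snd p} x \<partial>lborel2)
       = enn2real (\<integral>\<^sup>+p. ennreal (K (fst p) (snd p) * fst p * f (fst p) * f (snd p) * indicator {fst p<..<fst p + snd p} x) \<partial>lborel2)"
      using coef by (intro integral_eq_nn_integral) (measurable, auto split: split_indicator)
    also have "\<dots> = enn2real (ennreal (x\<^sup>2 * f x))"
      unfolding elim using coef
      by (intro arg_cong[where f=enn2real] nn_integral_cong) (auto split: split_indicator)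
    also have "\<dots> = x\<^sup>2 * f x" using f_nonneg by simp
    finally show ?case unfolding h_def by (simp add: x2\<xi>)
  qed
  have ftc: "(\<integral>x. indicator {y<..<y + z} x * \<xi> x \<partial>lborel) = \<psi> y / y - \<psi> (y + z) / (y + z)"
    if "0 < y" "0 < z" for y z
  proof -
    have "(\<integral>x. indicator {y<..<y + z} x * \<xi> x \<partial>lborel) = (\<integral>x. indicator {y..y + z} x *\<^sub>R \<xi> x \<partial>lborel)"
    proof (rule integral_cong_AE)
      have "AE x in lborel. x \<noteq> y" "AE x in lborel. x \<noteq> y + z"
        by (auto simp: AE_lborel_singleton)
      then show "AE x in lborel. indicator {y<..<y + z} x * \<xi> x = indicator {y..y + z} x *\<^sub>R \<xi> x"
        by eventually_elim (auto simp: indicator_def)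
    qed measurable
    also have "\<dots> = - (\<psi> (y + z) / (y + z)) - - (\<psi> y / y)"
    proof (rule integral_FTC_atLeastAtMost)
      show "y \<le> y + z" using that by simp
      show "((\<lambda>x. - (\<psi> x / x)) has_vector_derivative \<xi> x) (at x within {y..y + z})"
        if x: "y \<le> x" "x \<le> y + z" for x
        unfolding has_real_derivative_iff_has_vector_derivative[symmetric]
        using x \<open>0 < y\<close>
        by (auto intro!: derivative_eq_intros has_field_derivative_at_within[OF der]
            simp: \<xi>_def field_simps power2_eq_square)
      have "continuous_on {y..y+z} (\<lambda>x. (\<psi> x - x * \<psi>' x) / x\<^sup>2)"
        using \<open>0 < y\<close> by (intro continuous_intros continuous_on_subset[OF cont] continuous_on_subset[OF cont\<psi>]) auto
      then show "continuous_on {y..y + z} \<xi>"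
        by (rule continuous_on_eq) (use \<open>0 < y\<close> in \<open>auto simp: \<xi>_def\<close>)
    qed
    finally show ?thesis by simp
  qed
  have in2: "(\<integral>x. h x p \<partial>lborel) = (\<lambda>(y, z). K y z * f y * f z * (\<psi> y - y * \<psi> (y + z) / (y + z))) p" for p
  proof (cases p)
    case (Pair y z)
    show ?thesis
    proof (cases "0 < y \<and> 0 < z")
      case True
      have "(\<integral>x. h x p \<partial>lborel) = K y z * y * f y * f z * (\<integral>x. indicator {y<..<y + z} x * \<xi> x \<partial>lborel)"
        unfolding h_def Pair by (simp add: mult.assoc)
      also have "\<dots> = K y z * f y * f z * (\<psi> y - y * \<psi> (y + z) / (y + z))"
        using True by (subst ftc) (auto simp: right_diff_distrib)
      finally show ?thesis by (simp add: Pair)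
    next
      case False
      then show ?thesis unfolding h_def Pair by (auto simp: K_zero)
    qed
  qed
  show "integrable lborel2 (\<lambda>(y, z). K y z * f y * f z * (\<psi> y - y * \<psi> (y + z) / (y + z)))"
    using T.integrable_snd[OF inth] unfolding in2 .
  have "(\<integral>x. f x * (\<psi> x - x * \<psi>' x) \<partial>lborel) = (\<integral>x. \<integral>p. h x p \<partial>lborel2 \<partial>lborel)"
    using in1 int by (intro integral_cong_AE) (auto elim!: eventually_mono)
  also have "\<dots> = (\<integral>p. \<integral>x. h x p \<partial>lborel \<partial>lborel2)"
    using T.integral_fst[OF inth] T.integral_snd[OF inth] by simp
  finally show "(\<integral>x. f x * (\<psi> x - x * \<psi>' x) \<partial>lborel) =
      (\<integral>(y, z). K y z * f y * f z * (\<psi> y - y * \<psi> (y + z) / (y + z)) \<partial>lborel2)"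
    unfolding in2 .
qed

text \<open>Exchanging y and z leaves \<open>K\<close> unchanged, and the two weights y / (y + z)
  and z / (y + z) of the gain term add up to 1.\<close>

lemma weak_form:
  assumes der: "\<And>x. 0 < x \<Longrightarrow> (\<psi> has_real_derivative \<psi>' x) (at x)"
    and cont: "continuous_on {0<..} \<psi>'"
    and int: "integrable lborel (\<lambda>x. f x * (\<psi> x - x * \<psi>' x))"
  shows "integrable lborel2 (\<lambda>(y, z). K y z * f y * f z * (\<psi> y + \<psi> z - \<psi> (y + z)))"
    and "2 * (\<integral>x. f x * (\<psi> x - x * \<psi>' x) \<partial>lborel) =
      (\<integral>(y, z). K y z * f y * f z * (\<psi> y + \<psi> z - \<psi> (y + z)) \<partial>lborel2)"
proof -
  define H where "H = (\<lambda>(y, z). K y z * f y * f z * (\<psi> y - y * \<psi> (y + z) / (y + z)))"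
  have I: "integrable lborel2 H" "(\<integral>x. f x * (\<psi> x - x * \<psi>' x) \<partial>lborel) = (\<integral>p. H p \<partial>lborel2)"
    using weak_form_aux[OF der cont int] by (simp_all add: H_def)
  have S: "integrable lborel2 (\<lambda>(x, y). H (y, x))" "(\<integral>(x, y). H (y, x) \<partial>lborel2) = (\<integral>p. H p \<partial>lborel2)"
    using lborel_pair.integrable_product_swap[OF I(1)] lborel_pair.integral_product_swap[of H] I(1) by auto
  have eq: "H p + (\<lambda>(x, y). H (y, x)) p = (\<lambda>(y, z). K y z * f y * f z * (\<psi> y + \<psi> z - \<psi> (y + z))) p" for p
  proof (cases p)
    case (Pair y z)
    show ?thesis
    proof (cases "0 < y \<and> 0 < z")
      case True
      have "y * \<psi> (y + z) / (y + z) + z * \<psi> (y + z) / (y + z) = \<psi> (y + z)"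
        using True by (simp add: add_divide_distrib[symmetric] distrib_right[symmetric])
      then have e: "(\<psi> y - y * \<psi> (y + z) / (y + z)) + (\<psi> z - z * \<psi> (y + z) / (y + z)) = \<psi> y + \<psi> z - \<psi> (y + z)"
        by linarith
      have "H p + (\<lambda>(x, y). H (y, x)) p = K y z * f y * f z *
          ((\<psi> y - y * \<psi> (y + z) / (y + z)) + (\<psi> z - z * \<psi> (y + z) / (y + z)))"
        unfolding H_def Pair distrib_left
        by (simp add: K_sym[of z y] add.commute[of z y] mult.commute[of "f z"] mult.assoc)
      then show ?thesis unfolding e by (simp add: Pair)
    qed (auto simp: H_def Pair K_zero)
  qed
  show "integrable lborel2 (\<lambda>(y, z). K y z * f y * f z * (\<psi> y + \<psi> z - \<psi> (y + z)))"
    using Bochner_Integration.integrable_add[OF I(1) S(1)] unfolding eq .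
  show "2 * (\<integral>x. f x * (\<psi> x - x * \<psi>' x) \<partial>lborel) =
      (\<integral>(y, z). K y z * f y * f z * (\<psi> y + \<psi> z - \<psi> (y + z)) \<partial>lborel2)"
    using Bochner_Integration.integral_add[OF I(1) S(1)] I(2) S(2) unfolding eq by simp
qed

end

section \<open>Moment bounds and the Laplace transform\<close>

text \<open>Moments are first bounded for regularised weights, where finiteness is known beforehand.
  Fatou then gives integrability and the bound of the limit together.\<close>

lemma integrable_fatou_bound:
  fixes u :: "nat \<Rightarrow> 'a \<Rightarrow> real"
  assumes int: "\<And>n. integrable M (u n)" and nn: "\<And>n x. 0 \<le> u n x"
    and le: "\<And>n. (\<integral>x. u n x \<partial>M) \<le> C" and lim: "\<And>x. (\<lambda>n. u n x) \<longlonglongrightarrow> v x"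
  shows "integrable M v" "(\<integral>x. v x \<partial>M) \<le> C"
proof -
  have [measurable]: "u n \<in> borel_measurable M" for n using int by simp
  have [measurable]: "v \<in> borel_measurable M"
    by (rule borel_measurable_LIMSEQ_real[OF lim]) simp
  have v0: "0 \<le> v x" for x by (rule LIMSEQ_le_const[OF lim]) (use nn in auto)
  have C0: "0 \<le> C" using le[of 0] Bochner_Integration.integral_nonneg[of M "u 0", OF nn] by linarith
  have "(\<integral>\<^sup>+x. ennreal (v x) \<partial>M) = (\<integral>\<^sup>+x. liminf (\<lambda>n. ennreal (u n x)) \<partial>M)"
    by (intro nn_integral_cong lim_imp_Liminf[symmetric] tendsto_ennrealI lim) simp
  also have "\<dots> \<le> liminf (\<lambda>n. \<integral>\<^sup>+x. ennreal (u n x) \<partial>M)"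
    by (rule nn_integral_liminf) simp
  also have "\<dots> \<le> liminf (\<lambda>n. ennreal C)"
    by (intro Liminf_mono always_eventually allI)
       (simp add: nn_integral_eq_integral[OF int] nn le ennreal_leI)
  also have "\<dots> = ennreal C" by (simp add: Liminf_const)
  finally have *: "(\<integral>\<^sup>+x. ennreal (v x) \<partial>M) \<le> ennreal C" .
  then show I: "integrable M v"
    by (intro integrableI_bounded) (auto simp: v0 intro: le_less_trans)
  show "(\<integral>x. v x \<partial>M) \<le> C"
    using * nn_integral_eq_integral[OF I] v0 C0 by simp
qed

lemma integral_product:
  fixes a b :: "real \<Rightarrow> real"
  assumes a: "integrable lborel a" and b: "integrable lborel b"
  shows "integrable lborel2 (\<lambda>(y, z). a y * b z)"
    and "(\<integral>(y, z). a y * b z \<partial>lborel2) = (\<integral>y. a y \<partial>lborel) * (\<integral>z. b z \<partial>lborel)"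
proof -
  have [measurable]: "a \<in> borel_measurable borel" "b \<in> borel_measurable borel"
    using a b by auto
  show I: "integrable lborel2 (\<lambda>(y, z). a y * b z)"
  proof (rule lborel_pair.Fubini_integrable)
    show "integrable lborel (\<lambda>x. LINT y|lborel. norm (case (x, y) of (y, z) \<Rightarrow> a y * b z))"
      using a by (simp add: abs_mult)
    show "AE x in lborel. integrable lborel (\<lambda>y. case (x, y) of (y, z) \<Rightarrow> a y * b z)"
      using b by simp
  qed measurable
  show "(\<integral>(y, z). a y * b z \<partial>lborel2) = (\<integral>y. a y \<partial>lborel) * (\<integral>z. b z \<partial>lborel)"
    using lborel_pair.integral_fst[OF I] by simp
qed

lemma powr_le_sum:
  fixes x :: real
  assumes "0 < x" "a \<le> c" "c \<le> b"
  shows "x powr c \<le> x powr a + x powr b"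
proof (cases "1 \<le> x")
  case True
  then have "x powr c \<le> x powr b" using assms by (intro powr_mono) auto
  then show ?thesis using powr_ge_zero[of x a] by linarith
next
  case False
  then have "x powr c \<le> x powr a" using assms by (intro powr_mono') auto
  then show ?thesis using powr_ge_zero[of x b] by linarith
qed

lemma powr_le_one_plus:
  fixes x :: real
  assumes "0 \<le> x" "0 \<le> c" "c \<le> 1"
  shows "x powr c \<le> 1 + x"
  using powr_le_sum[of x 0 c 1] assms by (cases "x = 0") auto

section \<open>Laplace transform and bound on the number integral\<close>

context coag_profile
begin

lemma x_f_integrable: "integrable lborel (\<lambda>x. x * f x)"
  and x_f_integral: "(\<integral>x. x * f x \<partial>lborel) = 1"
  using f_mass by (auto simp: has_bochner_integral_iff)

text \<open>\<open>1 - exp\<close> rather than \<open>exp\<close>, because only the first moment is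
  known to be finite; finiteness of the integral of \<open>f\<close> is deduced from bounds on
  \<open>F\<close>. \<open>G\<close> will turn out to be the derivative of \<open>F\<close>.\<close>

definition F where "F p = (\<integral>x. f x * (1 - exp (- p * x)) \<partial>lborel)"
definition G where "G p = (\<integral>x. f x * (x * exp (- p * x)) \<partial>lborel)"

lemma exp_bounds:
  assumes "0 \<le> p" "0 \<le> x"
  shows "0 \<le> 1 - exp (- p * x)" "1 - exp (- p * x) \<le> p * x" "1 - exp (- p * x) \<le> (1::real)"
  using assms exp_ge_add_one_self[of "- p * x"] by auto

lemma F_integrable: assumes "0 \<le> p" shows "integrable lborel (\<lambda>x. f x * (1 - exp (- p * x)))"
proof (rule Bochner_Integration.integrable_bound)
  show "integrable lborel (\<lambda>x. p * (x * f x))" using x_f_integrable by simp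
  show "AE x in lborel. norm (f x * (1 - exp (- p * x))) \<le> norm (p * (x * f x))"
  proof (rule AE_I2)
    fix x
    show "norm (f x * (1 - exp (- p * x))) \<le> norm (p * (x * f x))"
    proof (cases "0 < x")
      case True
      then have "f x * (1 - exp (- p * x)) \<le> f x * (p * x)"
        by (intro mult_left_mono exp_bounds f_nonneg) (use assms in auto)
      then show ?thesis using True assms f_nonneg[of x] exp_bounds[of p x] by (auto simp: abs_mult mult_ac)
    qed (simp add: f_zero)
  qed
qed measurable

lemma G_integrable: assumes "0 \<le> p" shows "integrable lborel (\<lambda>x. f x * (x * exp (- p * x)))"
proof (rule Bochner_Integration.integrable_bound[OF x_f_integrable])
  show "AE x in lborel. norm (f x * (x * exp (- p * x))) \<le> norm (x * f x)"
  proof (rule AE_I2)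
    fix x
    show "norm (f x * (x * exp (- p * x))) \<le> norm (x * f x)"
      using f_zero[of x] assms mult_left_le[of "exp (- p * x)" "f x * x"] f_nonneg[of x]
      by (cases "0 < x") (auto simp: abs_mult mult_ac)
  qed
qed measurable

lemma F_nonneg: assumes "0 \<le> p" shows "0 \<le> F p"
  unfolding F_def
proof (rule Bochner_Integration.integral_nonneg)
  show "0 \<le> f x * (1 - exp (- p * x))" for x
    using exp_bounds(1)[of p x] f_nonneg[of x] f_zero[of x] assms by (cases "0 < x") auto
qed

lemma G_nonneg: "0 \<le> G p"
  unfolding G_def
proof (rule Bochner_Integration.integral_nonneg)
  show "0 \<le> f x * (x * exp (- p * x))" for x
    using f_nonneg[of x] f_zero[of x] by (cases "0 < x") auto
qed

lemma F_le: assumes "0 \<le> p" shows "F p \<le> p"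
proof -
  have "F p \<le> (\<integral>x. p * (x * f x) \<partial>lborel)"
    unfolding F_def
  proof (intro integral_mono F_integrable assms)
    fix x show "f x * (1 - exp (- p * x)) \<le> p * (x * f x)"
      using mult_left_mono[OF exp_bounds(2)[of p x] f_nonneg[of x]] assms f_zero[of x]
      by (cases "0 < x") (auto simp: mult_ac)
  qed (use x_f_integrable in simp)
  then show ?thesis using x_f_integral by simp
qed

text \<open>For \<open>\<psi> x = 1 - exp (- p * x)\<close> the expression
  \<open>\<psi> y + \<psi> z - \<psi> (y + z)\<close> factorises into
  \<open>\<psi> y * \<psi> z\<close>. For the constant kernel 2 the identity is the Bernoulli
  equation F - p F' = F^2, whose solution with slope 1 at 0 is p / (1 + p).\<close>

lemma laplace_eq:
  assumes "0 < p"
  shows "integrable lborel2 (\<lambda>(y, z). K y z * f y * f z * ((1 - exp (- p * y)) * (1 - exp (- p * z))))"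
    and "2 * (F p - p * G p) =
      (\<integral>(y, z). K y z * f y * f z * ((1 - exp (- p * y)) * (1 - exp (- p * z))) \<partial>lborel2)"
proof -
  have a: "((\<lambda>x. 1 - exp (- p * x)) has_real_derivative p * exp (- p * x)) (at x)" for x
    by (auto intro!: derivative_eq_intros)
  have b: "continuous_on {0<..} (\<lambda>x. p * exp (- p * x))"
    by (intro continuous_intros)
  have e: "f x * ((1 - exp (- p * x)) - x * (p * exp (- p * x))) = f x * (1 - exp (- p * x)) - p * (f x * (x * exp (- p * x)))" for x
    by (simp add: algebra_simps)
  have c: "integrable lborel (\<lambda>x. f x * ((1 - exp (- p * x)) - x * (p * exp (- p * x))))"
    unfolding e using assms by (intro Bochner_Integration.integrable_diff F_integrable integrable_mult_right G_integrable) auto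
  have d: "(\<integral>x. f x * ((1 - exp (- p * x)) - x * (p * exp (- p * x))) \<partial>lborel) = F p - p * G p"
    unfolding e F_def G_def using assms F_integrable[of p] G_integrable[of p]
    by (subst Bochner_Integration.integral_diff) auto
  have s: "(1 - exp (- p * y)) + (1 - exp (- p * z)) - (1 - exp (- p * (y + z))) =
    (1 - exp (- p * y)) * (1 - exp (- p * z))" for y z
  proof -
    have "exp (- p * (y + z)) = exp (- p * y) * exp (- p * z)"
      by (subst exp_add[symmetric]) (simp add: algebra_simps)
    then show ?thesis by (simp only: algebra_simps)
  qed
  show "integrable lborel2 (\<lambda>(y, z). K y z * f y * f z * ((1 - exp (- p * y)) * (1 - exp (- p * z))))"
    using weak_form(1)[OF a b c] unfolding s .
  show "2 * (F p - p * G p) =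
      (\<integral>(y, z). K y z * f y * f z * ((1 - exp (- p * y)) * (1 - exp (- p * z))) \<partial>lborel2)"
    using weak_form(2)[OF a b c] unfolding s d .
qed

text \<open>Only the lower bound of \<open>K\<close> enters, so no moment beyond the first is
  required; the matching upper bound has to wait for the second moment.\<close>

lemma laplace_lower:
  assumes "0 < p"
  shows "(1 - \<epsilon> / 2) * (F p)\<^sup>2 \<le> F p - p * G p"
proof -
  define h where "h x = f x * (1 - exp (- p * x))" for x
  have h: "integrable lborel h" "(\<integral>x. h x \<partial>lborel) = F p"
    using F_integrable[of p] assms unfolding h_def F_def by auto
  have "(2 - \<epsilon>) * (F p)\<^sup>2 = (\<integral>p. (2 - \<epsilon>) * (case p of (y, z) \<Rightarrow> h y * h z) \<partial>lborel2)"
    using integral_product[OF h(1) h(1)] by (simp add: h power2_eq_square)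
  also have "\<dots> \<le> (\<integral>(y, z). K y z * f y * f z * ((1 - exp (- p * y)) * (1 - exp (- p * z))) \<partial>lborel2)"
  proof (intro integral_mono laplace_eq assms)
    show "integrable lborel2 (\<lambda>p. (2 - \<epsilon>) * (case p of (y, z) \<Rightarrow> h y * h z))"
      using integral_product[OF h(1) h(1)] by simp
    fix q :: "real \<times> real" obtain y z where q: "q = (y, z)" by (cases q)
    show "(2 - \<epsilon>) * (case q of (y, z) \<Rightarrow> h y * h z) \<le> (case q of (y, z) \<Rightarrow> K y z * f y * f z * ((1 - exp (- p * y)) * (1 - exp (- p * z))))"
    proof (cases "0 < y \<and> 0 < z")
      case True
      then have "(2 - \<epsilon>) * (h y * h z) \<le> K y z * (h y * h z)"
        using exp_bounds(1)[of p y] exp_bounds(1)[of p z] assms f_nonneg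
        by (intro mult_right_mono K_lower) (auto simp: h_def)
      then show ?thesis by (simp add: q h_def mult_ac)
    qed (auto simp: q h_def f_zero not_less)
  qed
  also have "\<dots> = 2 * (F p - p * G p)" by (rule laplace_eq(2)[OF assms, symmetric])
  finally show ?thesis by (simp add: field_simps)
qed

text \<open>The term \<open>p * G p\<close> has the good sign, so \<open>laplace_lower\<close>
  leaves a quadratic inequality for \<open>F p\<close> alone, uniform in p.\<close>

lemma F_le_bound: assumes "0 < p" shows "F p \<le> 1 / (1 - \<epsilon> / 2)"
proof (cases "F p = 0")
  case False
  then have pos: "0 < F p" using F_nonneg[of p] assms by simp
  have "(1 - \<epsilon> / 2) * F p * F p \<le> 1 * F p"
    using laplace_lower[OF assms] mult_nonneg_nonneg[OF less_imp_le[OF assms] G_nonneg[of p]]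
    unfolding power2_eq_square mult.assoc by linarith
  then have "(1 - \<epsilon> / 2) * F p \<le> 1" using pos by (rule mult_right_le_imp_le)
  then show ?thesis using eps by (simp add: field_simps)
qed (use eps in simp)

text \<open>The integrand of \<open>F p\<close> tends to \<open>f\<close> as p grows, and the bound
  on \<open>F p\<close> does not depend on p.\<close>

lemma f_integrable: "integrable lborel f" and f_integral_le: "(\<integral>x. f x \<partial>lborel) \<le> 1 / (1 - \<epsilon> / 2)"
proof -
  let ?u = "\<lambda>n x. f x * (1 - exp (- real (Suc n) * x))"
  have lim: "(\<lambda>n. ?u n x) \<longlonglongrightarrow> f x" for x
  proof (cases "0 < x")
    case True
    have "(\<lambda>n. exp (- x) ^ Suc n) \<longlonglongrightarrow> 0"
      using True by (intro LIMSEQ_Suc LIMSEQ_realpow_zero) auto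
    also have "(\<lambda>n. exp (- x) ^ Suc n) = (\<lambda>n. exp (- real (Suc n) * x))"
      by (subst exp_of_nat_mult[symmetric]) (simp only: mult_minus_left mult_minus_right)
    finally have "(\<lambda>n. f x * (1 - exp (- real (Suc n) * x))) \<longlonglongrightarrow> f x * (1 - 0)"
      by (intro tendsto_intros)
    then show ?thesis by simp
  qed (simp add: f_zero)
  have nn: "0 \<le> ?u n x" for n x
    using exp_bounds(1)[of "real (Suc n)" x] f_nonneg[of x] f_zero[of x]
    by (cases "0 < x") auto
  have 1: "integrable lborel (?u n)" for n by (rule F_integrable) simp
  have 2: "(\<integral>x. ?u n x \<partial>lborel) \<le> 1 / (1 - \<epsilon> / 2)" for n
    using F_le_bound[of "real (Suc n)"] unfolding F_def by simp
  show "integrable lborel f" "(\<integral>x. f x \<partial>lborel) \<le> 1 / (1 - \<epsilon> / 2)"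
    by (rule integrable_fatou_bound[where u = ?u, OF 1 nn 2 lim])+
qed

lemma f_integral_le_2: "(\<integral>x. f x \<partial>lborel) \<le> 2"
proof -
  have "1 / (1 - \<epsilon> / 2) \<le> 2" using eps by (simp add: field_simps)
  then show ?thesis using f_integral_le by linarith
qed

lemma f_integral_le_eps: "(\<integral>x. f x \<partial>lborel) \<le> 1 + \<epsilon>"
proof -
  have "\<epsilon> * \<epsilon> \<le> \<epsilon>" using eps by (simp add: mult_left_le)
  then have "1 / (1 - \<epsilon> / 2) \<le> 1 + \<epsilon>" using eps by (simp add: field_simps)
  then show ?thesis using f_integral_le by simp
qed

lemma powr_1_integrable:
  assumes "0 \<le> c" "c \<le> 1"
  shows "integrable lborel (\<lambda>x. f x * x powr c)" "(\<integral>x. f x * x powr c \<partial>lborel) \<le> 3"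
proof -
  have b: "f x * x powr c \<le> f x + x * f x" for x
  proof (cases "0 < x")
    case True
    then have "f x * x powr c \<le> f x * (1 + x)"
      by (intro mult_left_mono powr_le_one_plus f_nonneg) (use assms in auto)
    then show ?thesis by (simp add: algebra_simps)
  qed (simp add: f_zero)
  have n: "0 \<le> f x * x powr c" for x by (simp add: f_nonneg)
  have d: "integrable lborel (\<lambda>x. f x + x * f x)" using f_integrable x_f_integrable by simp
  show i: "integrable lborel (\<lambda>x. f x * x powr c)"
    by (rule Bochner_Integration.integrable_bound[OF d]) (use b n in \<open>auto intro!: order_trans[OF b]\<close>)
  have "(\<integral>x. f x * x powr c \<partial>lborel) \<le> (\<integral>x. f x + x * f x \<partial>lborel)"
    by (rule integral_mono[OF i d b])
  also have "\<dots> \<le> 3" using f_integrable x_f_integrable f_integral_le_2 x_f_integral by simp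
  finally show "(\<integral>x. f x * x powr c \<partial>lborel) \<le> 3" .
qed

end

section \<open>Second moment\<close>

lemma powr_add_le:
  fixes x y c :: real
  assumes "0 \<le> x" "0 \<le> y" "0 \<le> c" "c \<le> 1"
  shows "(x + y) powr c \<le> x powr c + y powr c"
proof (cases "x + y = 0")
  case False
  define t where "t = x + y"
  have t: "0 < t" using False assms by (simp add: t_def)
  have *: "u / t \<le> u powr c / t powr c" if "0 \<le> u" "u \<le> t" for u
  proof (cases "u = 0")
    case False
    then have "(u / t) powr 1 \<le> (u / t) powr c"
      using that t assms by (intro powr_mono') auto
    then show ?thesis using that t by (simp add: powr_divide)
  qed simp
  have "1 = x / t + y / t" using t by (simp add: t_def add_divide_distrib[symmetric])
  also have "\<dots> \<le> x powr c / t powr c + y powr c / t powr c"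
    using assms by (intro add_mono *) (auto simp: t_def)
  finally have "1 \<le> (x powr c + y powr c) / t powr c" by (simp add: add_divide_distrib)
  then show ?thesis using t by (simp add: t_def[symmetric] field_simps)
qed (use assms in auto)

text \<open>Serves the part of the kernel that is large for z much bigger than y. Up to L the
  logarithm is essentially linear; beyond L it is bounded by a power with exponent 1 - \<alpha>, at
  the price of the factor 1 / (1 - \<alpha>).\<close>

lemma second_moment_cutoff:
  fixes L z \<alpha> :: real
  assumes "1 \<le> L" "0 < z" "0 \<le> \<alpha>" "\<alpha> < 1"
  shows "z powr \<alpha> * (L * ln (1 + z / L)) \<le> 2 / (1 - \<alpha>) * (z + z\<^sup>2 / (1 + z / L))"
proof (cases "z \<le> L")
  case True
  have "L * ln (1 + z / L) \<le> L * (z / L)"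
    using assms by (intro mult_left_mono ln_add_one_self_le_self) auto
  then have "z powr \<alpha> * (L * ln (1 + z / L)) \<le> z powr \<alpha> * z"
    using assms by (intro mult_left_mono) auto
  also have "\<dots> = z powr (\<alpha> + 1)" using assms by (simp add: powr_add)
  also have "\<dots> \<le> z powr 1 + z powr 2" using assms by (intro powr_le_sum) auto
  also have "\<dots> = z + z\<^sup>2" using assms by simp
  also have "\<dots> \<le> 2 * (z + z\<^sup>2 / (1 + z / L))"
  proof -
    have "z\<^sup>2 * (1 + z / L) \<le> z\<^sup>2 * 2" using True assms by (intro mult_left_mono) auto
    then have "z\<^sup>2 \<le> 2 * (z\<^sup>2 / (1 + z / L))" using assms by (simp add: field_simps)
    then show ?thesis using assms by simp
  qed
  also have "\<dots> \<le> 2 / (1 - \<alpha>) * (z + z\<^sup>2 / (1 + z / L))"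
    using assms by (intro mult_right_mono) (auto simp: field_simps)
  finally show ?thesis .
next
  case False
  have b: "0 < 1 - \<alpha>" using assms by simp
  have "ln ((1 + z / L) powr (1 - \<alpha>)) \<le> (1 + z / L) powr (1 - \<alpha>) - 1"
    using assms by (intro ln_le_minus_one) (auto simp: add_pos_pos less_imp_neq[symmetric])
  also have "(1 + z / L) powr (1 - \<alpha>) \<le> 1 powr (1 - \<alpha>) + (z / L) powr (1 - \<alpha>)"
    using assms by (intro powr_add_le) auto
  finally have "(1 - \<alpha>) * ln (1 + z / L) \<le> (z / L) powr (1 - \<alpha>)"
    using assms by (simp add: ln_powr)
  then have "ln (1 + z / L) \<le> (z / L) powr (1 - \<alpha>) / (1 - \<alpha>)"
    using b by (simp add: field_simps)
  then have "z powr \<alpha> * (L * ln (1 + z / L)) \<le> z powr \<alpha> * (L * ((z / L) powr (1 - \<alpha>) / (1 - \<alpha>)))"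
    using assms by (intro mult_left_mono) auto
  also have "\<dots> = z powr (\<alpha> + (1 - \<alpha>)) * (L / L powr (1 - \<alpha>)) / (1 - \<alpha>)"
    using assms by (simp only: powr_add) (simp add: powr_divide)
  also have "\<dots> = z * (L / L powr (1 - \<alpha>)) / (1 - \<alpha>)" using assms by simp
  also have "\<dots> \<le> z * L / (1 - \<alpha>)"
  proof -
    have "1 \<le> L powr (1 - \<alpha>)" using assms by (intro ge_one_powr_ge_zero) auto
    then have "L / L powr (1 - \<alpha>) \<le> L" using assms by (simp add: field_simps)
    then show ?thesis using assms b by (intro divide_right_mono mult_left_mono) auto
  qed
  also have "z * L / (1 - \<alpha>) \<le> 2 * (z\<^sup>2 / (1 + z / L)) / (1 - \<alpha>)"
  proof (rule divide_right_mono)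
    have "z * L * (1 + z / L) = z * L + z * z" using assms by (simp add: distrib_left)
    also have "\<dots> \<le> z * z + z * z" using False assms by (intro add_right_mono mult_left_mono) auto
    also have "\<dots> = 2 * z\<^sup>2" by (simp add: power2_eq_square)
    finally have "z * L \<le> 2 * z\<^sup>2 / (1 + z / L)"
      using assms by (subst pos_le_divide_eq) (auto intro: add_pos_pos)
    then show "z * L \<le> 2 * (z\<^sup>2 / (1 + z / L))" by simp
  qed (use b in simp)
  also have "\<dots> = 2 / (1 - \<alpha>) * (z\<^sup>2 / (1 + z / L))" by simp
  also have "\<dots> \<le> 2 / (1 - \<alpha>) * (z + z\<^sup>2 / (1 + z / L))"
    using assms by (intro mult_left_mono) auto
  finally show ?thesis .
qed

context coag_profile
begin

text \<open>The weight is cut off so that its integral is finite beforehand, being dominated by L x,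
  and can be absorbed. The test function is the solution of
  \<open>\<psi> x - x * \<psi>' x = x^2 / (1 + x / L)\<close>. The constant part of the kernel
  contributes at most 2, twice the squared mass; everything else carries a factor \<epsilon> and is
  at most linear in the unknown integral.\<close>

lemma second_moment_truncated:
  assumes small: "36 * \<epsilon> \<le> 1 - \<alpha>" and L: "1 \<le> L"
  shows "integrable lborel (\<lambda>x. f x * (x\<^sup>2 / (1 + x / L)))"
    and "(\<integral>x. f x * (x\<^sup>2 / (1 + x / L)) \<partial>lborel) \<le> 3"
proof -
  let ?\<psi> = "\<lambda>x. - (x * (L * ln (1 + x / L)))"
  let ?\<psi>' = "\<lambda>x. - (L * ln (1 + x / L)) - x / (1 + x / L)"
  have pos: "0 < 1 + x / L" if "0 < x" for x using that L by (simp add: add_pos_pos)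
  have a: "(?\<psi> has_real_derivative ?\<psi>' x) (at x)" if "0 < x" for x
    using pos[OF that] L that by (auto intro!: derivative_eq_intros simp: field_simps)
  have b: "continuous_on {0<..} ?\<psi>'"
    using pos L by (intro continuous_intros) (auto simp: less_imp_neq[symmetric])
  define m where "m x = f x * (x\<^sup>2 / (1 + x / L))" for x
  have e: "f x * (?\<psi> x - x * ?\<psi>' x) = m x" for x
    by (simp add: m_def algebra_simps power2_eq_square)
  have m0: "0 \<le> m x" for x
    using f_zero[of x] f_nonneg[of x] pos[of x] by (cases "0 < x") (auto simp: m_def)
  have [measurable]: "m \<in> borel_measurable borel" unfolding m_def by measurable
  have mL: "m x \<le> L * (x * f x)" for x
  proof (cases "0 < x")
    case True
    have "x\<^sup>2 / (1 + x / L) \<le> L * x"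
      using True L pos[of x] by (simp add: field_simps power2_eq_square)
    from mult_left_mono[OF this f_nonneg[of x]] show ?thesis unfolding m_def by (simp only: mult_ac)
  qed (simp add: m_def f_zero)
  have mi: "integrable lborel m"
  proof (rule Bochner_Integration.integrable_bound)
    show "integrable lborel (\<lambda>x. L * (x * f x))" using x_f_integrable by simp
    show "AE x in lborel. norm (m x) \<le> norm (L * (x * f x))"
      using mL m0 by (auto intro!: order_trans[OF mL])
  qed measurable
  define I where "I = (\<integral>x. m x \<partial>lborel)"
  note w = weak_form_aux[OF a b, unfolded e, OF _ mi]
  define c where "c = 2 / (1 - \<alpha>)"
  have c: "0 \<le> c" using alpha by (simp add: c_def)
  define a1 where "a1 x = x * f x" for x
  define a2 where "a2 x = f x * x powr (1 - \<alpha>)" for x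
  have i1: "integrable lborel a1" "(\<integral>x. a1 x \<partial>lborel) = 1"
    using x_f_integrable x_f_integral by (auto simp: a1_def[abs_def])
  have i2: "integrable lborel a2" "(\<integral>x. a2 x \<partial>lborel) \<le> 3"
    using powr_1_integrable[of "1 - \<alpha>"] alpha by (auto simp: a2_def[abs_def])
  define a3 where "a3 x = a1 x + m x" for x
  have i3: "integrable lborel a3" "(\<integral>x. a3 x \<partial>lborel) = 1 + I"
    using i1 mi by (auto simp: a3_def[abs_def] I_def)
  have a10: "0 \<le> a1 x" for x using f_nonneg[of x] f_zero[of x] by (cases "0 < x") (auto simp: a1_def)
  have a20: "0 \<le> a2 x" for x using f_nonneg[of x] by (auto simp: a2_def)
  have a30: "0 \<le> a3 x" for x using m0[of x] f_nonneg[of x] f_zero[of x] by (cases "0 < x") (auto simp: a3_def a1_def)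
  have I0: "0 \<le> I" unfolding I_def using m0 by (intro Bochner_Integration.integral_nonneg)
  define R where "R = (\<lambda>q. 2 * (case q of (y, z) \<Rightarrow> a1 y * a1 z) + \<epsilon> * (case q of (y, z) \<Rightarrow> a3 y * a2 z)
     + \<epsilon> * c * (case q of (y, z) \<Rightarrow> a2 y * a3 z))"
  have Ri: "integrable lborel2 R" "(\<integral>q. R q \<partial>lborel2) = 2 + \<epsilon> * ((1 + I) * (\<integral>x. a2 x \<partial>lborel)) + \<epsilon> * c * ((\<integral>x. a2 x \<partial>lborel) * (1 + I))"
    unfolding R_def using integral_product[OF i1(1) i1(1)] integral_product[OF i3(1) i2(1)] integral_product[OF i2(1) i3(1)]
    by (simp_all add: i1 i3)
  have "I = (\<integral>(y, z). K y z * f y * f z * (?\<psi> y - y * ?\<psi> (y + z) / (y + z)) \<partial>lborel2)"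
    unfolding I_def by (rule w(2)) auto
  also have "\<dots> \<le> (\<integral>q. R q \<partial>lborel2)"
  proof (rule integral_mono)
    show "integrable lborel2 (\<lambda>(y, z). K y z * f y * f z * (?\<psi> y - y * ?\<psi> (y + z) / (y + z)))"
      by (rule w(1)) auto
    show "integrable lborel2 R" by (rule Ri)
    fix q :: "real \<times> real"
    obtain y z where q: "q = (y, z)" by (cases q)
    show "(case q of (y, z) \<Rightarrow> K y z * f y * f z * (?\<psi> y - y * ?\<psi> (y + z) / (y + z))) \<le> R q"
    proof (cases "0 < y \<and> 0 < z")
      case True
      then have y: "0 < y" and z: "0 < z" by auto
      \<comment> \<open>\<open>Q\<close> is bounded in two ways: by
        \<open>z * (y / (1 + y / L))\<close> against the kernel power that is large for y >> z, and
        by \<open>y * (L * ln (1 + z / L))\<close> against the one that is large for z >> y. Thus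
        the cutoff always sits on the variable with the higher power.\<close>
      define Q where "Q = y * (L * ln (1 + z / (L + y)))"
      have "L * ln (1 + (y + z) / L) - L * ln (1 + y / L) = L * ln ((1 + (y + z) / L) / (1 + y / L))"
        using pos[OF y] pos[of "y + z"] y z by (simp add: ln_div right_diff_distrib)
      also have "(1 + (y + z) / L) / (1 + y / L) = 1 + z / (L + y)"
        using L y z by (simp add: divide_simps)
      finally have Qe: "?\<psi> y - y * ?\<psi> (y + z) / (y + z) = Q"
        using y z by (simp add: Q_def right_diff_distrib[symmetric])
      have Q0: "0 \<le> Q" using y z L by (simp add: Q_def)
      have "ln (1 + z / (L + y)) \<le> z / (L + y)"
        using y z L by (intro ln_add_one_self_le_self) auto
      then have "Q \<le> y * (L * (z / (L + y)))"
        unfolding Q_def using y L by (intro mult_left_mono) auto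
      also have "\<dots> = z * (y / (1 + y / L))" using L y by (simp add: field_simps)
      finally have Q1: "Q \<le> z * (y / (1 + y / L))" .
      also have "\<dots> \<le> z * y" using y z L by (intro mult_left_mono) (auto simp: field_simps)
      finally have Q2: "Q \<le> y * z" by (simp add: mult.commute)
      have "ln (1 + z / (L + y)) \<le> ln (1 + z / L)"
        using y z L by (intro ln_mono add_left_mono divide_left_mono) (auto simp: add_pos_pos)
      then have Q3: "Q \<le> y * (L * ln (1 + z / L))"
        unfolding Q_def using y L by (intro mult_left_mono) auto
      have "(y / z) powr \<alpha> * Q \<le> (y / z) powr \<alpha> * (z * (y / (1 + y / L)))"
        using Q1 by (intro mult_left_mono) auto
      also have "\<dots> = z powr (1 - \<alpha>) * (y powr (1 + \<alpha>) / (1 + y / L))"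
        using y z by (simp add: powr_divide powr_diff powr_add)
      also have "\<dots> \<le> z powr (1 - \<alpha>) * (y + y\<^sup>2 / (1 + y / L))"
      proof (intro mult_left_mono)
        have "y powr (1 + \<alpha>) \<le> y powr 1 + y powr 2" using y alpha by (intro powr_le_sum) auto
        then have "y powr (1 + \<alpha>) / (1 + y / L) \<le> (y + y\<^sup>2) / (1 + y / L)"
          using y L pos[OF y] by (intro divide_right_mono) auto
        also have "\<dots> \<le> y + y\<^sup>2 / (1 + y / L)"
        proof -
          have "y * 1 \<le> y * (1 + y / L)" using y L by (intro mult_left_mono) auto
          then have "y / (1 + y / L) \<le> y" using pos[OF y] by (subst pos_divide_le_eq) auto
          then show ?thesis by (simp only: add_divide_distrib)
        qed
        finally show "y powr (1 + \<alpha>) / (1 + y / L) \<le> y + y\<^sup>2 / (1 + y / L)" .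
      qed simp
      finally have B1: "(y / z) powr \<alpha> * Q \<le> z powr (1 - \<alpha>) * (y + y\<^sup>2 / (1 + y / L))" .
      have "(z / y) powr \<alpha> * Q \<le> (z / y) powr \<alpha> * (y * (L * ln (1 + z / L)))"
        using Q3 by (intro mult_left_mono) auto
      also have "\<dots> = y powr (1 - \<alpha>) * (z powr \<alpha> * (L * ln (1 + z / L)))"
        using y z by (simp add: powr_divide powr_diff powr_add)
      also have "\<dots> \<le> y powr (1 - \<alpha>) * (c * (z + z\<^sup>2 / (1 + z / L)))"
        unfolding c_def using second_moment_cutoff[OF L z alpha] by (intro mult_left_mono) auto
      finally have B2: "(z / y) powr \<alpha> * Q \<le> y powr (1 - \<alpha>) * (c * (z + z\<^sup>2 / (1 + z / L)))" .
      have "K y z * Q \<le> (2 + \<epsilon> * ((y / z) powr \<alpha> + (z / y) powr \<alpha>)) * Q"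
        using K_upper[OF y z] Q0 by (rule mult_right_mono)
      also have "\<dots> = 2 * Q + \<epsilon> * ((y / z) powr \<alpha> * Q) + \<epsilon> * ((z / y) powr \<alpha> * Q)"
        by (simp add: algebra_simps)
      also have "\<dots> \<le> 2 * (y * z) + \<epsilon> * (z powr (1 - \<alpha>) * (y + y\<^sup>2 / (1 + y / L)))
         + \<epsilon> * (y powr (1 - \<alpha>) * (c * (z + z\<^sup>2 / (1 + z / L))))"
        using Q2 B1 B2 eps by (intro add_mono mult_left_mono) auto
      finally have "f y * f z * (K y z * Q) \<le> f y * f z * (2 * (y * z) + \<epsilon> * (z powr (1 - \<alpha>) * (y + y\<^sup>2 / (1 + y / L)))
         + \<epsilon> * (y powr (1 - \<alpha>) * (c * (z + z\<^sup>2 / (1 + z / L)))))"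
        using f_nonneg by (intro mult_left_mono) auto
      also have "\<dots> = R q"
        unfolding R_def q prod.case a1_def a2_def a3_def m_def by (simp only: algebra_simps)
      finally show ?thesis unfolding q prod.case Qe by (simp add: mult_ac)
    next
      case False
      have "0 \<le> R q" unfolding R_def q prod.case using a10 a20 a30 eps c
        by (intro add_nonneg_nonneg mult_nonneg_nonneg) auto
      then show ?thesis using False by (auto simp: q K_zero)
    qed
  qed
  also have "\<dots> = 2 + \<epsilon> * (1 + c) * (1 + I) * (\<integral>x. a2 x \<partial>lborel)"
    unfolding Ri by (simp add: algebra_simps)
  also have "\<dots> \<le> 2 + \<epsilon> * (1 + c) * (1 + I) * 3"
    using i2(2) eps c I0 by (intro add_left_mono mult_left_mono) auto
  \<comment> \<open>With 1 / 12 the inequality reads I \<le> 2 + (1 + I) / 4, that is I \<le> 3. The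
    36 in the assumption is 3 * 12, since \<open>1 + c\<close> is at most 3 / (1 -
    \<alpha>).\<close>
  also have "\<epsilon> * (1 + c) \<le> 1 / 12"
  proof -
    have "1 \<le> 1 / (1 - \<alpha>)" using alpha by simp
    moreover have "3 / (1 - \<alpha>) = 1 / (1 - \<alpha>) + 2 / (1 - \<alpha>)" by (simp add: add_divide_distrib[symmetric])
    ultimately have "1 + c \<le> 3 / (1 - \<alpha>)" unfolding c_def by linarith
    then have "\<epsilon> * (1 + c) \<le> \<epsilon> * (3 / (1 - \<alpha>))" using eps by (intro mult_left_mono) auto
    also have "\<dots> \<le> 1 / 12" using small alpha by (simp add: field_simps)
    finally show ?thesis .
  qed
  finally have "I \<le> 2 + 1 / 12 * (1 + I) * 3" using I0 by simp
  then have "I \<le> 3" by (simp add: field_simps)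
  then show "(\<integral>x. f x * (x\<^sup>2 / (1 + x / L)) \<partial>lborel) \<le> 3" by (simp add: I_def m_def)
  show "integrable lborel (\<lambda>x. f x * (x\<^sup>2 / (1 + x / L)))" using mi by (simp add: m_def[abs_def])
qed

lemma second_moment:
  assumes small: "36 * \<epsilon> \<le> 1 - \<alpha>"
  shows "integrable lborel (\<lambda>x. f x * x\<^sup>2)" "(\<integral>x. f x * x\<^sup>2 \<partial>lborel) \<le> 3"
proof -
  let ?u = "\<lambda>n x. f x * (x\<^sup>2 / (1 + x / real (Suc n)))"
  have lim: "(\<lambda>n. ?u n x) \<longlonglongrightarrow> f x * x\<^sup>2" for x
  proof -
    have "(\<lambda>n. x * (1 / real (Suc n))) \<longlonglongrightarrow> x * 0"
      by (intro tendsto_mult tendsto_const LIMSEQ_Suc lim_1_over_n)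
    then have "(\<lambda>n. f x * (x\<^sup>2 / (1 + x / real (Suc n)))) \<longlonglongrightarrow> f x * (x\<^sup>2 / (1 + 0))"
      by (intro tendsto_intros) auto
    then show ?thesis by simp
  qed
  have nn: "0 \<le> ?u n x" for n x
    using f_nonneg[of x] f_zero[of x] by (cases "0 < x") auto
  note 1 = second_moment_truncated[OF small]
  show "integrable lborel (\<lambda>x. f x * x\<^sup>2)" "(\<integral>x. f x * x\<^sup>2 \<partial>lborel) \<le> 3"
    by (rule integrable_fatou_bound[where u = ?u, OF 1(1) nn 1(2) lim], simp_all)+
qed

end

section \<open>Perturbed differential equation for the Laplace transform\<close>

lemma exp_minus_le_quadratic:
  fixes t :: real assumes "0 \<le> t" shows "exp (- t) \<le> 1 - t + t\<^sup>2 / 2"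
proof -
  have "1 \<le> (1 - t + t\<^sup>2 / 2) * (1 + t + t\<^sup>2 / 2)"
  proof -
    have "(1 - t + t\<^sup>2 / 2) * (1 + t + t\<^sup>2 / 2) = 1 + (t\<^sup>2)\<^sup>2 / 4"
      by (simp add: algebra_simps power2_eq_square)
    then show ?thesis by simp
  qed
  also have "\<dots> \<le> (1 - t + t\<^sup>2 / 2) * exp t"
  proof (rule mult_left_mono[OF exp_lower_Taylor_quadratic[OF assms]])
    have "0 \<le> (1 - t)\<^sup>2 + 1" by simp
    then show "0 \<le> 1 - t + t\<^sup>2 / 2" by (simp add: power2_eq_square algebra_simps)
  qed
  finally show ?thesis by (simp add: exp_minus field_simps)
qed

text \<open>The remainder must be bounded by x^2 on both sides of p without exponential growth. For
  q < p the factor \<open>exp (- s)\<close> is large, so \<open>exp (- q * x)\<close> is taken out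
  instead of \<open>exp (- p * x)\<close>.\<close>

lemma exp_difference_bound:
  fixes p q x :: real
  assumes "0 \<le> p" "0 \<le> q" "0 \<le> x"
  shows "\<bar>exp (- p * x) - exp (- q * x) - (q - p) * (x * exp (- p * x))\<bar> \<le> (q - p)\<^sup>2 * x\<^sup>2"
proof -
  define s where "s = (q - p) * x"
  have q: "exp (- q * x) = exp (- p * x) * exp (- s)"
    by (subst exp_add[symmetric]) (simp add: s_def algebra_simps)
  have e: "exp (- p * x) - exp (- q * x) - (q - p) * (x * exp (- p * x)) = exp (- p * x) * (1 - exp (- s) - s)"
    unfolding q s_def by (simp add: algebra_simps)
  have neg: "1 - exp (- s) - s \<le> 0" using exp_ge_add_one_self[of "- s"] by simp
  have "exp (- p * x) * (s - 1 + exp (- s)) \<le> s\<^sup>2"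
  proof (cases "0 \<le> s")
    case True
    have "s - 1 + exp (- s) \<le> s\<^sup>2" using exp_minus_le_quadratic[OF True] zero_le_power2[of s] by linarith
    moreover have "exp (- p * x) * (s - 1 + exp (- s)) \<le> 1 * (s - 1 + exp (- s))"
      using assms neg by (intro mult_right_mono) auto
    ultimately show ?thesis unfolding mult_1_left by (rule order_trans[rotated])
  next
    case False
    have "exp (- p * x) * (s - 1 + exp (- s)) = exp (- q * x) * (exp s * (s - 1) + 1)"
    proof -
      have ee: "exp (- s) * exp s = 1" by (simp add: exp_minus)
      have "exp (- p * x) * (s - 1 + exp (- s)) = exp (- p * x) * ((exp (- s) * exp s) * (s - 1) + exp (- s))"
        unfolding ee by simp
      also have "\<dots> = exp (- q * x) * (exp s * (s - 1) + 1)"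
        unfolding q by (simp only: algebra_simps)
      finally show ?thesis .
    qed
    also have "\<dots> \<le> 1 * (exp s * (s - 1) + 1)"
    proof (rule mult_right_mono)
      have "exp s * (1 - s) \<le> exp s * exp (- s)"
        using exp_ge_add_one_self[of "- s"] by (intro mult_left_mono) auto
      then show "0 \<le> exp s * (s - 1) + 1" by (simp add: exp_minus algebra_simps)
    qed (use assms in simp)
    also have "\<dots> \<le> s\<^sup>2"
    proof -
      have "(1 + s) * (1 - s) \<le> exp s * (1 - s)"
        using exp_ge_add_one_self[of s] False by (intro mult_right_mono) auto
      then show ?thesis by (simp add: algebra_simps power2_eq_square)
    qed
    finally show ?thesis .
  qed
  moreover have "\<bar>exp (- p * x) * (1 - exp (- s) - s)\<bar> = exp (- p * x) * (s - 1 + exp (- s))"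
    using neg by (simp add: abs_mult)
  moreover have "s\<^sup>2 = (q - p)\<^sup>2 * x\<^sup>2" by (simp add: s_def power_mult_distrib)
  ultimately show ?thesis unfolding e by simp
qed

context coag_profile
begin

lemma powr_2_integrable:
  assumes small: "36 * \<epsilon> \<le> 1 - \<alpha>" and "0 \<le> c" "c \<le> 2"
  shows "integrable lborel (\<lambda>x. f x * x powr c)" "(\<integral>x. f x * x powr c \<partial>lborel) \<le> 5"
proof -
  have b: "f x * x powr c \<le> f x + f x * x\<^sup>2" for x
  proof (cases "0 < x")
    case True
    then have "f x * x powr c \<le> f x * (x powr 0 + x powr 2)"
      by (intro mult_left_mono powr_le_sum f_nonneg) (use assms in auto)
    then show ?thesis using True by (simp add: algebra_simps)
  qed (simp add: f_zero)
  have n: "0 \<le> f x * x powr c" for x by (simp add: f_nonneg)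
  have d: "integrable lborel (\<lambda>x. f x + f x * x\<^sup>2)" using f_integrable second_moment[OF small] by simp
  show i: "integrable lborel (\<lambda>x. f x * x powr c)"
    by (rule Bochner_Integration.integrable_bound[OF d]) (use b n in \<open>auto intro!: order_trans[OF b]\<close>)
  have "(\<integral>x. f x * x powr c \<partial>lborel) \<le> (\<integral>x. f x + f x * x\<^sup>2 \<partial>lborel)"
    by (rule integral_mono[OF i d b])
  also have "\<dots> \<le> 5" using f_integrable f_integral_le_2 second_moment[OF small] by simp
  finally show "(\<integral>x. f x * x powr c \<partial>lborel) \<le> 5" .
qed

text \<open>In the perturbation both factors are linearised,
  \<open>Q \<le> (p * y) * (p * z)\<close>. The kernel bound then produces moments of order 1 +
  \<alpha> and 1 - \<alpha>, which are at most 5 and 3; the first of them is finite thanks to the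
  second moment.\<close>

lemma laplace_upper:
  assumes small: "36 * \<epsilon> \<le> 1 - \<alpha>" and p: "0 < p"
  shows "F p - p * G p \<le> (F p)\<^sup>2 + 15 * \<epsilon> * p\<^sup>2"
proof -
  define h where "h x = f x * (1 - exp (- p * x))" for x
  have h: "integrable lborel h" "(\<integral>x. h x \<partial>lborel) = F p"
    using F_integrable[of p] p unfolding h_def F_def by auto
  define a where "a x = f x * x powr (1 + \<alpha>)" for x
  define b where "b x = f x * x powr (1 - \<alpha>)" for x
  have a: "integrable lborel a" "(\<integral>x. a x \<partial>lborel) \<le> 5"
    using powr_2_integrable[OF small, of "1 + \<alpha>"] alpha unfolding a_def by auto
  have b: "integrable lborel b" "(\<integral>x. b x \<partial>lborel) \<le> 3"
    using powr_1_integrable[of "1 - \<alpha>"] alpha unfolding b_def by auto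
  have ab0: "0 \<le> (\<integral>x. a x \<partial>lborel)" "0 \<le> (\<integral>x. b x \<partial>lborel)"
    using f_nonneg by (auto intro!: Bochner_Integration.integral_nonneg simp: a_def b_def)
  define R where "R = (\<lambda>q. 2 * (case q of (y, z) \<Rightarrow> h y * h z) + \<epsilon> * p\<^sup>2 * (case q of (y, z) \<Rightarrow> a y * b z)
     + \<epsilon> * p\<^sup>2 * (case q of (y, z) \<Rightarrow> b y * a z))"
  have Ri: "integrable lborel2 R" "(\<integral>q. R q \<partial>lborel2) = 2 * (F p * F p) + 2 * (\<epsilon> * p\<^sup>2) * ((\<integral>x. a x \<partial>lborel) * (\<integral>x. b x \<partial>lborel))"
    unfolding R_def using integral_product[OF h(1) h(1)] integral_product[OF a(1) b(1)] integral_product[OF b(1) a(1)]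
    by (simp_all add: h)
  have "2 * (F p - p * G p) = (\<integral>(y, z). K y z * f y * f z * ((1 - exp (- p * y)) * (1 - exp (- p * z))) \<partial>lborel2)"
    by (rule laplace_eq(2)[OF p])
  also have "\<dots> \<le> (\<integral>q. R q \<partial>lborel2)"
  proof (intro integral_mono laplace_eq p Ri)
    fix q :: "real \<times> real"
    obtain y z where q: "q = (y, z)" by (cases q)
    show "(case q of (y, z) \<Rightarrow> K y z * f y * f z * ((1 - exp (- p * y)) * (1 - exp (- p * z)))) \<le> R q"
    proof (cases "0 < y \<and> 0 < z")
      case True
      then have y: "0 < y" and z: "0 < z" by auto
      define Q where "Q = (1 - exp (- p * y)) * (1 - exp (- p * z))"
      have Q0: "0 \<le> Q" unfolding Q_def using exp_bounds(1)[of p] y z p by (intro mult_nonneg_nonneg) auto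
      have Q1: "Q \<le> (p * y) * (p * z)" unfolding Q_def using exp_bounds[of p] y z p by (intro mult_mono) auto
      have "K y z * Q \<le> (2 + \<epsilon> * ((y / z) powr \<alpha> + (z / y) powr \<alpha>)) * Q"
        using K_upper[OF y z] Q0 by (rule mult_right_mono)
      also have "\<dots> = 2 * Q + \<epsilon> * ((y / z) powr \<alpha> * Q) + \<epsilon> * ((z / y) powr \<alpha> * Q)"
        by (simp add: algebra_simps)
      also have "\<dots> \<le> 2 * Q + \<epsilon> * ((y / z) powr \<alpha> * ((p * y) * (p * z))) + \<epsilon> * ((z / y) powr \<alpha> * ((p * y) * (p * z)))"
        using Q1 eps by (intro add_mono mult_left_mono) auto
      also have "(y / z) powr \<alpha> * ((p * y) * (p * z)) = p\<^sup>2 * (y powr (1 + \<alpha>) * z powr (1 - \<alpha>))"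
        using y z by (simp add: powr_divide powr_diff powr_add power2_eq_square)
      also have "(z / y) powr \<alpha> * ((p * y) * (p * z)) = p\<^sup>2 * (y powr (1 - \<alpha>) * z powr (1 + \<alpha>))"
        using y z by (simp add: powr_divide powr_diff powr_add power2_eq_square)
      finally have "f y * f z * (K y z * Q) \<le> f y * f z * (2 * Q + \<epsilon> * (p\<^sup>2 * (y powr (1 + \<alpha>) * z powr (1 - \<alpha>)))
          + \<epsilon> * (p\<^sup>2 * (y powr (1 - \<alpha>) * z powr (1 + \<alpha>))))"
        using f_nonneg by (intro mult_left_mono) auto
      also have "\<dots> = R q"
        unfolding R_def q prod.case a_def b_def h_def Q_def by (simp only: algebra_simps)
      finally show ?thesis unfolding q prod.case Q_def by (simp only: mult_ac)
    next
      case False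
      then show ?thesis by (auto simp: q R_def a_def b_def h_def not_less f_zero)
    qed
  qed
  also have "\<dots> \<le> 2 * (F p * F p) + 2 * (\<epsilon> * p\<^sup>2) * (5 * 3)"
    unfolding Ri using a b ab0 eps by (intro add_left_mono mult_left_mono mult_mono) auto
  finally show ?thesis by (simp add: power2_eq_square)
qed

lemma F_mono: assumes "0 \<le> p" "p \<le> q" shows "F p \<le> F q"
  unfolding F_def
proof (rule integral_mono)
  fix x show "f x * (1 - exp (- p * x)) \<le> f x * (1 - exp (- q * x))"
    using assms f_nonneg[of x] f_zero[of x]
    by (cases "0 < x") (auto intro!: mult_left_mono simp: mult_right_mono)
next
  show "integrable lborel (\<lambda>x. f x * (1 - exp (- p * x)))" "integrable lborel (\<lambda>x. f x * (1 - exp (- q * x)))"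
    using assms by (intro F_integrable; simp)+
qed

lemma F_lower_quadratic:
  assumes small: "36 * \<epsilon> \<le> 1 - \<alpha>" and p: "0 \<le> p"
  shows "p - 3 / 2 * p\<^sup>2 \<le> F p"
proof -
  have i: "integrable lborel (\<lambda>x. p * (x * f x) - p\<^sup>2 / 2 * (f x * x\<^sup>2))"
    using x_f_integrable second_moment[OF small] by (intro Bochner_Integration.integrable_diff integrable_mult_right)
  have "p\<^sup>2 / 2 * (\<integral>x. f x * x\<^sup>2 \<partial>lborel) \<le> p\<^sup>2 / 2 * 3"
    using second_moment[OF small] by (intro mult_left_mono) auto
  then have "p - 3 / 2 * p\<^sup>2 \<le> p * (\<integral>x. x * f x \<partial>lborel) - p\<^sup>2 / 2 * (\<integral>x. f x * x\<^sup>2 \<partial>lborel)"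
    by (simp add: x_f_integral)
  also have "\<dots> = (\<integral>x. p * (x * f x) - p\<^sup>2 / 2 * (f x * x\<^sup>2) \<partial>lborel)"
    using x_f_integrable second_moment[OF small]
    by (subst Bochner_Integration.integral_diff) (auto intro: integrable_mult_right)
  also have "\<dots> \<le> F p" unfolding F_def
  proof (rule integral_mono[OF i F_integrable[OF p]])
    fix x show "p * (x * f x) - p\<^sup>2 / 2 * (f x * x\<^sup>2) \<le> f x * (1 - exp (- p * x))"
    proof (cases "0 < x")
      case True
      have "p * x - (p * x)\<^sup>2 / 2 \<le> 1 - exp (- p * x)"
        using exp_minus_le_quadratic[of "p * x"] p True by simp
      from mult_left_mono[OF this f_nonneg[of x]] show ?thesis
        by (simp add: algebra_simps power_mult_distrib)
    qed (simp add: f_zero)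
  qed
  finally show ?thesis .
qed

text \<open>Up to p = 1 / 3 the quadratic bound from the first two moments is at least p / 2; from
  there on monotonicity keeps the value 1 / 6 reached at 1 / 3.\<close>

lemma F_lower:
  assumes small: "36 * \<epsilon> \<le> 1 - \<alpha>" and p: "0 < p"
  shows "p / (6 * (1 + p)) \<le> F p"
proof (cases "p \<le> 1 / 3")
  case True
  have "p / (6 * (1 + p)) \<le> p / 2" using p by (intro divide_left_mono) auto
  also have "\<dots> \<le> p - 3 / 2 * p\<^sup>2"
    using mult_left_mono[OF True, of p] p by (simp add: power2_eq_square)
  also have "\<dots> \<le> F p" using F_lower_quadratic[OF small] p by simp
  finally show ?thesis .
next
  case False
  have "p / (6 * (1 + p)) \<le> 1 / 3 - 3 / 2 * (1 / 3)\<^sup>2" using p by (simp add: field_simps power2_eq_square)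
  also have "\<dots> \<le> F (1 / 3)" by (rule F_lower_quadratic[OF small]) simp
  also have "\<dots> \<le> F p" using False by (intro F_mono) auto
  finally show ?thesis .
qed

lemma F_deriv:
  assumes small: "36 * \<epsilon> \<le> 1 - \<alpha>" and p: "0 < p"
  shows "(F has_real_derivative G p) (at p)"
proof -
  have bound: "\<bar>F q - F p - (q - p) * G p\<bar> \<le> 3 * (q - p)\<^sup>2" if q: "0 < q" for q
  proof -
    have i: "integrable lborel (\<lambda>x. f x * (exp (- p * x) - exp (- q * x) - (q - p) * (x * exp (- p * x))))"
      (is "integrable _ ?h")
      and e: "F q - F p - (q - p) * G p = (\<integral>x. f x * (exp (- p * x) - exp (- q * x) - (q - p) * (x * exp (- p * x))) \<partial>lborel)"
    proof -
      have r: "?h = (\<lambda>x. f x * (1 - exp (- q * x)) - f x * (1 - exp (- p * x)) - (q - p) * (f x * (x * exp (- p * x))))"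
        by (auto simp: algebra_simps)
      show "integrable lborel ?h" unfolding r using p q
        by (intro Bochner_Integration.integrable_diff F_integrable integrable_mult_right G_integrable) auto
      show "F q - F p - (q - p) * G p = (\<integral>x. ?h x \<partial>lborel)"
        unfolding r F_def G_def using F_integrable[of p] F_integrable[of q] G_integrable[of p] p q by simp
    qed
    have "\<bar>\<integral>x. ?h x \<partial>lborel\<bar> \<le> (\<integral>x. \<bar>?h x\<bar> \<partial>lborel)"
      using integral_norm_bound[of lborel ?h] by simp
    also have "\<dots> \<le> (\<integral>x. (q - p)\<^sup>2 * (f x * x\<^sup>2) \<partial>lborel)"
    proof (rule integral_mono)
      show "integrable lborel (\<lambda>x. \<bar>?h x\<bar>)" using i by (rule integrable_abs)
      show "integrable lborel (\<lambda>x. (q - p)\<^sup>2 * (f x * x\<^sup>2))" using second_moment[OF small] by simp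
      fix x show "\<bar>?h x\<bar> \<le> (q - p)\<^sup>2 * (f x * x\<^sup>2)"
      proof (cases "0 < x")
        case True
        from mult_left_mono[OF exp_difference_bound[of p q x] f_nonneg[of x]] show ?thesis
          using p q True f_nonneg[of x] by (simp add: abs_mult mult_ac)
      qed (simp add: f_zero)
    qed
    also have "\<dots> \<le> (q - p)\<^sup>2 * 3" using second_moment[OF small] by (simp add: mult_left_mono)
    finally show ?thesis unfolding e by simp
  qed
  have "((\<lambda>q. (F q - F p) / (q - p)) \<longlongrightarrow> G p) (at p)"
  proof (rule tendsto_sandwich)
    have ev: "\<forall>\<^sub>F q in at p. 0 < q \<and> q \<noteq> p"
      using eventually_at_in_open[of "{0<..}" p] p by (auto elim!: eventually_mono)
    have q: "\<bar>(F q - F p) / (q - p) - G p\<bar> \<le> 3 * \<bar>q - p\<bar>" if "0 < q" "q \<noteq> p" for q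
    proof -
      have "(F q - F p) / (q - p) - G p = (F q - F p - (q - p) * G p) / (q - p)"
        using that by (simp add: field_simps)
      also have "\<bar>\<dots>\<bar> \<le> 3 * (q - p)\<^sup>2 / \<bar>q - p\<bar>"
        unfolding abs_divide using bound[OF that(1)] by (intro divide_right_mono) auto
      also have "\<dots> = 3 * \<bar>q - p\<bar>" using that by (simp add: power2_eq_square field_simps abs_if)
      finally show ?thesis .
    qed
    show "\<forall>\<^sub>F q in at p. G p - 3 * \<bar>q - p\<bar> \<le> (F q - F p) / (q - p)"
      using ev by eventually_elim (use q in fastforce)
    show "\<forall>\<^sub>F q in at p. (F q - F p) / (q - p) \<le> G p + 3 * \<bar>q - p\<bar>"
      using ev by eventually_elim (use q in fastforce)
    show "((\<lambda>q. G p - 3 * \<bar>q - p\<bar>) \<longlongrightarrow> G p) (at p)"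
      by (auto intro!: tendsto_eq_intros)
    show "((\<lambda>q. G p + 3 * \<bar>q - p\<bar>) \<longlongrightarrow> G p) (at p)"
      by (auto intro!: tendsto_eq_intros)
  qed
  then show ?thesis by (simp add: has_field_derivative_iff)
qed

text \<open>The function \<open>p / F p\<close> solves \<open>y' = 1 + R / F\<^sup>2\<close> with \<open>R = O(\<epsilon>)\<close>; for the constant kernel it is \<open>1 + p\<close>.\<close>
lemma laplace_close:
  assumes small: "36 * \<epsilon> \<le> 1 - \<alpha>" and p: "0 < p" "p \<le> P"
  shows "\<bar>F p - p / (1 + p)\<bar> \<le> 540 * \<epsilon> * (1 + P) ^ 3"
proof -
  define Y where "Y q = q / F q" for q
  have Fpos: "0 < F q" if "0 < q" for q
    using F_lower[OF small that] that by (auto intro: less_le_trans[rotated])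
  have dY: "(Y has_real_derivative (F t - t * G t) / (F t)\<^sup>2) (at t)" if "0 < t" for t
    unfolding Y_def using F_deriv[OF small that] Fpos[OF that]
    by (auto intro!: derivative_eq_intros simp: power2_eq_square)
  \<comment> \<open>540 = 15 * 36: the 15 of \<open>laplace_upper\<close> times the square of the 6
    in \<open>F_lower\<close>, which appears when R is divided by the square of F.\<close>
  define c where "c = 540 * \<epsilon> * (1 + P)\<^sup>2"
  have c0: "0 \<le> c" using eps by (simp add: c_def)
  have dYb: "\<bar>(F t - t * G t) / (F t)\<^sup>2 - 1\<bar> \<le> c" if t: "0 < t" "t \<le> P" for t
  proof -
    have F2: "0 < (F t)\<^sup>2" using Fpos[OF t(1)] by simp
    have "t \<le> F t * (6 * (1 + t))" using F_lower[OF small t(1)] t pos_divide_le_eq[of "6 * (1 + t)" t "F t"] by simp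
    then have "t\<^sup>2 \<le> (F t * (6 * (1 + t)))\<^sup>2" using t by (intro power_mono) auto
    then have "t\<^sup>2 \<le> 36 * (1 + t)\<^sup>2 * (F t)\<^sup>2" by (simp only: power_mult_distrib) (simp add: mult_ac)
    also have "\<dots> \<le> 36 * (1 + P)\<^sup>2 * (F t)\<^sup>2" using t by (intro mult_right_mono mult_left_mono power_mono) auto
    finally have "15 * \<epsilon> * t\<^sup>2 \<le> 15 * \<epsilon> * (36 * (1 + P)\<^sup>2 * (F t)\<^sup>2)" using eps by (intro mult_left_mono) auto
    then have u: "F t - t * G t \<le> (1 + c) * (F t)\<^sup>2"
      using laplace_upper[OF small t(1)] by (simp add: c_def algebra_simps)
    have "\<epsilon> / 2 \<le> c"
    proof -
      have "1 \<le> (1 + P)\<^sup>2" using t by (simp add: power2_eq_square algebra_simps)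
      then have "540 * \<epsilon> * 1 \<le> c" unfolding c_def using eps by (intro mult_left_mono) auto
      then show ?thesis using eps by simp
    qed
    then have "(1 - c) * (F t)\<^sup>2 \<le> (1 - \<epsilon> / 2) * (F t)\<^sup>2" by (intro mult_right_mono) auto
    then have l: "(1 - c) * (F t)\<^sup>2 \<le> F t - t * G t" using laplace_lower[OF t(1)] by linarith
    have "(F t - t * G t) / (F t)\<^sup>2 \<le> 1 + c" "1 - c \<le> (F t - t * G t) / (F t)\<^sup>2"
      using u l F2 by (simp_all only: pos_divide_le_eq pos_le_divide_eq)
    then show ?thesis by linarith
  qed
  have Y1: "1 \<le> Y q" if "0 < q" for q
    using F_le[of q] Fpos[OF that] that by (simp add: Y_def)
  have close: "\<bar>Y p - 1 - p\<bar> \<le> c * P"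
  proof (rule field_le_epsilon)
    fix e :: real assume e: "0 < e"
    \<comment> \<open>The mean value theorem cannot start at 0, where \<open>Y\<close> has only a
      limit. For q \<le> 1 / 3 the value \<open>Y q\<close> differs from 1 by at most 3 q; together
      with the missing piece of length q this costs 4 q \<le> e.\<close>
    define q where "q = min (p / 2) (min (1 / 3) (e / 4))"
    have q: "0 < q" "q < p" "q \<le> 1 / 3" "4 * q \<le> e" using p e by (auto simp: q_def)
    obtain t where t: "q < t" "t < p" "Y p - Y q = (p - q) * ((F t - t * G t) / (F t)\<^sup>2)"
      using MVT2[of q p Y "\<lambda>t. (F t - t * G t) / (F t)\<^sup>2"] q dY by auto
    have "Y p - Y q - (p - q) = (p - q) * ((F t - t * G t) / (F t)\<^sup>2 - 1)"
      unfolding t(3) by (simp only: right_diff_distrib mult_1_right)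
    then have "\<bar>Y p - Y q - (p - q)\<bar> = (p - q) * \<bar>(F t - t * G t) / (F t)\<^sup>2 - 1\<bar>"
      using q by (simp add: abs_mult)
    also have "\<dots> \<le> P * c" using dYb[of t] t q p by (intro mult_mono) auto
    finally have 1: "\<bar>Y p - Y q - (p - q)\<bar> \<le> c * P" by (simp add: mult.commute)
    have "q / F q \<le> 1 + 3 * q"
    proof -
      have "q \<le> (1 + 3 * q) * (q - 3 / 2 * q\<^sup>2)"
        using mult_left_mono[OF q(3), of "q * q"] q by (simp add: algebra_simps power2_eq_square)
      also have "\<dots> \<le> (1 + 3 * q) * F q" using F_lower_quadratic[OF small, of q] q by (intro mult_left_mono) auto
      finally show ?thesis using Fpos[OF q(1)] by (simp add: pos_divide_le_eq)
    qed
    then have "\<bar>Y q - 1\<bar> \<le> 3 * q" using Y1[OF q(1)] by (simp add: Y_def)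
    then show "\<bar>Y p - 1 - p\<bar> \<le> c * P + e" using 1 q by linarith
  qed
  have F: "F p = p / Y p" using Fpos[OF p(1)] p by (simp add: Y_def)
  have "F p - p / (1 + p) = p / (1 + p) * ((1 + p - Y p) / Y p)"
    unfolding F using Y1[OF p(1)] p by (simp add: diff_divide_distrib right_diff_distrib)
  also have "\<bar>\<dots>\<bar> \<le> 1 * (c * P)"
    unfolding abs_mult
  proof (rule mult_mono)
    have "\<bar>(1 + p - Y p) / Y p\<bar> \<le> \<bar>1 + p - Y p\<bar> / 1"
      unfolding abs_divide using Y1[OF p(1)] by (intro divide_left_mono) auto
    also have "\<dots> \<le> c * P" using close by simp
    finally show "\<bar>(1 + p - Y p) / Y p\<bar> \<le> c * P" .
  qed (use p in auto)
  also have "\<dots> \<le> c * (1 + P)" using c0 by (simp add: mult_left_mono)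
  also have "\<dots> = 540 * \<epsilon> * (1 + P) ^ 3" by (simp add: c_def power2_eq_square power3_eq_cube)
  finally show ?thesis .
qed

end

section \<open>Mass near zero and the negative moment\<close>

context coag_profile
begin

lemma F_le_integral: assumes "0 \<le> p" shows "F p \<le> (\<integral>x. f x \<partial>lborel)"
  unfolding F_def
proof (rule integral_mono[OF F_integrable[OF assms] f_integrable])
  fix x show "f x * (1 - exp (- p * x)) \<le> f x"
    using f_nonneg[of x] by (simp add: right_diff_distrib)
qed

text \<open>At p = 1 / d the unperturbed transform is 1 / (1 + d), at least 1 - d. A small d brings
  this close to 1 but enlarges the factor in front of \<epsilon>, so d is fixed first and \<epsilon>
  afterwards.\<close>

lemma f_integral_lower:
  assumes small: "36 * \<epsilon> \<le> 1 - \<alpha>" and d: "0 < d"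
  shows "1 - d - 540 * \<epsilon> * (1 + 1 / d) ^ 3 \<le> F (1 / d)"
    and "1 - d - 540 * \<epsilon> * (1 + 1 / d) ^ 3 \<le> (\<integral>x. f x \<partial>lborel)"
proof -
  have "(1 / d) / (1 + 1 / d) = 1 / (1 + d)" using d by (simp add: field_simps)
  moreover have "1 - d \<le> 1 / (1 + d)"
  proof -
    have "(1 - d) * (1 + d) \<le> 1" by (simp add: algebra_simps)
    then show ?thesis using d by (simp add: pos_le_divide_eq)
  qed
  ultimately show *: "1 - d - 540 * \<epsilon> * (1 + 1 / d) ^ 3 \<le> F (1 / d)"
    using laplace_close[OF small, of "1 / d" "1 / d"] d by simp
  show "1 - d - 540 * \<epsilon> * (1 + 1 / d) ^ 3 \<le> (\<integral>x. f x \<partial>lborel)"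
    using * F_le_integral[of "1 / d"] d by simp
qed

text \<open>On x \<le> d the function \<open>exp (- x / d)\<close> is at least 1 / e, hence at least
  1 / 3, and its integral against \<open>f\<close> is the integral of \<open>f\<close> minus
  \<open>F (1 / d)\<close>. The first is at most 1 + \<epsilon>, the second nearly 1; the extra
  \<epsilon> turns 540 into 541.\<close>

lemma near_zero:
  assumes small: "36 * \<epsilon> \<le> 1 - \<alpha>" and d: "0 < d"
  shows "integrable lborel (\<lambda>x. f x * indicator {..d} x)"
    and "(\<integral>x. f x * indicator {..d} x \<partial>lborel) \<le> 3 * (d + 541 * \<epsilon> * (1 + 1 / d) ^ 3)"
proof -
  show i: "integrable lborel (\<lambda>x. f x * indicator {..d} x)"
    using integrable_mult_indicator[OF _ f_integrable, of "{..d}"] by (simp add: mult.commute)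
  have j: "integrable lborel (\<lambda>x. 3 * (f x - f x * (1 - exp (- (1 / d) * x))))"
    using f_integrable F_integrable[of "1 / d"] d
    by (intro integrable_mult_right Bochner_Integration.integrable_diff) auto
  have "(\<integral>x. f x * indicator {..d} x \<partial>lborel) \<le> (\<integral>x. 3 * (f x - f x * (1 - exp (- (1 / d) * x))) \<partial>lborel)"
  proof (rule integral_mono[OF i j])
    fix x
    have e: "f x - f x * (1 - exp (- (1 / d) * x)) = f x * exp (- (1 / d) * x)" by (simp add: algebra_simps)
    show "f x * indicator {..d} x \<le> 3 * (f x - f x * (1 - exp (- (1 / d) * x)))"
    proof (cases "x \<le> d")
      case True
      have "exp (- 1) \<le> exp (- (1 / d) * x)" using True d by (simp add: field_simps)
      moreover have "1 \<le> 3 * exp (- 1 :: real)" using exp_le by (simp add: exp_minus field_simps)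
      ultimately have "1 \<le> 3 * exp (- (1 / d) * x)" by linarith
      from mult_left_mono[OF this f_nonneg[of x]] show ?thesis unfolding e using True by (simp add: mult_ac)
    next
      case False
      then show ?thesis unfolding e using f_nonneg[of x] by simp
    qed
  qed
  also have "\<dots> = 3 * ((\<integral>x. f x \<partial>lborel) - F (1 / d))"
    unfolding F_def using f_integrable F_integrable[of "1 / d"] d by simp
  also have "\<dots> \<le> 3 * (d + 541 * \<epsilon> * (1 + 1 / d) ^ 3)"
  proof -
    have "1 \<le> (1 + 1 / d) ^ 3" using d by (intro one_le_power) auto
    from mult_left_mono[OF this, of \<epsilon>] have "\<epsilon> \<le> \<epsilon> * (1 + 1 / d) ^ 3" using eps by simp
    then show ?thesis using f_integral_lower(1)[OF small d] f_integral_le_eps by simp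
  qed
  finally show "(\<integral>x. f x * indicator {..d} x \<partial>lborel) \<le> 3 * (d + 541 * \<epsilon> * (1 + 1 / d) ^ 3)" .
qed

text \<open>Testing with the decreasing function \<open>(x + \<kappa>) powr - \<alpha>\<close>, the loss term wins because
  \<open>2 N - 1 - \<alpha> > 0\<close> for \<open>N\<close> close to \<open>1\<close>.\<close>
lemma negative_moment_shifted:
  assumes d: "0 < d" and k: "0 < \<kappa>"
    and coef: "1 - \<alpha> \<le> (2 - \<epsilon>) * (2 * (\<integral>x. f x \<partial>lborel) - (\<integral>x. f x * indicator {..d} x \<partial>lborel)) - 2 - 2 * \<alpha>"
  shows "integrable lborel (\<lambda>x. f x * (x + \<kappa>) powr (- \<alpha>))"
    and "(\<integral>x. f x * (x + \<kappa>) powr (- \<alpha>) \<partial>lborel) \<le> 8 * d powr (- \<alpha>) / (1 - \<alpha>)"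
proof -
  let ?\<psi> = "\<lambda>x. (x + \<kappa>) powr (- \<alpha>)"
  let ?\<psi>' = "\<lambda>x. - \<alpha> * (x + \<kappa>) powr (- \<alpha> - 1)"
  define N where "N = (\<integral>x. f x \<partial>lborel)"
  define n where "n = (\<integral>x. f x * indicator {..d} x \<partial>lborel)"
  have N: "0 \<le> N" "N \<le> 2" using f_integral_le_2 f_nonneg by (auto simp: N_def)
  have a: "(?\<psi> has_real_derivative ?\<psi>' x) (at x)" if "0 < x" for x
    using that k by (auto intro!: derivative_eq_intros)
  have b: "continuous_on {0<..} ?\<psi>'"
    using k by (intro continuous_intros) auto
  have anti: "?\<psi> y \<le> ?\<psi> x" if "0 \<le> x" "x \<le> y" for x y
    using that k alpha by (intro powr_mono2') auto
  define h where "h x = f x * ?\<psi> x" for x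
  have h0: "0 \<le> h x" for x using f_nonneg by (simp add: h_def)
  have hk: "h x \<le> \<kappa> powr (- \<alpha>) * f x" for x
    using mult_left_mono[OF anti[of 0 x] f_nonneg[of x]] f_zero[of x] by (cases "0 < x") (auto simp: h_def mult_ac)
  have hi: "integrable lborel h"
  proof (rule Bochner_Integration.integrable_bound)
    show "integrable lborel (\<lambda>x. \<kappa> powr (- \<alpha>) * f x)" using f_integrable by simp
    show "AE x in lborel. norm (h x) \<le> norm (\<kappa> powr (- \<alpha>) * f x)"
      using hk h0 by (auto intro!: order_trans[OF hk])
    show "h \<in> borel_measurable lborel" unfolding h_def by measurable
  qed
  define m where "m = (\<integral>x. h x \<partial>lborel)"
  have m0: "0 \<le> m" unfolding m_def using h0 by (intro Bochner_Integration.integral_nonneg)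
  have lb: "0 \<le> f x * (?\<psi> x - x * ?\<psi>' x)" "f x * (?\<psi> x - x * ?\<psi>' x) \<le> (1 + \<alpha>) * h x" for x
  proof -
    show "0 \<le> f x * (?\<psi> x - x * ?\<psi>' x)"
      using f_zero[of x] f_nonneg[of x] alpha by (cases "0 < x") auto
    show "f x * (?\<psi> x - x * ?\<psi>' x) \<le> (1 + \<alpha>) * h x"
    proof (cases "0 < x")
      case True
      have "x * (x + \<kappa>) powr (- \<alpha> - 1) \<le> (x + \<kappa>) * (x + \<kappa>) powr (- \<alpha> - 1)"
        using k by (intro mult_right_mono) auto
      also have "\<dots> = ?\<psi> x" using True k by (simp add: powr_diff)
      finally have "\<alpha> * (x * (x + \<kappa>) powr (- \<alpha> - 1)) \<le> \<alpha> * ?\<psi> x" using alpha by (intro mult_left_mono)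
      then have "?\<psi> x - x * ?\<psi>' x \<le> (1 + \<alpha>) * ?\<psi> x" by (simp add: algebra_simps)
      from mult_left_mono[OF this f_nonneg[of x]] show ?thesis by (simp add: h_def mult_ac)
    qed (simp add: f_zero h_def)
  qed
  have c: "integrable lborel (\<lambda>x. f x * (?\<psi> x - x * ?\<psi>' x))"
  proof (rule Bochner_Integration.integrable_bound)
    show "integrable lborel (\<lambda>x. (1 + \<alpha>) * h x)" using hi by simp
    show "AE x in lborel. norm (f x * (?\<psi> x - x * ?\<psi>' x)) \<le> norm ((1 + \<alpha>) * h x)"
    proof (rule AE_I2)
      fix x show "norm (f x * (?\<psi> x - x * ?\<psi>' x)) \<le> norm ((1 + \<alpha>) * h x)"
        using lb[of x] unfolding real_norm_def by linarith
    qed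
    show "(\<lambda>x. f x * (?\<psi> x - x * ?\<psi>' x)) \<in> borel_measurable lborel" by measurable
  qed
  have ni: "integrable lborel (\<lambda>x. f x * indicator {..d} x)"
    using integrable_mult_indicator[OF _ f_integrable, of "{..d}"] by (simp add: mult.commute)
  define R where "R = (\<lambda>q. (2 - \<epsilon>) * ((case q of (y, z) \<Rightarrow> h y * f z) + (case q of (y, z) \<Rightarrow> f y * h z)
     - (case q of (y, z) \<Rightarrow> (f y * indicator {..d} y) * h z) - d powr (- \<alpha>) * (case q of (y, z) \<Rightarrow> f y * f z)))"
  have Ri: "integrable lborel2 R" "(\<integral>q. R q \<partial>lborel2) = (2 - \<epsilon>) * (m * N + N * m - n * m - d powr (- \<alpha>) * (N * N))"
    unfolding R_def using integral_product[OF hi f_integrable] integral_product[OF f_integrable hi]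
      integral_product[OF ni hi] integral_product[OF f_integrable f_integrable]
    by (simp_all add: m_def n_def N_def)
  have "(2 - \<epsilon>) * (m * N + N * m - n * m - d powr (- \<alpha>) * (N * N)) = (\<integral>q. R q \<partial>lborel2)"
    by (rule Ri(2)[symmetric])
  also have "\<dots> \<le> (\<integral>(y, z). K y z * f y * f z * (?\<psi> y + ?\<psi> z - ?\<psi> (y + z)) \<partial>lborel2)"
  proof (rule integral_mono[OF Ri(1) weak_form(1)[OF a b c]])
    fix q :: "real \<times> real"
    obtain y z where q: "q = (y, z)" by (cases q)
    show "R q \<le> (case q of (y, z) \<Rightarrow> K y z * f y * f z * (?\<psi> y + ?\<psi> z - ?\<psi> (y + z)))"
    proof (cases "0 < y \<and> 0 < z")
      case True
      then have y: "0 < y" and z: "0 < z" by auto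
      have "?\<psi> (y + z) \<le> ?\<psi> y" using y z by (intro anti) auto
      then have D0: "0 \<le> ?\<psi> y + ?\<psi> z - ?\<psi> (y + z)" using powr_ge_zero[of "z + \<kappa>" "- \<alpha>"] by linarith
      \<comment> \<open>The gain is compared with the full \<open>?\<psi> z\<close> only for y below
        d, where there is little mass, and with a constant otherwise. The first case subtracts n
        from 2 N in the coefficient, the second gives the right-hand side of the final
        bound.\<close>
      have "?\<psi> (y + z) \<le> indicator {..d} y * ?\<psi> z + d powr (- \<alpha>)"
      proof (cases "y \<le> d")
        case True
        have "?\<psi> (y + z) \<le> ?\<psi> z" using y z by (intro anti) auto
        then show ?thesis using True powr_ge_zero[of d "- \<alpha>"] by (simp add: add_increasing2)
      next
        case False
        have "?\<psi> (y + z) \<le> d powr (- \<alpha>)" using False d k z alpha by (intro powr_mono2') auto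
        then show ?thesis using False by simp
      qed
      then have "(2 - \<epsilon>) * (?\<psi> y + ?\<psi> z - indicator {..d} y * ?\<psi> z - d powr (- \<alpha>)) \<le> (2 - \<epsilon>) * (?\<psi> y + ?\<psi> z - ?\<psi> (y + z))"
        using eps by (intro mult_left_mono) auto
      also have "\<dots> \<le> K y z * (?\<psi> y + ?\<psi> z - ?\<psi> (y + z))"
        using K_lower[OF y z] D0 by (rule mult_right_mono)
      finally have "f y * f z * ((2 - \<epsilon>) * (?\<psi> y + ?\<psi> z - indicator {..d} y * ?\<psi> z - d powr (- \<alpha>)))
         \<le> f y * f z * (K y z * (?\<psi> y + ?\<psi> z - ?\<psi> (y + z)))"
        using f_nonneg by (intro mult_left_mono) auto
      also have "f y * f z * ((2 - \<epsilon>) * (?\<psi> y + ?\<psi> z - indicator {..d} y * ?\<psi> z - d powr (- \<alpha>))) = R q"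
        unfolding R_def q prod.case h_def by (simp only: algebra_simps)
      finally show ?thesis unfolding q prod.case by (simp only: mult_ac)
    next
      case False
      then show ?thesis by (auto simp: q R_def h_def not_less f_zero)
    qed
  qed
  also have "\<dots> = 2 * (\<integral>x. f x * (?\<psi> x - x * ?\<psi>' x) \<partial>lborel)"
    by (rule weak_form(2)[OF a b c, symmetric])
  also have "\<dots> \<le> 2 * (\<integral>x. (1 + \<alpha>) * h x \<partial>lborel)"
    by (intro mult_left_mono integral_mono c lb(2)) (use hi in auto)
  also have "\<dots> = 2 * ((1 + \<alpha>) * m)" by (simp add: m_def)
  finally have "((2 - \<epsilon>) * (2 * N - n) - 2 - 2 * \<alpha>) * m \<le> (2 - \<epsilon>) * (d powr (- \<alpha>) * (N * N))"
    by (simp add: algebra_simps)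
  also have "\<dots> \<le> 2 * (d powr (- \<alpha>) * (2 * 2))"
    using N eps by (intro mult_mono) auto
  finally have 1: "((2 - \<epsilon>) * (2 * N - n) - 2 - 2 * \<alpha>) * m \<le> 8 * d powr (- \<alpha>)" by simp
  have "(1 - \<alpha>) * m \<le> ((2 - \<epsilon>) * (2 * N - n) - 2 - 2 * \<alpha>) * m"
    using coef m0 unfolding N_def n_def by (intro mult_right_mono)
  then have "(1 - \<alpha>) * m \<le> 8 * d powr (- \<alpha>)" using 1 by linarith
  then have "m \<le> 8 * d powr (- \<alpha>) / (1 - \<alpha>)" using alpha by (simp add: field_simps)
  then show "(\<integral>x. f x * (x + \<kappa>) powr (- \<alpha>) \<partial>lborel) \<le> 8 * d powr (- \<alpha>) / (1 - \<alpha>)"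
    by (simp add: m_def h_def)
  show "integrable lborel (\<lambda>x. f x * (x + \<kappa>) powr (- \<alpha>))" using hi by (simp add: h_def[abs_def])
qed

text \<open>With \<open>\<tau> \<le> (1 - \<alpha>) / 20\<close> the integral of \<open>f\<close> is
  at least 1 - \<tau> and the part below d at most 3 \<tau>, so 2 N - n \<ge> 2 - 5 \<tau>. The
  ideal coefficient 2 (1 - \<alpha>) then loses at most 10 \<tau> + 2 \<epsilon>, and at least half
  of it remains. The shift \<open>\<kappa>\<close>, needed for finiteness, is removed by
  Fatou.\<close>

lemma negative_moment:
  assumes e: "541 * \<epsilon> * (1 + 40 / (1 - \<alpha>)) ^ 3 \<le> (1 - \<alpha>) / 40"
  shows "36 * \<epsilon> \<le> 1 - \<alpha>"
    and "integrable lborel (\<lambda>x. f x * x powr (- \<alpha>))"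
    and "(\<integral>x. f x * x powr (- \<alpha>) \<partial>lborel) \<le> 8 * ((1 - \<alpha>) / 40) powr (- \<alpha>) / (1 - \<alpha>)"
proof -
  define d where "d = (1 - \<alpha>) / 40"
  have d: "0 < d" using alpha by (simp add: d_def)
  define \<tau> where "\<tau> = d + 541 * \<epsilon> * (1 + 1 / d) ^ 3"
  have d1: "1 / d = 40 / (1 - \<alpha>)" by (simp add: d_def)
  define c where "c = (1 + 40 / (1 - \<alpha>)) ^ 3"
  have c1: "1 \<le> c" unfolding c_def using alpha by (intro one_le_power) auto
  have c2: "0 \<le> 541 * \<epsilon> * c" using c1 eps by simp
  have \<tau>_eq: "\<tau> = (1 - \<alpha>) / 40 + 541 * \<epsilon> * c" unfolding \<tau>_def d1 c_def by (simp add: d_def)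
  have e': "541 * \<epsilon> * c \<le> (1 - \<alpha>) / 40" using e by (simp only: c_def)
  have \<tau>: "\<tau> \<le> (1 - \<alpha>) / 20" "0 \<le> \<tau>" using e' c2 alpha unfolding \<tau>_eq by linarith+
  have "541 * \<epsilon> * 1 \<le> 541 * \<epsilon> * c" using c1 eps by (intro mult_left_mono) auto
  then have e2: "541 * \<epsilon> \<le> (1 - \<alpha>) / 40" using e' by linarith
  then show small: "36 * \<epsilon> \<le> 1 - \<alpha>" using eps alpha by simp
  define N where "N = (\<integral>x. f x \<partial>lborel)"
  define n where "n = (\<integral>x. f x * indicator {..d} x \<partial>lborel)"
  have "\<epsilon> * (1 + 1 / d) ^ 3 \<ge> 0" using eps d by simp
  then have N: "1 - \<tau> \<le> N" using f_integral_lower(2)[OF small d] unfolding N_def \<tau>_def by (simp add: algebra_simps)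
  have n: "n \<le> 3 * \<tau>" using near_zero(2)[OF small d] unfolding n_def \<tau>_def .
  have "1 - \<alpha> \<le> (2 - \<epsilon>) * (2 - 5 * \<tau>) - 2 - 2 * \<alpha>"
  proof -
    have "0 \<le> \<epsilon> * (5 * \<tau>)" using eps \<tau> by simp
    then have "(2 - \<epsilon>) * (2 - 5 * \<tau>) \<ge> 4 - 10 * \<tau> - 2 * \<epsilon>" by (simp add: algebra_simps)
    then show ?thesis using \<tau> e2 by (simp add: field_simps)
  qed
  also have "(2 - \<epsilon>) * (2 - 5 * \<tau>) \<le> (2 - \<epsilon>) * (2 * N - n)"
    using N n eps by (intro mult_left_mono) auto
  finally have coef: "1 - \<alpha> \<le> (2 - \<epsilon>) * (2 * N - n) - 2 - 2 * \<alpha>" by simp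
  let ?u = "\<lambda>k x. f x * (x + 1 / real (Suc k)) powr (- \<alpha>)"
  have lim: "(\<lambda>k. ?u k x) \<longlonglongrightarrow> f x * x powr (- \<alpha>)" for x
  proof (cases "0 < x")
    case True
    have "(\<lambda>k. x + 1 / real (Suc k)) \<longlonglongrightarrow> x + 0"
      by (intro tendsto_add tendsto_const LIMSEQ_Suc lim_1_over_n)
    then have "(\<lambda>k. (x + 1 / real (Suc k)) powr (- \<alpha>)) \<longlonglongrightarrow> x powr (- \<alpha>)"
      using True by (intro tendsto_powr) auto
    then show ?thesis by (intro tendsto_mult tendsto_const)
  qed (simp add: f_zero)
  have nn: "0 \<le> ?u k x" for k x by (simp add: f_nonneg)
  have pk: "0 < 1 / real (Suc k)" for k by simp
  note 1 = negative_moment_shifted[OF d pk coef[unfolded N_def n_def]]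
  show "integrable lborel (\<lambda>x. f x * x powr (- \<alpha>))"
    by (rule integrable_fatou_bound(1)[where u = ?u, OF 1(1) nn 1(2) lim])
  show "(\<integral>x. f x * x powr (- \<alpha>) \<partial>lborel) \<le> 8 * ((1 - \<alpha>) / 40) powr (- \<alpha>) / (1 - \<alpha>)"
    using integrable_fatou_bound(2)[where u = ?u, OF 1(1) nn 1(2) lim] by (simp add: d_def)
qed

end

section \<open>Weak closeness to the exponential profile\<close>

text \<open>This is the variance of the binomial distribution divided by n^2, read off from the
  known sums of k and k (k - 1).\<close>

lemma Bernstein_second_moment:
  assumes "n > 0"
  shows "(\<Sum>k\<le>n. (x - real k / real n)\<^sup>2 * Bernstein n k x) = x * (1 - x) / real n"
proof -
  have "(x - real k / real n)\<^sup>2 * Bernstein n k x =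
     (real k * (real k - 1) * Bernstein n k x + (1 - 2 * real n * x) * (real k * Bernstein n k x)
       + (real n)\<^sup>2 * x\<^sup>2 * Bernstein n k x) / (real n)\<^sup>2" for k
    using assms by (simp add: field_simps power2_eq_square)
  then have "(\<Sum>k\<le>n. (x - real k / real n)\<^sup>2 * Bernstein n k x) =
     ((\<Sum>k\<le>n. real k * (real k - 1) * Bernstein n k x) + (1 - 2 * real n * x) * (\<Sum>k\<le>n. real k * Bernstein n k x)
       + (real n)\<^sup>2 * x\<^sup>2 * (\<Sum>k\<le>n. Bernstein n k x)) / (real n)\<^sup>2"
    unfolding sum_distrib_left sum.distrib[symmetric] sum_divide_distrib by (intro sum.cong refl) (simp only:)
  also have "\<dots> = (real n * (real n - 1) * x\<^sup>2 + (1 - 2 * real n * x) * (real n * x) + (real n)\<^sup>2 * x\<^sup>2) / (real n)\<^sup>2"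
    by simp
  also have "\<dots> = x * (1 - x) / real n" using assms by (simp add: field_simps power2_eq_square)
  finally show ?thesis .
qed

text \<open>An explicit rate, rather than mere density of polynomials, makes the degree depend on
  the Lipschitz constant only, and hence the closeness uniform over test functions. The inequality
  \<open>u \<le> 1 / (2 * c) + c / 2 * u^2\<close> with c the square root of n takes the place of
  Cauchy-Schwarz and balances both terms.\<close>

lemma Bernstein_Lipschitz:
  fixes \<Phi> :: "real \<Rightarrow> real"
  assumes lip: "\<And>s t. s \<in> {0..1} \<Longrightarrow> t \<in> {0..1} \<Longrightarrow> \<bar>\<Phi> s - \<Phi> t\<bar> \<le> \<Lambda> * \<bar>s - t\<bar>"
    and n: "n > 0" and x: "x \<in> {0..1}" and L: "0 \<le> \<Lambda>"
  shows "\<bar>\<Phi> x - (\<Sum>k\<le>n. \<Phi> (real k / real n) * Bernstein n k x)\<bar> \<le> \<Lambda> / sqrt (real n)"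
proof -
  define c where "c = sqrt (real n)"
  have c: "0 < c" "c * c = real n" using n by (auto simp: c_def)
  have B0: "0 \<le> Bernstein n k x" for k using x by (intro Bernstein_nonneg) auto
  have "\<Phi> x - (\<Sum>k\<le>n. \<Phi> (real k / real n) * Bernstein n k x) = (\<Sum>k\<le>n. (\<Phi> x - \<Phi> (real k / real n)) * Bernstein n k x)"
    by (simp add: left_diff_distrib sum_subtractf sum_distrib_left[symmetric])
  also have "\<bar>\<dots>\<bar> \<le> (\<Sum>k\<le>n. \<bar>(\<Phi> x - \<Phi> (real k / real n)) * Bernstein n k x\<bar>)" by (rule sum_abs)
  also have "\<dots> \<le> (\<Sum>k\<le>n. (\<Lambda> * (1 / (2 * c) + c / 2 * (x - real k / real n)\<^sup>2)) * Bernstein n k x)"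
  proof (rule sum_mono)
    fix k assume "k \<in> {..n}"
    then have k: "real k / real n \<in> {0..1}" using n by (auto simp: field_simps)
    define u where "u = \<bar>x - real k / real n\<bar>"
    have "0 \<le> (1 - c * u)\<^sup>2" by simp
    then have "2 * (c * u) \<le> 1 + c * c * u\<^sup>2" by (simp add: power2_eq_square algebra_simps)
    then have "u \<le> 1 / (2 * c) + c / 2 * u\<^sup>2" using c(1) by (simp add: field_simps)
    then have "\<Lambda> * u \<le> \<Lambda> * (1 / (2 * c) + c / 2 * (x - real k / real n)\<^sup>2)"
      using L by (intro mult_left_mono) (auto simp: u_def)
    then have "\<bar>\<Phi> x - \<Phi> (real k / real n)\<bar> \<le> \<Lambda> * (1 / (2 * c) + c / 2 * (x - real k / real n)\<^sup>2)"
      using lip[OF x k] by (simp add: u_def)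
    then show "\<bar>(\<Phi> x - \<Phi> (real k / real n)) * Bernstein n k x\<bar> \<le> (\<Lambda> * (1 / (2 * c) + c / 2 * (x - real k / real n)\<^sup>2)) * Bernstein n k x"
      unfolding abs_mult using B0[of k] by (simp add: mult_right_mono)
  qed
  also have "\<dots> = \<Lambda> * (1 / (2 * c)) * (\<Sum>k\<le>n. Bernstein n k x) + \<Lambda> * (c / 2) * (\<Sum>k\<le>n. (x - real k / real n)\<^sup>2 * Bernstein n k x)"
    unfolding sum_distrib_left sum.distrib[symmetric] by (intro sum.cong refl) (simp only: algebra_simps)
  also have "\<dots> = \<Lambda> * (1 / (2 * c) + c / 2 * (x * (1 - x) / (c * c)))"
    unfolding Bernstein_second_moment[OF n] c(2) by (simp add: distrib_left)
  also have "\<dots> \<le> \<Lambda> * (1 / (2 * c) + c / 2 * (1 / (c * c)))"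
    using L c x by (intro mult_left_mono add_left_mono divide_right_mono) (auto intro: mult_le_one)
  also have "\<dots> = \<Lambda> / c" using c(1) by (simp add: field_simps)
  finally show ?thesis by (simp add: c_def)
qed

text \<open>The profile of mass 1 for the constant kernel 2, extended by zero like all profiles
  here.\<close>

definition exp_profile :: "real \<Rightarrow> real" where "exp_profile x = (if 0 < x then exp (- x) else 0)"

lemma exp_profile_nonneg: "0 \<le> exp_profile x" by (simp add: exp_profile_def)

lemma exp_profile_measurable [measurable]: "exp_profile \<in> borel_measurable borel"
  unfolding exp_profile_def by measurable

lemma exp_profile_times_exp:
  assumes "0 \<le> p"
  shows "has_bochner_integral lborel (\<lambda>x. exp_profile x * exp (- p * x)) (1 / (1 + p))"
proof -
  have "(\<integral>\<^sup>+x. ennreal (exp (- (1 + p) * x)) * indicator {0..} x \<partial>lborel) = ennreal (0 - (- exp (- (1 + p) * 0) / (1 + p)))"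
  proof (rule nn_integral_FTC_atLeast)
    show "((\<lambda>x. - exp (- (1 + p) * x) / (1 + p)) has_real_derivative exp (- (1 + p) * x)) (at x)" for x
    proof -
      have "((\<lambda>x. - exp (- (1 + p) * x) / (1 + p)) has_real_derivative - (exp (- (1 + p) * x) * (- (1 + p))) / (1 + p)) (at x)"
        using assms by (auto intro!: derivative_eq_intros)
      moreover have "- (exp (- (1 + p) * x) * (- (1 + p))) / (1 + p) = exp (- (1 + p) * x)"
        using assms by (simp only: mult_minus_right minus_minus) simp
      ultimately show ?thesis by (simp only:)
    qed
    have "LIM x at_top. - (1 + p) * x :> at_bot"
      using assms by (intro filterlim_tendsto_neg_mult_at_bot[OF tendsto_const] filterlim_ident) auto
    then have "((\<lambda>x. exp (- (1 + p) * x)) \<longlongrightarrow> 0) at_top"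
      by (rule filterlim_compose[OF exp_at_bot])
    then have "((\<lambda>x. - exp (- (1 + p) * x) / (1 + p)) \<longlongrightarrow> - 0 / (1 + p)) at_top"
      using assms by (intro tendsto_intros) auto
    then show "((\<lambda>x. - exp (- (1 + p) * x) / (1 + p)) \<longlongrightarrow> 0) at_top" by simp
  qed auto
  moreover have "(\<integral>\<^sup>+x. ennreal (exp (- (1 + p) * x)) * indicator {0..} x \<partial>lborel) = (\<integral>\<^sup>+x. ennreal (exp_profile x * exp (- p * x)) \<partial>lborel)"
  proof (rule nn_integral_cong_AE)
    show "AE x in lborel. ennreal (exp (- (1 + p) * x)) * indicator {0..} x = ennreal (exp_profile x * exp (- p * x))"
      using AE_lborel_singleton[of "0::real"]
      by eventually_elim (auto simp: exp_profile_def indicator_def exp_add[symmetric] algebra_simps)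
  qed
  ultimately show ?thesis
    using assms by (intro has_bochner_integral_nn_integral) (auto simp: exp_profile_nonneg)
qed

lemma exp_profile_integrable: "integrable lborel exp_profile" and exp_profile_integral: "(\<integral>x. exp_profile x \<partial>lborel) = 1"
  using exp_profile_times_exp[of 0] by (auto simp: has_bochner_integral_iff)

lemma exp_profile_second_moment:
  shows "integrable lborel (\<lambda>x. exp_profile x * x\<^sup>2)" "(\<integral>x. exp_profile x * x\<^sup>2 \<partial>lborel) = 2"
proof -
  have "(\<integral>\<^sup>+x. ennreal (x\<^sup>2 * exp (- x)) * indicator {0..} x \<partial>lborel) = ennreal (0 - (- (0\<^sup>2 + 2 * 0 + 2) * exp (- 0)))"
  proof (rule nn_integral_FTC_atLeast)
    show "((\<lambda>x. - (x\<^sup>2 + 2 * x + 2) * exp (- x)) has_real_derivative x\<^sup>2 * exp (- x)) (at x)" for x :: real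
      by (auto intro!: derivative_eq_intros simp: algebra_simps)
    have t: "((\<lambda>x::real. x ^ k * exp (- x)) \<longlongrightarrow> 0) at_top" for k
      using tendsto_power_div_exp_0[of k] by (simp add: exp_minus field_simps)
    have "((\<lambda>x::real. - (x ^ 2 * exp (- x)) - 2 * (x ^ 1 * exp (- x)) - 2 * (x ^ 0 * exp (- x))) \<longlongrightarrow> - 0 - 2 * 0 - 2 * 0) at_top"
      by (intro tendsto_intros t)
    moreover have "(\<lambda>x::real. - (x ^ 2 * exp (- x)) - 2 * (x ^ 1 * exp (- x)) - 2 * (x ^ 0 * exp (- x)))
      = (\<lambda>x. - (x\<^sup>2 + 2 * x + 2) * exp (- x))"
      by (auto simp: fun_eq_iff algebra_simps)
    ultimately show "((\<lambda>x::real. - (x\<^sup>2 + 2 * x + 2) * exp (- x)) \<longlongrightarrow> 0) at_top" by simp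
  qed auto
  moreover have "(\<integral>\<^sup>+x. ennreal (x\<^sup>2 * exp (- x)) * indicator {0..} x \<partial>lborel) = (\<integral>\<^sup>+x. ennreal (exp_profile x * x\<^sup>2) \<partial>lborel)"
    by (intro nn_integral_cong) (auto simp: exp_profile_def indicator_def)
  ultimately have "has_bochner_integral lborel (\<lambda>x. exp_profile x * x\<^sup>2) 2"
    by (intro has_bochner_integral_nn_integral) (auto simp: exp_profile_nonneg)
  then show "integrable lborel (\<lambda>x. exp_profile x * x\<^sup>2)" "(\<integral>x. exp_profile x * x\<^sup>2 \<partial>lborel) = 2"
    by (auto simp: has_bochner_integral_iff)
qed

section \<open>From Laplace transforms to Lipschitz test functions\<close>

context coag_profile
begin

lemma diff_integrable:
  assumes [measurable]: "h \<in> borel_measurable borel" and b: "\<And>x. 0 < x \<Longrightarrow> \<bar>h x\<bar> \<le> C"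
  shows "integrable lborel (\<lambda>x. (f x - exp_profile x) * h x)"
proof (rule Bochner_Integration.integrable_bound)
  show "integrable lborel (\<lambda>x. C * (f x - exp_profile x))" using f_integrable exp_profile_integrable by simp
  show "AE x in lborel. norm ((f x - exp_profile x) * h x) \<le> norm (C * (f x - exp_profile x))"
  proof (rule AE_I2)
    fix x show "norm ((f x - exp_profile x) * h x) \<le> norm (C * (f x - exp_profile x))"
    proof (cases "0 < x")
      case True
      have "\<bar>f x - exp_profile x\<bar> * \<bar>h x\<bar> \<le> \<bar>f x - exp_profile x\<bar> * \<bar>C\<bar>" using b[OF True] by (intro mult_left_mono) auto
      then show ?thesis by (simp add: abs_mult mult_ac)
    qed (simp add: f_zero exp_profile_def)
  qed
qed measurable

lemma moment_close:
  fixes j :: nat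
  assumes N: "\<bar>(\<integral>x. f x \<partial>lborel) - 1\<bar> \<le> \<sigma>"
    and F: "\<And>j::nat. 1 \<le> j \<Longrightarrow> j \<le> n \<Longrightarrow> \<bar>F (real j) - real j / (1 + real j)\<bar> \<le> \<sigma>" and j: "j \<le> n"
  shows "\<bar>\<integral>x. (f x - exp_profile x) * exp (- x) ^ j \<partial>lborel\<bar> \<le> 2 * \<sigma>"
proof -
  have e: "exp (- x) ^ j = exp (- real j * x)" for x :: real
    by (subst exp_of_nat_mult[symmetric]) (simp only: mult_minus_left mult_minus_right)
  have r: "(f x - exp_profile x) * exp (- real j * x) = f x - f x * (1 - exp (- real j * x)) - exp_profile x * exp (- real j * x)" for x
    by (simp add: algebra_simps)
  have Ei: "integrable lborel (\<lambda>x. exp_profile x * exp (- real j * x))" "(\<integral>x. exp_profile x * exp (- real j * x) \<partial>lborel) = 1 / (1 + real j)"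
    using exp_profile_times_exp[of "real j"] by (auto simp: has_bochner_integral_iff)
  have "(\<integral>x. (f x - exp_profile x) * exp (- x) ^ j \<partial>lborel) = (\<integral>x. f x \<partial>lborel) - F (real j) - 1 / (1 + real j)"
    unfolding e r F_def using Ei F_integrable[of "real j"] f_integrable by simp
  moreover have "1 - real j / (1 + real j) = 1 / (1 + real j)" by (simp add: field_simps)
  moreover have "\<bar>F (real j) - real j / (1 + real j)\<bar> \<le> \<sigma>"
  proof (cases "j = 0")
    case True then show ?thesis using N by (simp add: F_def)
  qed (use F[of j] j in simp)
  ultimately show ?thesis using N by linarith
qed

text \<open>Each factor \<open>1 - exp (- x)\<close> splits the integral into two with one factor
  fewer, which doubles the error. The growth 2^m is harmless because the degree n is fixed before
  \<sigma>.\<close>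

lemma Bernstein_moment_close:
  assumes N: "\<bar>(\<integral>x. f x \<partial>lborel) - 1\<bar> \<le> \<sigma>"
    and F: "\<And>j::nat. 1 \<le> j \<Longrightarrow> j \<le> n \<Longrightarrow> \<bar>F (real j) - real j / (1 + real j)\<bar> \<le> \<sigma>"
  shows "k + m \<le> n \<Longrightarrow> \<bar>\<integral>x. (f x - exp_profile x) * (exp (- x) ^ k * (1 - exp (- x)) ^ m) \<partial>lborel\<bar> \<le> 2 ^ m * (2 * \<sigma>)"
proof (induction m arbitrary: k)
  case 0
  then show ?case using moment_close[OF N F, of k] by simp
next
  case (Suc m)
  have i: "integrable lborel (\<lambda>x. (f x - exp_profile x) * (exp (- x) ^ k * (1 - exp (- x)) ^ m))" for k
  proof (rule diff_integrable)
    fix x :: real assume "0 < x"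
    then show "\<bar>exp (- x) ^ k * (1 - exp (- x)) ^ m\<bar> \<le> 1"
      unfolding abs_mult power_abs by (intro mult_le_one power_le_one) auto
  qed measurable
  have "(f x - exp_profile x) * (exp (- x) ^ k * (1 - exp (- x)) ^ Suc m) =
    (f x - exp_profile x) * (exp (- x) ^ k * (1 - exp (- x)) ^ m) - (f x - exp_profile x) * (exp (- x) ^ Suc k * (1 - exp (- x)) ^ m)" for x
    by (simp add: algebra_simps)
  then have "(\<integral>x. (f x - exp_profile x) * (exp (- x) ^ k * (1 - exp (- x)) ^ Suc m) \<partial>lborel) =
    (\<integral>x. (f x - exp_profile x) * (exp (- x) ^ k * (1 - exp (- x)) ^ m) \<partial>lborel) -
    (\<integral>x. (f x - exp_profile x) * (exp (- x) ^ Suc k * (1 - exp (- x)) ^ m) \<partial>lborel)"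
    using i[of k] i[of "Suc k"] by simp
  then show ?case using Suc.IH[of k] Suc.IH[of "Suc k"] Suc.prems by simp
qed

text \<open>Approximation error plus moment error. The 3 bounds the integral of
  \<open>f + exp_profile\<close>; 4^n is the sum 2^n of the binomial coefficients times the factor
  2^n from \<open>Bernstein_moment_close\<close>.\<close>

lemma Lipschitz_close:
  assumes lip: "\<And>s t. s \<in> {0..1} \<Longrightarrow> t \<in> {0..1} \<Longrightarrow> \<bar>\<Phi> s - \<Phi> t\<bar> \<le> \<Lambda> * \<bar>s - t\<bar>"
    and bd: "\<And>t. t \<in> {0..1} \<Longrightarrow> \<bar>\<Phi> t\<bar> \<le> \<Lambda>" and n: "n > 0"
    and [measurable]: "\<Phi> \<in> borel_measurable borel"
    and N: "\<bar>(\<integral>x. f x \<partial>lborel) - 1\<bar> \<le> \<sigma>"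
    and F: "\<And>j::nat. 1 \<le> j \<Longrightarrow> j \<le> n \<Longrightarrow> \<bar>F (real j) - real j / (1 + real j)\<bar> \<le> \<sigma>"
  shows "\<bar>\<integral>x. (f x - exp_profile x) * \<Phi> (exp (- x)) \<partial>lborel\<bar> \<le> 3 * \<Lambda> / sqrt (real n) + \<Lambda> * 4 ^ n * (2 * \<sigma>)"
proof -
  have L0: "0 \<le> \<Lambda>" using bd[of 0] by auto
  have s0: "0 \<le> \<sigma>" using N by linarith
  have t: "exp (- x) \<in> {0..1}" if "0 < x" for x :: real using that by simp
  define Q where "Q x = (\<Sum>k\<le>n. \<Phi> (real k / real n) * Bernstein n k (exp (- x)))" for x
  have Qb: "\<bar>\<Phi> (exp (- x)) - Q x\<bar> \<le> \<Lambda> / sqrt (real n)" if "0 < x" for x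
    unfolding Q_def by (rule Bernstein_Lipschitz[OF lip n t[OF that] L0])
  have [measurable]: "Q \<in> borel_measurable borel" unfolding Q_def Bernstein_def by measurable
  have i1: "integrable lborel (\<lambda>x. (f x - exp_profile x) * (\<Phi> (exp (- x)) - Q x))"
    by (rule diff_integrable[OF _ Qb]) measurable
  have i0: "integrable lborel (\<lambda>x. (f x - exp_profile x) * \<Phi> (exp (- x)))"
    by (rule diff_integrable[OF _ bd[OF t]]) measurable
  have iQ: "integrable lborel (\<lambda>x. (f x - exp_profile x) * Q x)"
    using Bochner_Integration.integrable_diff[OF i0 i1]
    by (simp only: right_diff_distrib[symmetric]) simp
  have d: "integrable lborel (\<lambda>x. \<Lambda> / sqrt (real n) * (f x + exp_profile x))"
    using f_integrable exp_profile_integrable by simp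
  have "\<bar>\<integral>x. (f x - exp_profile x) * (\<Phi> (exp (- x)) - Q x) \<partial>lborel\<bar> \<le> (\<integral>x. \<bar>(f x - exp_profile x) * (\<Phi> (exp (- x)) - Q x)\<bar> \<partial>lborel)"
    using integral_norm_bound[of lborel "\<lambda>x. (f x - exp_profile x) * (\<Phi> (exp (- x)) - Q x)"] by simp
  also have "\<dots> \<le> (\<integral>x. \<Lambda> / sqrt (real n) * (f x + exp_profile x) \<partial>lborel)"
  proof (rule integral_mono[OF integrable_abs[OF i1] d])
    fix x
    show "\<bar>(f x - exp_profile x) * (\<Phi> (exp (- x)) - Q x)\<bar> \<le> \<Lambda> / sqrt (real n) * (f x + exp_profile x)"
    proof (cases "0 < x")
      case True
      have "\<bar>f x - exp_profile x\<bar> \<le> f x + exp_profile x" using f_nonneg[of x] exp_profile_nonneg[of x] by linarith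
      then have "\<bar>f x - exp_profile x\<bar> * \<bar>\<Phi> (exp (- x)) - Q x\<bar> \<le> (f x + exp_profile x) * (\<Lambda> / sqrt (real n))"
        using Qb[OF True] f_nonneg[of x] exp_profile_nonneg[of x] by (intro mult_mono) auto
      then show ?thesis by (simp add: abs_mult mult_ac)
    qed (simp add: f_zero exp_profile_def)
  qed
  also have "\<dots> = \<Lambda> / sqrt (real n) * ((\<integral>x. f x \<partial>lborel) + 1)"
    using f_integrable exp_profile_integrable exp_profile_integral by simp
  also have "\<dots> \<le> \<Lambda> / sqrt (real n) * 3" using f_integral_le_2 L0 by (intro mult_left_mono) auto
  finally have A: "\<bar>\<integral>x. (f x - exp_profile x) * (\<Phi> (exp (- x)) - Q x) \<partial>lborel\<bar> \<le> 3 * \<Lambda> / sqrt (real n)" by (simp add: mult.commute)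
  have ik: "integrable lborel (\<lambda>x. (f x - exp_profile x) * (exp (- x) ^ k * (1 - exp (- x)) ^ m))" for k m
  proof (rule diff_integrable)
    fix x :: real assume "0 < x"
    then show "\<bar>exp (- x) ^ k * (1 - exp (- x)) ^ m\<bar> \<le> 1"
      unfolding abs_mult power_abs by (intro mult_le_one power_le_one) auto
  qed measurable
  define J where "J k = (\<integral>x. (f x - exp_profile x) * (exp (- x) ^ k * (1 - exp (- x)) ^ (n - k)) \<partial>lborel)" for k
  have Qs: "(f x - exp_profile x) * Q x =
    (\<Sum>k\<le>n. (\<Phi> (real k / real n) * real (n choose k)) * ((f x - exp_profile x) * (exp (- x) ^ k * (1 - exp (- x)) ^ (n - k))))" for x
    unfolding Q_def Bernstein_def sum_distrib_left by (intro sum.cong refl) (simp only: mult_ac)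
  have JQ: "(\<integral>x. (f x - exp_profile x) * Q x \<partial>lborel) = (\<Sum>k\<le>n. (\<Phi> (real k / real n) * real (n choose k)) * J k)"
    unfolding Qs J_def integral_mult_right_zero[symmetric]
    by (rule Bochner_Integration.integral_sum) (intro integrable_mult_right ik)
  have Jk: "\<bar>(\<Phi> (real k / real n) * real (n choose k)) * J k\<bar> \<le> real (n choose k) * (\<Lambda> * (2 ^ n * (2 * \<sigma>)))"
    if "k \<le> n" for k
  proof -
    have mem: "real k / real n \<in> {0..1}" using n that by simp
    have "\<bar>J k\<bar> \<le> 2 ^ (n - k) * (2 * \<sigma>)" unfolding J_def using that by (intro Bernstein_moment_close[OF N F]) auto
    also have "\<dots> \<le> 2 ^ n * (2 * \<sigma>)" using s0 by (intro mult_right_mono power_increasing) auto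
    finally have "\<bar>\<Phi> (real k / real n)\<bar> * \<bar>J k\<bar> \<le> \<Lambda> * (2 ^ n * (2 * \<sigma>))"
      using bd[OF mem] L0 by (intro mult_mono) auto
    from mult_left_mono[OF this, of "real (n choose k)"] show ?thesis
      unfolding abs_mult abs_of_nat by (simp only: mult.assoc mult.left_commute of_nat_0_le_iff)
  qed
  have "\<bar>\<Sum>k\<le>n. (\<Phi> (real k / real n) * real (n choose k)) * J k\<bar> \<le> (\<Sum>k\<le>n. \<bar>(\<Phi> (real k / real n) * real (n choose k)) * J k\<bar>)"
    by (rule sum_abs)
  also have "\<dots> \<le> (\<Sum>k\<le>n. real (n choose k) * (\<Lambda> * (2 ^ n * (2 * \<sigma>))))"
    by (rule sum_mono) (use Jk in auto)
  also have "\<dots> = real (\<Sum>k\<le>n. n choose k) * (\<Lambda> * (2 ^ n * (2 * \<sigma>)))"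
    by (simp only: sum_distrib_right of_nat_sum)
  also have "\<dots> = \<Lambda> * 4 ^ n * (2 * \<sigma>)"
  proof -
    have "(4::real) ^ n = 2 ^ n * 2 ^ n" by (simp add: power_mult_distrib[symmetric])
    then show ?thesis unfolding choose_row_sum of_nat_power of_nat_numeral by (simp only: mult_ac)
  qed
  finally have B: "\<bar>\<integral>x. (f x - exp_profile x) * Q x \<partial>lborel\<bar> \<le> \<Lambda> * 4 ^ n * (2 * \<sigma>)" unfolding JQ .
  have "(\<integral>x. (f x - exp_profile x) * \<Phi> (exp (- x)) \<partial>lborel) =
    (\<integral>x. (f x - exp_profile x) * (\<Phi> (exp (- x)) - Q x) \<partial>lborel) + (\<integral>x. (f x - exp_profile x) * Q x \<partial>lborel)"
    by (subst Bochner_Integration.integral_add[OF i1 iQ, symmetric]) (simp only: distrib_left[symmetric] diff_add_cancel)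
  then show ?thesis using A B by linarith
qed

end

text \<open>The substitution t = exp (- x) turns polynomials in t into combinations of Laplace
  transforms at integers. Vanishing beyond L keeps the relevant t above \<open>exp (- L)\<close>,
  where the logarithm has Lipschitz constant \<open>exp L\<close>. It matters that e is chosen
  before h: later h depends on a further parameter x and on the solution of an equation involving
  the profiles.\<close>

lemma weak_closeness:
  fixes \<alpha> \<eta> \<Lambda> L :: real
  assumes "0 \<le> \<alpha>" "\<alpha> < 1" "0 < \<eta>" "0 \<le> \<Lambda>" "0 \<le> L"
  shows "\<exists>e>0. \<forall>\<epsilon> K f h. coag_profile \<alpha> \<epsilon> K f \<longrightarrow> \<epsilon> \<le> e \<longrightarrow> h \<in> borel_measurable borel \<longrightarrow>
    (\<forall>y\<ge>0. \<bar>h y\<bar> \<le> \<Lambda>) \<longrightarrow> (\<forall>y\<ge>0. \<forall>z\<ge>0. \<bar>h y - h z\<bar> \<le> \<Lambda> * \<bar>y - z\<bar>) \<longrightarrow> (\<forall>y\<ge>L. h y = 0) \<longrightarrow>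
    \<bar>\<integral>x. (f x - exp_profile x) * h x \<partial>lborel\<bar> \<le> \<eta>"
proof -
  define \<Lambda>' where "\<Lambda>' = \<Lambda> * exp L"
  have L': "0 \<le> \<Lambda>'" "\<Lambda> \<le> \<Lambda>'" using assms by (auto simp: \<Lambda>'_def mult_le_cancel_left1)
  obtain n0 :: nat where n0: "6 * \<Lambda>' / \<eta> < real n0" using reals_Archimedean2 by blast
  define n where "n = Suc n0 ^ 2"
  have n: "n > 0" by (simp add: n_def)
  have sq: "sqrt (real n) = real (Suc n0)" by (simp add: n_def del: of_nat_Suc)
  have "3 * \<Lambda>' / sqrt (real n) \<le> \<eta> / 2"
    unfolding sq using n0 assms by (simp add: field_simps)
  \<comment> \<open>The division by 4^n cancels the growth in \<open>Lipschitz_close\<close>;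
    \<open>1 + \<Lambda>'\<close> in place of \<open>\<Lambda>'\<close> avoids a division by
    zero.\<close>
  define \<sigma> where "\<sigma> = \<eta> / 2 * (1 / (1 + \<Lambda>')) / 4 ^ n / 2"
  have \<sigma>: "0 < \<sigma>" using assms L' by (simp add: \<sigma>_def)
  have "\<Lambda>' * 4 ^ n * (2 * \<sigma>) \<le> \<eta> / 2"
  proof -
    have "\<Lambda>' * 4 ^ n * (2 * \<sigma>) = \<eta> / 2 * (\<Lambda>' / (1 + \<Lambda>'))" unfolding \<sigma>_def by simp
    also have "\<dots> \<le> \<eta> / 2 * 1" using assms L' by (intro mult_left_mono) auto
    finally show ?thesis by simp
  qed
  define d where "d = \<sigma> / 2"
  have d: "0 < d" using \<sigma> by (simp add: d_def)
  define A where "A = 541 * (1 + 1 / d) ^ 3 + 540 * (1 + real n) ^ 3 + 1"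
  have A: "1 \<le> A" using d by (auto simp: A_def)
  define e where "e = min (\<sigma> / (2 * A)) ((1 - \<alpha>) / 36)"
  show ?thesis
  proof (intro exI[of _ e] conjI allI impI)
    show "0 < e" using \<sigma> A assms by (simp add: e_def)
    fix \<epsilon> K f h
    assume "coag_profile \<alpha> \<epsilon> K f"
    then interpret coag_profile \<alpha> \<epsilon> K f .
    assume ee: "\<epsilon> \<le> e" and [measurable]: "h \<in> borel_measurable borel"
      and hb: "\<forall>y\<ge>0. \<bar>h y\<bar> \<le> \<Lambda>" and hl: "\<forall>y\<ge>0. \<forall>z\<ge>0. \<bar>h y - h z\<bar> \<le> \<Lambda> * \<bar>y - z\<bar>" and hz: "\<forall>y\<ge>L. h y = 0"
    have small: "36 * \<epsilon> \<le> 1 - \<alpha>" using ee by (simp add: e_def)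
    have eA: "\<epsilon> * A \<le> \<sigma> / 2" using ee A by (simp add: e_def field_simps)
    have 1: "541 * \<epsilon> * (1 + 1 / d) ^ 3 \<le> \<epsilon> * A" "540 * \<epsilon> * (1 + real n) ^ 3 \<le> \<epsilon> * A" "\<epsilon> \<le> \<epsilon> * A"
      unfolding A_def using eps d by (auto simp: algebra_simps)
    have "0 \<le> \<epsilon> * (1 + 1 / d) ^ 3" using eps d by simp
    then have N: "\<bar>(\<integral>x. f x \<partial>lborel) - 1\<bar> \<le> \<sigma>"
      using f_integral_lower(2)[OF small d] f_integral_le_eps 1 eA \<sigma> d_def by (simp add: abs_le_iff)
    have F: "\<bar>F (real j) - real j / (1 + real j)\<bar> \<le> \<sigma>" if "1 \<le> j" "j \<le> n" for j :: nat
      using laplace_close[OF small, of "real j" "real n"] that 1(2) eA \<sigma> by simp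
    \<comment> \<open>Below \<open>exp (- L)\<close> the argument of \<open>h\<close> is frozen at
      L, where \<open>h\<close> vanishes. This makes \<open>\<Phi>\<close> Lipschitz up to t = 0
      without changing the integral.\<close>
    define \<Phi> where "\<Phi> t = h (- ln (max t (exp (- L))))" for t
    have mx: "exp (- L) \<le> max t (exp (- L))" "max t (exp (- L)) \<le> 1" if "t \<in> {0..1}" for t
      using that assms by auto
    have arg: "0 \<le> - ln (max t (exp (- L)))" if "t \<in> {0..1}" for t
      using mx[OF that] by (simp add: less_max_iff_disj)
    have ln_lip: "\<bar>ln a - ln b\<bar> \<le> exp L * \<bar>a - b\<bar>" if "exp (- L) \<le> a" "exp (- L) \<le> b" for a b
    proof -
      have *: "ln b - ln a \<le> exp L * (b - a)" if "exp (- L) \<le> a" "a \<le> b" for a b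
      proof -
        have a: "0 < a" using that(1) by (rule less_le_trans[OF exp_gt_zero])
        have "ln b - ln a \<le> (b - a) / a" using a that ln_diff_le[of b a] by simp
        also have "\<dots> = (1 / a) * (b - a)" by simp
        also have "\<dots> \<le> exp L * (b - a)"
        proof (rule mult_right_mono)
          have "exp L * exp (- L) \<le> exp L * a" using that by (intro mult_left_mono) auto
          then show "1 / a \<le> exp L" using a by (simp add: exp_minus field_simps)
        qed (use that in auto)
        finally show ?thesis .
      qed
      have p: "0 < a" "0 < b" using that by (auto intro: less_le_trans[OF exp_gt_zero])
      show ?thesis
      proof (cases "a \<le> b")
        case True
        then have "ln a \<le> ln b" using p by simp
        then show ?thesis using *[OF that(1) True] True by simp
      next
        case False
        then have "ln b \<le> ln a" using p by simp
        then show ?thesis using *[OF that(2), of a] False by simp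
      qed
    qed
    have "\<bar>\<integral>x. (f x - exp_profile x) * \<Phi> (exp (- x)) \<partial>lborel\<bar> \<le> 3 * \<Lambda>' / sqrt (real n) + \<Lambda>' * 4 ^ n * (2 * \<sigma>)"
    proof (rule Lipschitz_close[OF _ _ n _ N F])
      fix s t :: real assume s: "s \<in> {0..1}" and t: "t \<in> {0..1}"
      have "\<bar>\<Phi> s - \<Phi> t\<bar> \<le> \<Lambda> * \<bar>- ln (max s (exp (- L))) - - ln (max t (exp (- L)))\<bar>"
        unfolding \<Phi>_def using hl arg[OF s] arg[OF t] by blast
      also have "\<dots> \<le> \<Lambda> * (exp L * \<bar>s - t\<bar>)"
      proof (rule mult_left_mono)
        have "\<bar>- ln (max s (exp (- L))) - - ln (max t (exp (- L)))\<bar> = \<bar>ln (max s (exp (- L))) - ln (max t (exp (- L)))\<bar>" by simp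
        also have "\<dots> \<le> exp L * \<bar>max s (exp (- L)) - max t (exp (- L))\<bar>"
          by (rule ln_lip) auto
        also have "\<dots> \<le> exp L * \<bar>s - t\<bar>" by (intro mult_left_mono) auto
        finally show "\<bar>- ln (max s (exp (- L))) - - ln (max t (exp (- L)))\<bar> \<le> exp L * \<bar>s - t\<bar>" .
      qed (use assms in simp)
      finally show "\<bar>\<Phi> s - \<Phi> t\<bar> \<le> \<Lambda>' * \<bar>s - t\<bar>" by (simp add: \<Lambda>'_def mult.assoc)
    next
      fix t :: real assume t: "t \<in> {0..1}"
      then show "\<bar>\<Phi> t\<bar> \<le> \<Lambda>'" unfolding \<Phi>_def using hb arg[OF t] L' by (blast intro: order_trans)
    next
      show "\<Phi> \<in> borel_measurable borel" unfolding \<Phi>_def by measurable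
    qed auto
    also have "\<dots> \<le> \<eta>" using \<open>3 * \<Lambda>' / sqrt (real n) \<le> \<eta> / 2\<close> \<open>\<Lambda>' * 4 ^ n * (2 * \<sigma>) \<le> \<eta> / 2\<close> by simp
    also have "(\<integral>x. (f x - exp_profile x) * \<Phi> (exp (- x)) \<partial>lborel) = (\<integral>x. (f x - exp_profile x) * h x \<partial>lborel)"
    proof (intro Bochner_Integration.integral_cong refl)
      fix x show "(f x - exp_profile x) * \<Phi> (exp (- x)) = (f x - exp_profile x) * h x"
      proof (cases "0 < x")
        case True
        then show ?thesis using hz by (cases "x \<le> L") (auto simp: \<Phi>_def max_def)
      qed (simp add: f_zero exp_profile_def)
    qed
    finally show "\<bar>\<integral>x. (f x - exp_profile x) * h x \<partial>lborel\<bar> \<le> \<eta>" .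
  qed
qed

section \<open>Inverting the linearised operator\<close>

lemma exp_profile_first_moment:
  shows "integrable lborel (\<lambda>x. exp_profile x * x)" "(\<integral>x. exp_profile x * x \<partial>lborel) = 1"
proof -
  have "(\<integral>\<^sup>+x. ennreal (x * exp (- x)) * indicator {0..} x \<partial>lborel) = ennreal (0 - (- (0 + 1) * exp (- 0)))"
  proof (rule nn_integral_FTC_atLeast)
    show "((\<lambda>x. - (x + 1) * exp (- x)) has_real_derivative x * exp (- x)) (at x)" for x :: real
      by (auto intro!: derivative_eq_intros simp: algebra_simps)
    have t: "((\<lambda>x::real. x ^ k * exp (- x)) \<longlongrightarrow> 0) at_top" for k
      using tendsto_power_div_exp_0[of k] by (simp add: exp_minus field_simps)
    have "((\<lambda>x::real. - (x ^ 1 * exp (- x)) - (x ^ 0 * exp (- x))) \<longlongrightarrow> - 0 - 0) at_top"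
      by (intro tendsto_intros t)
    moreover have "(\<lambda>x::real. - (x ^ 1 * exp (- x)) - (x ^ 0 * exp (- x))) = (\<lambda>x. - (x + 1) * exp (- x))"
      by (auto simp: fun_eq_iff algebra_simps)
    ultimately show "((\<lambda>x::real. - (x + 1) * exp (- x)) \<longlongrightarrow> 0) at_top" by simp
  qed auto
  moreover have "(\<integral>\<^sup>+x. ennreal (x * exp (- x)) * indicator {0..} x \<partial>lborel) = (\<integral>\<^sup>+x. ennreal (exp_profile x * x) \<partial>lborel)"
    by (intro nn_integral_cong) (auto simp: exp_profile_def indicator_def)
  ultimately have "has_bochner_integral lborel (\<lambda>x. exp_profile x * x) 1"
    by (intro has_bochner_integral_nn_integral) (auto simp: exp_profile_def)
  then show "integrable lborel (\<lambda>x. exp_profile x * x)" "(\<integral>x. exp_profile x * x \<partial>lborel) = 1"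
    by (auto simp: has_bochner_integral_iff)
qed

section \<open>Primitives on the half line\<close>

lemma antiderivative_pos:
  fixes h :: "real \<Rightarrow> real"
  assumes "continuous_on {0<..} h"
  obtains Q where "\<And>x. 0 < x \<Longrightarrow> (Q has_real_derivative h x) (at x)"
proof -
  have "\<exists>Q. \<forall>x :: real. ereal 0 < ereal x \<longrightarrow> ereal x < \<infinity> \<longrightarrow> (Q has_vector_derivative h x) (at x)"
    using assms by (intro einterval_antiderivative) (auto simp: continuous_on_eq_continuous_at)
  then show ?thesis using that by (auto simp: has_real_derivative_iff_has_vector_derivative)
qed

text \<open>\<open>h\<close> may oscillate at 0, so the primitive is normalised by a limit. Near 0
  an antiderivative is Lipschitz with constant c, hence its values at 1 / (n + 1) form a Cauchy
  sequence.\<close>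

lemma primitive_at_zero:
  fixes h :: "real \<Rightarrow> real"
  assumes cont: "continuous_on {0<..} h" and bd: "\<And>y. 0 < y \<Longrightarrow> y \<le> 1 \<Longrightarrow> \<bar>h y\<bar> \<le> c"
  obtains P where "\<And>x. 0 < x \<Longrightarrow> (P has_real_derivative h x) (at x)" "(P \<longlongrightarrow> 0) (at_right 0)"
proof -
  obtain Q where Q: "\<And>x. 0 < x \<Longrightarrow> (Q has_real_derivative h x) (at x)" using antiderivative_pos[OF cont] by blast
  have c0: "0 \<le> c" using bd[of 1] by simp
  have lip: "\<bar>Q x - Q y\<bar> \<le> c * \<bar>x - y\<bar>" if "0 < x" "x \<le> 1" "0 < y" "y \<le> 1" for x y
  proof -
    have *: "\<bar>Q y - Q x\<bar> \<le> c * \<bar>y - x\<bar>" if xy: "0 < x" "x < y" "y \<le> 1" for x y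
    proof -
      obtain z where "x < z" "z < y" "Q y - Q x = (y - x) * h z"
        using MVT2[of x y Q h] Q xy by auto
      then show ?thesis using bd[of z] xy by (simp add: abs_mult mult.commute mult_left_mono)
    qed
    show ?thesis using *[of x y] *[of y x] that
      by (cases x y rule: linorder_cases) (auto simp: abs_minus_commute)
  qed
  define s where "s n = Q (1 / real (Suc n))" for n
  have s_lim: "(\<lambda>n. 1 / real (Suc n)) \<longlonglongrightarrow> 0" by (intro LIMSEQ_Suc lim_1_over_n)
  have "Cauchy s"
  proof (rule metric_CauchyI)
    fix e :: real assume e: "0 < e"
    have "Cauchy (\<lambda>n. 1 / real (Suc n))" using s_lim by (rule LIMSEQ_imp_Cauchy)
    then obtain M where M: "\<And>m n. M \<le> m \<Longrightarrow> M \<le> n \<Longrightarrow> dist (1 / real (Suc m)) (1 / real (Suc n)) < e / (c + 1)"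
      using metric_CauchyD[of "\<lambda>n. 1 / real (Suc n)" "e / (c + 1)"] e c0 by auto
    show "\<exists>M. \<forall>m\<ge>M. \<forall>n\<ge>M. dist (s m) (s n) < e"
    proof (intro exI allI impI)
      fix m n assume mn: "M \<le> m" "M \<le> n"
      let ?d = "\<bar>1 / real (Suc m) - 1 / real (Suc n)\<bar>"
      have "dist (s m) (s n) \<le> c * ?d" unfolding s_def dist_real_def by (rule lip) auto
      also have "\<dots> \<le> (c + 1) * ?d" by (intro mult_right_mono) auto
      also have "\<dots> < (c + 1) * (e / (c + 1))"
        using M[OF mn] c0 unfolding dist_real_def by (intro mult_strict_left_mono) auto
      also have "\<dots> = e" using c0 by simp
      finally show "dist (s m) (s n) < e" .
    qed
  qed
  then obtain l where l: "s \<longlonglongrightarrow> l" by (auto simp: Cauchy_convergent_iff convergent_def)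
  have near: "\<bar>Q x - l\<bar> \<le> c * x" if "0 < x" "x \<le> 1" for x
  proof (rule tendsto_le)
    show "(\<lambda>n. \<bar>Q x - s n\<bar>) \<longlonglongrightarrow> \<bar>Q x - l\<bar>" by (intro tendsto_intros l)
    show "(\<lambda>n. c * \<bar>x - 1 / real (Suc n)\<bar>) \<longlonglongrightarrow> c * x"
    proof -
      have "(\<lambda>n. c * \<bar>x - 1 / real (Suc n)\<bar>) \<longlonglongrightarrow> c * \<bar>x - 0\<bar>"
        by (intro tendsto_mult tendsto_const tendsto_rabs tendsto_diff s_lim)
      then show ?thesis using that by simp
    qed
    show "\<forall>\<^sub>F n in sequentially. \<bar>Q x - s n\<bar> \<le> c * \<bar>x - 1 / real (Suc n)\<bar>"
      unfolding s_def using that by (intro always_eventually allI lip) auto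
  qed simp
  show ?thesis
  proof (rule that[of "\<lambda>x. Q x - l"])
    show "((\<lambda>x. Q x - l) has_real_derivative h x) (at x)" if "0 < x" for x
      using Q[OF that] by (auto intro!: derivative_eq_intros)
    show "((\<lambda>x. Q x - l) \<longlongrightarrow> 0) (at_right 0)"
    proof (rule Lim_null_comparison)
      show "\<forall>\<^sub>F x in at_right 0. norm (Q x - l) \<le> c * x"
        using near by (auto simp: eventually_at_right_field intro!: exI[of _ 1])
      show "((\<lambda>x. c * x) \<longlongrightarrow> 0) (at_right 0)" by (auto intro!: tendsto_eq_intros)
    qed
  qed
qed

text \<open>Comparison with an explicit primitive replaces the estimate of an integral from 0 to x:
  \<open>B - P\<close> and \<open>B + P\<close> are nondecreasing and start at 0.\<close>

lemma primitive_bound: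
  fixes P B :: "real \<Rightarrow> real"
  assumes P: "\<And>y. 0 < y \<Longrightarrow> (P has_real_derivative h y) (at y)" "(P \<longlongrightarrow> 0) (at_right 0)"
    and B: "\<And>y. 0 < y \<Longrightarrow> (B has_real_derivative k y) (at y)" "(B \<longlongrightarrow> 0) (at_right 0)"
    and le: "\<And>y. 0 < y \<Longrightarrow> y \<le> x \<Longrightarrow> \<bar>h y\<bar> \<le> k y" and x: "0 < x"
  shows "\<bar>P x\<bar> \<le> B x"
proof -
  have *: "0 \<le> B x - \<sigma> * P x" if s: "\<bar>\<sigma>\<bar> = 1" for \<sigma> :: real
  proof (rule tendsto_upperbound)
    show "((\<lambda>y. B y - \<sigma> * P y) \<longlongrightarrow> 0) (at_right 0)"
      using P(2) B(2) by (auto intro!: tendsto_eq_intros)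
    have "B y - \<sigma> * P y \<le> B x - \<sigma> * P x" if "0 < y" "y < x" for y
    proof (rule DERIV_nonneg_imp_nondecreasing[where f = "\<lambda>y. B y - \<sigma> * P y"])
      fix t assume t: "y \<le> t" "t \<le> x"
      then have "0 < t" using that by simp
      then have "((\<lambda>y. B y - \<sigma> * P y) has_real_derivative k t - \<sigma> * h t) (at t)"
        using P(1) B(1) by (auto intro!: derivative_eq_intros)
      moreover have "\<bar>\<sigma> * h t\<bar> \<le> k t" using le[of t] t \<open>0 < t\<close> s by (simp add: abs_mult)
      ultimately show "\<exists>d. ((\<lambda>y. B y - \<sigma> * P y) has_real_derivative d) (at t) \<and> 0 \<le> d"
        by (intro exI[of _ "k t - \<sigma> * h t"]) auto
    qed (use that in simp)
    then show "\<forall>\<^sub>F y in at_right 0. B y - \<sigma> * P y \<le> B x - \<sigma> * P x"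
      using x by (auto simp: eventually_at_right_field)
  qed simp
  show ?thesis using *[of 1] *[of "-1"] by simp
qed

lemma primitive_unique:
  fixes P R :: "real \<Rightarrow> real"
  assumes P: "\<And>y. 0 < y \<Longrightarrow> (P has_real_derivative h y) (at y)" "(P \<longlongrightarrow> 0) (at_right 0)"
    and R: "\<And>y. 0 < y \<Longrightarrow> (R has_real_derivative h y) (at y)" "(R \<longlongrightarrow> 0) (at_right 0)"
    and x: "0 < x"
  shows "P x = R x"
proof -
  have "\<bar>P x - R x\<bar> \<le> 0"
  proof (rule primitive_bound[where h = "\<lambda>_. 0" and k = "\<lambda>_. 0" and B = "\<lambda>_. 0" and P = "\<lambda>x. P x - R x"])
    show "((\<lambda>x. P x - R x) has_real_derivative 0) (at y)" if "0 < y" for y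
      using P(1)[OF that] R(1)[OF that] by (auto intro!: derivative_eq_intros)
    show "((\<lambda>x. P x - R x) \<longlongrightarrow> 0) (at_right 0)" using tendsto_diff[OF P(2) R(2)] by simp
  qed (use x in auto)
  then show ?thesis by simp
qed

section \<open>Averages against the exponential\<close>

lemma exp_profile_times_measurable:
  assumes "continuous_on {0<..} g" "0 \<le> x"
  shows "(\<lambda>y. exp_profile y * g (x + y)) \<in> borel_measurable borel"
proof -
  have "(\<lambda>y. if y \<in> {0<..} then exp (- y) * g (x + y) else 0) \<in> borel_measurable borel"
    using assms(2)
    by (intro borel_measurable_continuous_on_if continuous_intros continuous_on_compose2[OF assms(1)]) auto
  also have "(\<lambda>y. if y \<in> {0<..} then exp (- y) * g (x + y) else 0) = (\<lambda>y. exp_profile y * g (x + y))"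
    by (auto simp: exp_profile_def)
  finally show ?thesis .
qed

lemma exp_profile_average_bound:
  assumes cont: "continuous_on {0<..} g" and x: "0 \<le> x"
    and bd: "\<And>y. 0 < y \<Longrightarrow> \<bar>g (x + y)\<bar> \<le> a + b * y + c * y\<^sup>2"
  shows "integrable lborel (\<lambda>y. exp_profile y * g (x + y))"
    and "\<bar>\<integral>y. exp_profile y * g (x + y) \<partial>lborel\<bar> \<le> a + b + 2 * c"
proof -
  let ?d = "\<lambda>y. a * exp_profile y + b * (exp_profile y * y) + c * (exp_profile y * y\<^sup>2)"
  have d: "integrable lborel ?d"
    using exp_profile_integrable exp_profile_first_moment exp_profile_second_moment by simp
  have le: "\<bar>exp_profile y * g (x + y)\<bar> \<le> ?d y" for y
  proof (cases "0 < y")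
    case True
    from mult_left_mono[OF bd[OF this] exp_profile_nonneg[of y]] show ?thesis
      using exp_profile_nonneg[of y] by (simp add: abs_mult algebra_simps)
  qed (simp add: exp_profile_def)
  show i: "integrable lborel (\<lambda>y. exp_profile y * g (x + y))"
    by (rule Bochner_Integration.integrable_bound[OF d])
       (use exp_profile_times_measurable[OF cont x] le in \<open>auto intro!: order_trans[OF le]\<close>)
  have "\<bar>\<integral>y. exp_profile y * g (x + y) \<partial>lborel\<bar> \<le> (\<integral>y. \<bar>exp_profile y * g (x + y)\<bar> \<partial>lborel)"
    using integral_norm_bound[of lborel "\<lambda>y. exp_profile y * g (x + y)"] by simp
  also have "\<dots> \<le> (\<integral>y. ?d y \<partial>lborel)"
    by (rule integral_mono[OF integrable_abs[OF i] d le])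
  also have "\<dots> = a + b + 2 * c"
    using exp_profile_integrable exp_profile_integral exp_profile_first_moment exp_profile_second_moment by simp
  finally show "\<bar>\<integral>y. exp_profile y * g (x + y) \<partial>lborel\<bar> \<le> a + b + 2 * c" .
qed

text \<open>For the constant kernel 2 the gain part of the adjoint operator is twice this average.
  For g of polynomial growth it is the solution of U' = U - g without an exponentially growing
  part.\<close>

definition exp_average :: "(real \<Rightarrow> real) \<Rightarrow> real \<Rightarrow> real" where
  "exp_average g x = (\<integral>y. exp_profile y * g (x + y) \<partial>lborel)"

lemma exp_average_tail:
  assumes "0 \<le> x"
  shows "exp_average g x = exp x * (\<integral>t. exp_profile t * g t * indicator {x<..} t \<partial>lborel)"
proof -
  have "(\<integral>t. exp_profile t * g t * indicator {x<..} t \<partial>lborel) = (\<integral>y. exp_profile (x + y) * g (x + y) * indicator {x<..} (x + y) \<partial>lborel)"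
    using lborel_integral_real_affine[of 1 "\<lambda>t. exp_profile t * g t * indicator {x<..} t" x] by simp
  also have "\<dots> = (\<integral>y. exp (- x) * (exp_profile y * g (x + y)) \<partial>lborel)"
    using assms by (intro Bochner_Integration.integral_cong refl) (auto simp: exp_profile_def indicator_def exp_diff exp_minus field_simps)
  finally show ?thesis unfolding exp_average_def by (simp add: exp_minus)
qed

text \<open>Quadratic growth is allowed because the second moment of the exponential is finite and
  the functions v below are only known to be O(x^2). Continuity of \<open>g\<close> on the open half
  line suffices, since everything is read off from the tail integral.\<close>

lemma exp_average_props:
  assumes cont: "continuous_on {0<..} g" and bd: "\<And>t. 0 < t \<Longrightarrow> \<bar>g t\<bar> \<le> C * (1 + t\<^sup>2)" and C: "0 \<le> C"
  shows "0 \<le> x \<Longrightarrow> integrable lborel (\<lambda>y. exp_profile y * g (x + y))"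
    and "0 \<le> x \<Longrightarrow> \<bar>exp_average g x\<bar> \<le> C * (5 + 2 * x\<^sup>2)"
    and "0 < x \<Longrightarrow> (exp_average g has_real_derivative exp_average g x - g x) (at x)"
    and "(exp_average g \<longlongrightarrow> exp_average g 0) (at_right 0)"
proof -
  have b: "\<bar>g (x + y)\<bar> \<le> C * (1 + 2 * x\<^sup>2) + 0 * y + (2 * C) * y\<^sup>2" if "0 < y" "0 \<le> x" for x y
  proof -
    have "0 \<le> (x - y)\<^sup>2" by simp
    then have "(x + y)\<^sup>2 \<le> 2 * x\<^sup>2 + 2 * y\<^sup>2" by (simp add: power2_eq_square algebra_simps)
    then have "C * (1 + (x + y)\<^sup>2) \<le> C * (1 + (2 * x\<^sup>2 + 2 * y\<^sup>2))" using C by (intro mult_left_mono) auto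
    moreover have "\<bar>g (x + y)\<bar> \<le> C * (1 + (x + y)\<^sup>2)" using that by (intro bd) auto
    ultimately show ?thesis by (simp add: algebra_simps)
  qed
  show int: "integrable lborel (\<lambda>y. exp_profile y * g (x + y))" if "0 \<le> x" for x
    by (rule exp_profile_average_bound(1)[OF cont that b[OF _ that]])
  show "\<bar>exp_average g x\<bar> \<le> C * (5 + 2 * x\<^sup>2)" if "0 \<le> x" for x
    using exp_profile_average_bound(2)[OF cont that b[OF _ that]] by (simp add: exp_average_def algebra_simps)
  define I where "I x = (\<integral>t. exp_profile t * g t * indicator {x<..} t \<partial>lborel)" for x
  have EI: "exp_average g x = exp x * I x" if "0 \<le> x" for x using exp_average_tail[OF that] by (simp add: I_def)
  have g_int: "integrable lborel (\<lambda>t. exp_profile t * g t)" using int[of 0] by simp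
  have g_ind: "integrable lborel (\<lambda>t. exp_profile t * g t * indicator A t)" if "A \<in> sets borel" for A
    using integrable_mult_indicator[OF _ g_int, of A] that by (simp add: mult.commute)
  have diff: "I a - I b = (\<integral>t. exp_profile t * g t * indicator {a<..b} t \<partial>lborel)" if "a \<le> b" for a b
  proof -
    have "I a - I b = (\<integral>t. exp_profile t * g t * indicator {a<..} t - exp_profile t * g t * indicator {b<..} t \<partial>lborel)"
      unfolding I_def by (rule Bochner_Integration.integral_diff[symmetric]) (auto intro: g_ind)
    also have "\<dots> = (\<integral>t. exp_profile t * g t * indicator {a<..b} t \<partial>lborel)"
      using that by (intro Bochner_Integration.integral_cong refl) (auto simp: indicator_def)
    finally show ?thesis .
  qed
  have c': "continuous_on {0<..} (\<lambda>t. exp (- t) * g t)" by (intro continuous_intros cont)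
  obtain Q where Q: "\<And>x. 0 < x \<Longrightarrow> (Q has_real_derivative exp (- x) * g x) (at x)"
    using antiderivative_pos[OF c'] by blast
  have QI: "I a - I b = Q b - Q a" if "0 < a" "a \<le> b" for a b
  proof -
    have "I a - I b = (\<integral>t. indicator {a..b} t *\<^sub>R (exp (- t) * g t) \<partial>lborel)"
      unfolding diff[OF that(2)]
    proof (rule integral_cong_AE)
      show "AE t in lborel. exp_profile t * g t * indicator {a<..b} t = indicator {a..b} t *\<^sub>R (exp (- t) * g t)"
        using AE_lborel_singleton[of a] by eventually_elim (use that in \<open>auto simp: indicator_def exp_profile_def\<close>)
      show "(\<lambda>t. exp_profile t * g t * indicator {a<..b} t) \<in> borel_measurable lborel"
        using g_ind[of "{a<..b}"] by auto
      have "(\<lambda>t. if t \<in> {a..b} then exp (- t) * g t else 0) \<in> borel_measurable borel"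
        by (intro borel_measurable_continuous_on_if continuous_on_subset[OF c'] continuous_on_const) (use that in auto)
      also have "(\<lambda>t. if t \<in> {a..b} then exp (- t) * g t else 0) = (\<lambda>t. indicator {a..b} t *\<^sub>R (exp (- t) * g t))"
        by (auto simp: indicator_def)
      finally show "(\<lambda>t. indicator {a..b} t *\<^sub>R (exp (- t) * g t)) \<in> borel_measurable lborel" by simp
    qed
    also have "\<dots> = Q b - Q a"
      using that by (intro integral_FTC_atLeastAtMost continuous_on_subset[OF c'])
        (auto simp: has_real_derivative_iff_has_vector_derivative[symmetric] intro!: has_field_derivative_at_within Q)
    finally show ?thesis .
  qed
  \<comment> \<open>The tail integral is a constant minus an antiderivative on the whole open half
    line, so it can be differentiated.\<close>
  define k where "k = I 1 + Q 1"
  have Ieq: "I y = k - Q y" if "0 < y" for y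
    using QI[of y 1] QI[of 1 y] that by (cases "y \<le> 1") (auto simp: k_def)
  show "(exp_average g has_real_derivative exp_average g x - g x) (at x)" if x: "0 < x"
  proof -
    have "((\<lambda>y. exp y * (k - Q y)) has_real_derivative exp x * (k - Q x) - g x) (at x)"
      using Q[OF x] by (auto intro!: derivative_eq_intros simp: exp_minus algebra_simps)
    then have "((\<lambda>y. exp y * (k - Q y)) has_real_derivative exp_average g x - g x) (at x)"
      using x by (simp add: EI Ieq)
    moreover
    have "\<forall>\<^sub>F y in nhds x. exp y * (k - Q y) = exp_average g y"
      using eventually_nhds_in_open[of "{0<..}" x] x by (auto elim!: eventually_mono simp: EI Ieq)
    from DERIV_cong_ev[OF refl this refl] calculation show ?thesis by (rule iffD1)
  qed
  have "((\<lambda>x. exp x * I x) \<longlongrightarrow> exp 0 * I 0) (at_right 0)"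
  proof (intro tendsto_mult)
    show "((\<lambda>x::real. exp x) \<longlongrightarrow> exp 0) (at_right 0)" by (intro tendsto_intros)
    have "((\<lambda>x. I 0 - (I 0 - I x)) \<longlongrightarrow> I 0 - 0) (at_right 0)"
    proof (intro tendsto_diff tendsto_const, rule Lim_null_comparison)
      show "((\<lambda>x. 2 * C * x) \<longlongrightarrow> 0) (at_right 0)" by (auto intro!: tendsto_eq_intros)
      have "norm (I 0 - I x) \<le> 2 * C * x" if x: "0 < x" "x < 1" for x
      proof -
        have d: "integrable lborel (\<lambda>t. 2 * C * indicator {0<..x} t)" using x by (intro integrable_mult_right integrable_real_indicator) auto
        have "norm (I 0 - I x) \<le> (\<integral>t. norm (exp_profile t * g t * indicator {0<..x} t) \<partial>lborel)"
          using x unfolding diff[OF less_imp_le[OF x(1)]] by (intro integral_norm_bound)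
        also have "\<dots> \<le> (\<integral>t. 2 * C * indicator {0<..x} t \<partial>lborel)"
        proof (rule integral_mono)
          show "integrable lborel (\<lambda>t. norm (exp_profile t * g t * indicator {0<..x} t))" using g_ind[of "{0<..x}"] by auto
          fix t
          show "norm (exp_profile t * g t * indicator {0<..x} t) \<le> 2 * C * indicator {0<..x} t"
          proof (cases "t \<in> {0<..x}")
            case True
            then have t: "0 < t" "t \<le> x" by auto
            have "t\<^sup>2 \<le> 1\<^sup>2" using t x by (intro power_mono) auto
            then have "C * (1 + t\<^sup>2) \<le> C * 2" using C by (intro mult_left_mono) auto
            then have "\<bar>g t\<bar> \<le> C * 2" using bd[OF t(1)] by linarith
            then have "exp_profile t * \<bar>g t\<bar> \<le> 1 * (C * 2)" using t C by (intro mult_mono) (auto simp: exp_profile_def)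
            then show ?thesis using True exp_profile_nonneg[of t] by (simp add: abs_mult mult.commute)
          qed simp
        qed (rule d)
        also have "\<dots> = 2 * C * x" using x by simp
        finally show ?thesis .
      qed
      then show "\<forall>\<^sub>F x in at_right 0. norm (I 0 - I x) \<le> 2 * C * x"
        by (auto simp: eventually_at_right_field intro!: exI[of _ 1])
    qed
    then show "(I \<longlongrightarrow> I 0) (at_right 0)" by simp
  qed
  moreover have "\<forall>\<^sub>F x in at_right 0. exp x * I x = exp_average g x"
    using EI by (auto simp: eventually_at_right_field intro!: exI[of _ 1])
  ultimately show "(exp_average g \<longlongrightarrow> exp_average g 0) (at_right 0)"
    by (simp add: EI Lim_transform_eventually)
qed

text \<open>Trades the logarithmic growth found in \<open>solve_laguerre\<close> for a small power b
  at the price 1 / b, so that all later estimates are between powers.\<close>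

lemma ln_le_powr:
  fixes x b :: real
  assumes "0 < x" "0 < b" "b \<le> 1"
  shows "ln (1 + x) \<le> x powr b / b"
proof -
  have "ln ((1 + x) powr b) \<le> (1 + x) powr b - 1" using assms by (intro ln_le_minus_one) auto
  also have "(1 + x) powr b \<le> 1 powr b + x powr b" using assms by (intro powr_add_le) auto
  finally have "b * ln (1 + x) \<le> x powr b" using assms by (simp add: ln_powr)
  then show ?thesis using assms by (simp add: field_simps)
qed

text \<open>The loss part \<open>- x \<psi>' - (1 + V) \<psi>\<close> of the adjoint operator is inverted by an explicit formula, in which
  only \<open>0 \<le> V\<close> matters for the sup bound.\<close>
lemma solve_transport:
  fixes V \<phi> :: "real \<Rightarrow> real"
  assumes \<alpha>: "0 \<le> \<alpha>" "\<alpha> < 1" and CV: "0 \<le> CV"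
    and Vc: "continuous_on {0<..} V" and V0: "\<And>x. 0 < x \<Longrightarrow> 0 \<le> V x"
    and Vb: "\<And>x. 0 < x \<Longrightarrow> V x \<le> CV * (1 + x powr (- \<alpha>))"
    and \<phi>c: "continuous_on {0<..} \<phi>" and \<phi>b: "\<And>x. 0 < x \<Longrightarrow> \<bar>\<phi> x\<bar> \<le> 1 + x"
  obtains \<psi> \<psi>' where
    "\<And>x. 0 < x \<Longrightarrow> (\<psi> has_real_derivative \<psi>' x) (at x)" "continuous_on {0<..} \<psi>'"
    "\<And>x. 0 < x \<Longrightarrow> - x * \<psi>' x - \<psi> x = \<phi> x + V x * \<psi> x"
    "\<And>x. 0 < x \<Longrightarrow> \<bar>\<psi> x\<bar> \<le> 1 + x"
    "\<And>x. 0 < x \<Longrightarrow> \<bar>\<psi>' x\<bar> \<le> (4 + 4 * CV) * x powr (- 1 - \<alpha>) \<or> 1 \<le> x"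
    "\<And>x. 1 \<le> x \<Longrightarrow> \<bar>\<psi>' x\<bar> \<le> 4 + 4 * CV"
proof -
  have "continuous_on {0<..} (\<lambda>x. V x / x)" using Vc by (intro continuous_intros) auto
  \<comment> \<open>\<open>exp (\<Lambda> x)\<close> is the integrating factor: the equation says
    that the derivative of \<open>x * exp (\<Lambda> x) * \<psi> x\<close> is
    \<open>- exp (\<Lambda> x) * \<phi> x\<close>.\<close>
  then obtain \<Lambda> where \<Lambda>: "\<And>x. 0 < x \<Longrightarrow> (\<Lambda> has_real_derivative V x / x) (at x)"
    using antiderivative_pos by blast
  have mono: "\<Lambda> y \<le> \<Lambda> x" if "0 < y" "y \<le> x" for x y
  proof (rule DERIV_nonneg_imp_nondecreasing[of y x \<Lambda>])
    fix t assume "y \<le> t" "t \<le> x"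
    then have "0 < t" using that by simp
    then show "\<exists>d. (\<Lambda> has_real_derivative d) (at t) \<and> 0 \<le> d"
      using \<Lambda>[of t] V0[of t] by (intro exI[of _ "V t / t"]) simp
  qed (rule that)
  have \<Lambda>c: "continuous_on {0<..} \<Lambda>" using \<Lambda> by (auto intro!: continuous_at_imp_continuous_on DERIV_isCont)
  have hb: "\<bar>exp (\<Lambda> y) * \<phi> y\<bar> \<le> exp (\<Lambda> x) * (1 + y)" if "0 < y" "y \<le> x" for x y
    unfolding abs_mult using mono[OF that] \<phi>b[OF that(1)] by (intro mult_mono) auto
  have hc: "continuous_on {0<..} (\<lambda>y. exp (\<Lambda> y) * \<phi> y)" by (intro continuous_intros \<Lambda>c \<phi>c)
  have h1: "\<bar>exp (\<Lambda> y) * \<phi> y\<bar> \<le> exp (\<Lambda> 1) * 2" if "0 < y" "y \<le> 1" for y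
  proof -
    have "exp (\<Lambda> 1) * (1 + y) \<le> exp (\<Lambda> 1) * 2" using that by (intro mult_left_mono) auto
    then show ?thesis using hb[OF that] by linarith
  qed
  obtain I where I: "\<And>x. 0 < x \<Longrightarrow> (I has_real_derivative exp (\<Lambda> x) * \<phi> x) (at x)" "(I \<longlongrightarrow> 0) (at_right 0)"
    using primitive_at_zero[OF hc h1] by blast
  \<comment> \<open>Since \<open>\<Lambda>\<close> is nondecreasing, which is the sign of
    \<open>V\<close>, the factor \<open>exp (\<Lambda> y)\<close> is at most its value at x. There
    it cancels against \<open>exp (- \<Lambda> x)\<close> in the formula for \<open>\<psi>\<close>,
    so the size of \<open>V\<close> drops out of the sup bound.\<close>
  have Ib: "\<bar>I x\<bar> \<le> exp (\<Lambda> x) * (x + x\<^sup>2 / 2)" if x: "0 < x" for x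
  proof (rule primitive_bound[OF I _ _ hb x, where B = "\<lambda>y. exp (\<Lambda> x) * (y + y\<^sup>2 / 2)"])
    show "((\<lambda>y. exp (\<Lambda> x) * (y + y\<^sup>2 / 2)) has_real_derivative exp (\<Lambda> x) * (1 + y)) (at y)" for y
      by (auto intro!: derivative_eq_intros)
    show "((\<lambda>y. exp (\<Lambda> x) * (y + y\<^sup>2 / 2)) \<longlongrightarrow> 0) (at_right 0)" by (auto intro!: tendsto_eq_intros)
  qed
  define \<psi> where "\<psi> x = - (exp (- \<Lambda> x) * I x / x)" for x
  define \<psi>' where "\<psi>' x = - (\<phi> x + (1 + V x) * \<psi> x) / x" for x
  have d: "(\<psi> has_real_derivative \<psi>' x) (at x)" if x: "0 < x" for x
  proof -
    have "(\<psi> has_real_derivative - (((exp (- \<Lambda> x) * (- (V x / x))) * I x + (exp (\<Lambda> x) * \<phi> x) * exp (- \<Lambda> x)) * x - exp (- \<Lambda> x) * I x * 1) / (x * x)) (at x)"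
      unfolding \<psi>_def using x \<Lambda>[OF x] I(1)[OF x]
      by (auto intro!: derivative_eq_intros simp: diff_divide_distrib)
    moreover have "(exp (\<Lambda> x) * \<phi> x) * exp (- \<Lambda> x) = \<phi> x" by (simp add: exp_minus)
    ultimately have "(\<psi> has_real_derivative - (((exp (- \<Lambda> x) * (- (V x / x))) * I x + \<phi> x) * x - exp (- \<Lambda> x) * I x * 1) / (x * x)) (at x)"
      by (simp only:)
    moreover have "- (((exp (- \<Lambda> x) * (- (V x / x))) * I x + \<phi> x) * x - exp (- \<Lambda> x) * I x * 1) / (x * x) = \<psi>' x"
      unfolding \<psi>'_def \<psi>_def using x by (simp add: field_simps)
    ultimately show ?thesis by simp
  qed
  have \<psi>c: "continuous_on {0<..} \<psi>" using d by (auto intro!: continuous_at_imp_continuous_on DERIV_isCont)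
  have c: "continuous_on {0<..} \<psi>'" unfolding \<psi>'_def by (intro continuous_intros \<psi>c \<phi>c Vc) auto
  have b: "\<bar>\<psi> x\<bar> \<le> 1 + x" if x: "0 < x" for x
  proof -
    have "\<bar>\<psi> x\<bar> = exp (- \<Lambda> x) * \<bar>I x\<bar> / x" using x by (simp add: \<psi>_def abs_mult)
    also have "\<dots> \<le> exp (- \<Lambda> x) * (exp (\<Lambda> x) * (x + x\<^sup>2 / 2)) / x"
      using x Ib[OF x] by (intro divide_right_mono mult_left_mono) auto
    also have "\<dots> = 1 + x / 2" using x by (simp add: exp_minus field_simps power2_eq_square)
    finally show ?thesis using x by simp
  qed
  have b': "x * \<bar>\<psi>' x\<bar> \<le> (1 + x) * (2 + CV * (1 + x powr (- \<alpha>)))" if x: "0 < x" for x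
  proof -
    have "x * \<bar>\<psi>' x\<bar> = \<bar>\<phi> x + (1 + V x) * \<psi> x\<bar>" using x by (simp add: \<psi>'_def)
    also have "\<dots> \<le> \<bar>\<phi> x\<bar> + (1 + V x) * \<bar>\<psi> x\<bar>"
      using abs_triangle_ineq[of "\<phi> x" "(1 + V x) * \<psi> x"] V0[OF x] by (simp add: abs_mult)
    also have "\<dots> \<le> (1 + x) + (1 + CV * (1 + x powr (- \<alpha>))) * (1 + x)"
      using \<phi>b[OF x] b[OF x] Vb[OF x] V0[OF x] x CV by (intro add_mono mult_mono) auto
    also have "\<dots> = (1 + x) * (2 + CV * (1 + x powr (- \<alpha>)))" by (simp add: algebra_simps)
    finally show ?thesis .
  qed
  show ?thesis
  proof (rule that[OF d c _ b])
    show "- x * \<psi>' x - \<psi> x = \<phi> x + V x * \<psi> x" if "0 < x" for x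
    proof -
      have "x * \<psi>' x = - (\<phi> x + (1 + V x) * \<psi> x)" using that by (simp add: \<psi>'_def)
      then show ?thesis by (simp add: algebra_simps)
    qed
    show "\<bar>\<psi>' x\<bar> \<le> (4 + 4 * CV) * x powr (- 1 - \<alpha>) \<or> 1 \<le> x" if x: "0 < x" for x
    proof (cases "1 \<le> x")
      case False
      have p: "1 \<le> x powr (- \<alpha>)" using False x \<alpha> powr_mono'[of "- \<alpha>" 0 x] by simp
      have "CV * (1 + x powr (- \<alpha>)) \<le> CV * (2 * x powr (- \<alpha>))" using p CV by (intro mult_left_mono) auto
      then have "(1 + x) * (2 + CV * (1 + x powr (- \<alpha>))) \<le> 2 * (2 * x powr (- \<alpha>) + CV * (2 * x powr (- \<alpha>)))"
        using False x CV p by (intro mult_mono add_mono) auto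
      also have "\<dots> = (4 + 4 * CV) * x powr (- \<alpha>)" by (simp add: algebra_simps)
      finally have "x * \<bar>\<psi>' x\<bar> \<le> (4 + 4 * CV) * x powr (- \<alpha>)" using b'[OF x] by linarith
      then have "\<bar>\<psi>' x\<bar> \<le> (4 + 4 * CV) * x powr (- \<alpha>) / x" using x by (simp add: field_simps)
      also have "\<dots> = (4 + 4 * CV) * x powr (- 1 - \<alpha>)"
      proof -
        have "x powr (- 1 - \<alpha>) = x powr (- \<alpha> - 1)" by (rule arg_cong[where f = "(powr) x"]) simp
        also have "\<dots> = x powr (- \<alpha>) / x" using x by (simp add: powr_diff)
        finally show ?thesis by simp
      qed
      finally show ?thesis by simp
    qed simp
    show "\<bar>\<psi>' x\<bar> \<le> 4 + 4 * CV" if x: "1 \<le> x" for x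
    proof -
      have "x powr (- \<alpha>) \<le> x powr 0" using x \<alpha> by (intro powr_mono) auto
      then have p: "x powr (- \<alpha>) \<le> 1" using x by simp
      have "CV * (1 + x powr (- \<alpha>)) \<le> CV * 2" using p CV by (intro mult_left_mono) auto
      then have "(1 + x) * (2 + CV * (1 + x powr (- \<alpha>))) \<le> (2 * x) * (2 + CV * 2)"
        using x CV p by (intro mult_mono add_mono) auto
      then have "x * \<bar>\<psi>' x\<bar> \<le> x * (4 + 4 * CV)" using b'[of x] x by (simp add: algebra_simps)
      then show ?thesis using x by simp
    qed
  qed
qed

text \<open>With \<open>\<psi> = v - v'\<close> the constant-kernel operator becomes the Laguerre operator \<open>x v'' + (1 - x) v' + v\<close>,
  whose derivative \<open>x r' + (2 - x) r\<close> only involves \<open>r = v''\<close>.\<close>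
lemma solve_laguerre:
  fixes q :: "real \<Rightarrow> real"
  assumes Cq: "0 \<le> Cq" and qc: "continuous_on {0<..} q" and qb: "\<And>x. 0 < x \<Longrightarrow> \<bar>q x\<bar> \<le> Cq"
    and q0: "(\<integral>y. exp_profile y * (y * q y) \<partial>lborel) = 0"
  obtains \<psi> \<psi>' v where
    "\<And>x. 0 < x \<Longrightarrow> (\<psi> has_real_derivative \<psi>' x) (at x)" "continuous_on {0<..} \<psi>'"
    "\<And>x. 0 < x \<Longrightarrow> \<bar>\<psi>' x\<bar> \<le> 4 * Cq * (1 + ln (1 + x))"
    "(\<psi> \<longlongrightarrow> 0) (at_right 0)"
    "\<And>x. 0 < x \<Longrightarrow> integrable lborel (\<lambda>y. exp_profile y * \<psi> (x + y))" "integrable lborel (\<lambda>y. exp_profile y * \<psi> y)"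
    "\<And>x. 0 < x \<Longrightarrow> exp_average \<psi> x = v x" "exp_average \<psi> 0 = 0"
    "\<And>x. 0 < x \<Longrightarrow> ((\<lambda>x. - x * \<psi>' x - \<psi> x + 2 * v x) has_real_derivative q x) (at x)"
    "((\<lambda>x. - x * \<psi>' x - \<psi> x + 2 * v x) \<longlongrightarrow> 0) (at_right 0)"
proof -
  define g where "g t = t * q t" for t
  have gc: "continuous_on {0<..} g" unfolding g_def by (intro continuous_intros qc)
  have gb: "\<bar>g t\<bar> \<le> Cq * t" if "0 < t" for t
    using qb[OF that] that mult_right_mono[of "\<bar>q t\<bar>" Cq t] by (simp add: g_def abs_mult mult.commute)
  have gb2: "\<bar>g t\<bar> \<le> Cq * (1 + t\<^sup>2)" if "0 < t" for t
  proof -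
    have "0 \<le> (t - 1)\<^sup>2" by simp
    then have "2 * t \<le> 1 + t\<^sup>2" by (simp add: power2_eq_square algebra_simps)
    then have "t \<le> 1 + t\<^sup>2" using that by simp
    from mult_left_mono[OF this Cq] show ?thesis using gb[OF that] by linarith
  qed
  have U3: "(exp_average g has_real_derivative exp_average g x - g x) (at x)" if "0 < x" for x
    by (rule exp_average_props(3)[OF gc gb2 Cq that])
  have U4: "(exp_average g \<longlongrightarrow> exp_average g 0) (at_right 0)"
    by (rule exp_average_props(4)[OF gc gb2 Cq])
  \<comment> \<open>Multiplied by \<open>x * exp (- x)\<close>, the equation for r says that
    \<open>x^2 * exp (- x) * r\<close> has the derivative \<open>x * exp (- x) * q\<close>.
    \<open>U\<close> is \<open>exp x\<close> times the tail integral of the latter, which gives r =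
    - U / x^2.\<close>
  define U where "U = exp_average g"
  have dU: "(U has_real_derivative U x - x * q x) (at x)" if "0 < x" for x
    using U3[OF that] by (simp add: U_def g_def)
  \<comment> \<open>The orthogonality of q is used here. Without it r would behave like 1 / x^2 at
    the origin; with it the tail integral equals minus the integral from 0, which is O(x^2).\<close>
  have U0: "U 0 = 0" using q0 by (simp add: U_def exp_average_def g_def)
  have lU: "(U \<longlongrightarrow> 0) (at_right 0)" using U4 U0 by (simp add: U_def)
  have Ub: "\<bar>U x\<bar> \<le> Cq * (x + 1)" if "0 < x" for x
  proof -
    have "\<bar>g (x + y)\<bar> \<le> Cq * x + Cq * y + 0 * y\<^sup>2" if "0 < y" for y
      using gb[of "x + y"] \<open>0 < x\<close> that by (simp add: distrib_left)
    from exp_profile_average_bound(2)[OF gc less_imp_le[OF that] this] show ?thesis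
      by (simp add: U_def exp_average_def algebra_simps)
  qed
  have Ub0: "\<bar>exp (- x) * U x\<bar> \<le> Cq * (x\<^sup>2 / 2)" if x: "0 < x" for x
  proof (rule primitive_bound[where h = "\<lambda>y. - (exp (- y) * (y * q y))" and k = "\<lambda>y. Cq * y" and B = "\<lambda>y. Cq * (y\<^sup>2 / 2)" and P = "\<lambda>y. exp (- y) * U y"])
    show "((\<lambda>y. exp (- y) * U y) has_real_derivative - (exp (- y) * (y * q y))) (at y)" if "0 < y" for y
      using dU[OF that] by (auto intro!: derivative_eq_intros simp: algebra_simps)
    show "((\<lambda>y. exp (- y) * U y) \<longlongrightarrow> 0) (at_right 0)"
      using lU by (auto intro!: tendsto_eq_intros)
    show "((\<lambda>y. Cq * (y\<^sup>2 / 2)) has_real_derivative Cq * y) (at y)" for y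
      by (auto intro!: derivative_eq_intros)
    show "((\<lambda>y. Cq * (y\<^sup>2 / 2)) \<longlongrightarrow> 0) (at_right 0)" by (auto intro!: tendsto_eq_intros)
    show "\<bar>- (exp (- y) * (y * q y))\<bar> \<le> Cq * y" if "0 < y" "y \<le> x" for y
    proof -
      have "exp (- y) * \<bar>g y\<bar> \<le> 1 * (Cq * y)" using gb[OF that(1)] that Cq by (intro mult_mono) auto
      then show ?thesis by (simp add: abs_mult g_def)
    qed
  qed (rule x)
  define r where "r x = - (U x / x\<^sup>2)" for x
  define r' where "r' x = - ((U x - x * q x) / x\<^sup>2) + 2 * U x / x ^ 3" for x
  have dr: "(r has_real_derivative r' x) (at x)" if x: "0 < x" for x
    unfolding r_def r'_def using dU[OF x] x
    by (auto intro!: derivative_eq_intros simp: field_simps power2_eq_square power3_eq_cube)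
  have rq: "x * r' x + (2 - x) * r x = q x" if x: "0 < x" for x
    unfolding r_def r'_def using x by (simp add: field_simps power2_eq_square power3_eq_cube)
  \<comment> \<open>The representation by the tail is used for x \<ge> 1 and the one from 0 for x <
    1. The decay 1 / (1 + x) is what makes w, and with it the derivative of \<open>\<psi>\<close>,
    grow only logarithmically.\<close>
  have rb: "\<bar>r x\<bar> \<le> 4 * Cq * (1 / (1 + x))" if x: "0 < x" for x
  proof (cases "1 \<le> x")
    case True
    have "\<bar>r x\<bar> \<le> Cq * (x + 1) / x\<^sup>2" unfolding r_def using Ub[OF x] x by (simp add: abs_divide divide_right_mono)
    also have "\<dots> = Cq * ((x + 1) / x\<^sup>2)" by simp
    also have "\<dots> \<le> Cq * (4 * (1 / (1 + x)))"
    proof (rule mult_left_mono[OF _ Cq])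
      have "(x + 1) * (1 + x) \<le> (2 * x) * (2 * x)" using True by (intro mult_mono) auto
      then show "(x + 1) / x\<^sup>2 \<le> 4 * (1 / (1 + x))" using x by (simp add: field_simps power2_eq_square)
    qed
    finally show ?thesis by (simp add: mult.commute)
  next
    case False
    have "\<bar>U x\<bar> = exp x * \<bar>exp (- x) * U x\<bar>" by (simp add: abs_mult exp_minus)
    also have "\<dots> \<le> exp x * (Cq * (x\<^sup>2 / 2))" using Ub0[OF x] by (intro mult_left_mono) auto
    also have "\<dots> \<le> 3 * (Cq * (x\<^sup>2 / 2))"
    proof (rule mult_right_mono)
      have "exp x \<le> exp 1" using False by simp
      then show "exp x \<le> 3" using exp_le by linarith
    qed (use Cq in simp)
    finally have "\<bar>U x\<bar> / x\<^sup>2 \<le> 3 * (Cq * (x\<^sup>2 / 2)) / x\<^sup>2" using x by (intro divide_right_mono) auto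
    then have "\<bar>r x\<bar> \<le> Cq * (3 / 2)" using x by (simp add: r_def abs_divide)
    also have "\<dots> \<le> Cq * (4 * (1 / (1 + x)))" using False x by (intro mult_left_mono Cq) (auto simp: field_simps)
    finally show ?thesis by (simp add: mult.commute)
  qed
  have rb1: "\<bar>r x\<bar> \<le> 4 * Cq" if "0 < x" for x
  proof -
    have "4 * Cq * (1 / (1 + x)) \<le> 4 * Cq * 1" using that Cq by (intro mult_left_mono) auto
    then show ?thesis using rb[OF that] by linarith
  qed
  have rc: "continuous_on {0<..} r" using dr by (auto intro!: continuous_at_imp_continuous_on DERIV_isCont)
  obtain w where w: "\<And>x. 0 < x \<Longrightarrow> (w has_real_derivative r x) (at x)" "(w \<longlongrightarrow> 0) (at_right 0)"
    using primitive_at_zero[OF rc rb1] by blast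
  have wb: "\<bar>w x\<bar> \<le> 4 * Cq * ln (1 + x)" if x: "0 < x" for x
  proof (rule primitive_bound[OF w _ _ rb x, where B = "\<lambda>y. 4 * Cq * ln (1 + y)"])
    show "((\<lambda>y. 4 * Cq * ln (1 + y)) has_real_derivative 4 * Cq * (1 / (1 + y))) (at y)" if "0 < y" for y
      using that by (auto intro!: derivative_eq_intros)
    show "((\<lambda>y. 4 * Cq * ln (1 + y)) \<longlongrightarrow> 0) (at_right 0)" by (auto intro!: tendsto_eq_intros)
  qed
  have wb2: "\<bar>w x\<bar> \<le> 4 * Cq * x" if "0 < x" for x
  proof -
    have "4 * Cq * ln (1 + x) \<le> 4 * Cq * x" using that Cq by (intro mult_left_mono ln_add_one_self_le_self) auto
    then show ?thesis using wb[OF that] by linarith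
  qed
  have wc: "continuous_on {0<..} w" using w by (auto intro!: continuous_at_imp_continuous_on DERIV_isCont)
  have wb1: "\<bar>w x\<bar> \<le> 4 * Cq" if "0 < x" "x \<le> 1" for x
  proof -
    have "4 * Cq * x \<le> 4 * Cq * 1" using that Cq by (intro mult_left_mono) auto
    then show ?thesis using wb2[OF that(1)] by linarith
  qed
  obtain v where v: "\<And>x. 0 < x \<Longrightarrow> (v has_real_derivative w x) (at x)" "(v \<longlongrightarrow> 0) (at_right 0)"
    using primitive_at_zero[OF wc wb1] by blast
  have vb: "\<bar>v x\<bar> \<le> 2 * Cq * x\<^sup>2" if x: "0 < x" for x
  proof (rule primitive_bound[OF v _ _ wb2 x, where B = "\<lambda>y. 2 * Cq * y\<^sup>2"])
    show "((\<lambda>y. 2 * Cq * y\<^sup>2) has_real_derivative 4 * Cq * y) (at y)" for y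
      by (auto intro!: derivative_eq_intros)
    show "((\<lambda>y. 2 * Cq * y\<^sup>2) \<longlongrightarrow> 0) (at_right 0)" by (auto intro!: tendsto_eq_intros)
  qed
  have vc: "continuous_on {0<..} v" using v by (auto intro!: continuous_at_imp_continuous_on DERIV_isCont)
  define \<psi> where "\<psi> x = v x - w x" for x
  define \<psi>' where "\<psi>' x = w x - r x" for x
  have \<psi>c: "continuous_on {0<..} \<psi>" unfolding \<psi>_def by (intro continuous_intros vc wc)
  have \<psi>b: "\<bar>\<psi> x\<bar> \<le> (6 * Cq) * (1 + x\<^sup>2)" if x: "0 < x" for x
  proof -
    have "0 \<le> (x - 1)\<^sup>2" by simp
    then have "2 * x \<le> 1 + x\<^sup>2" by (simp add: power2_eq_square algebra_simps)
    from mult_left_mono[OF this, of "2 * Cq"] have "4 * Cq * x \<le> 2 * Cq * (1 + x\<^sup>2)" using Cq by simp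
    then have "\<bar>\<psi> x\<bar> \<le> 2 * Cq * x\<^sup>2 + 2 * Cq * (1 + x\<^sup>2)" using vb[OF x] wb2[OF x] by (simp add: \<psi>_def abs_le_iff)
    also have "\<dots> \<le> (6 * Cq) * (1 + x\<^sup>2)" using Cq by (simp add: algebra_simps)
    finally show ?thesis .
  qed
  have C6: "0 \<le> 6 * Cq" using Cq by simp
  have A1: "integrable lborel (\<lambda>y. exp_profile y * \<psi> (x + y))" if "0 \<le> x" for x
    by (rule exp_average_props(1)[OF \<psi>c \<psi>b C6 that])
  have A2: "\<bar>exp_average \<psi> x\<bar> \<le> 6 * Cq * (5 + 2 * x\<^sup>2)" if "0 \<le> x" for x
    by (rule exp_average_props(2)[OF \<psi>c \<psi>b C6 that])
  have A3: "(exp_average \<psi> has_real_derivative exp_average \<psi> x - \<psi> x) (at x)" if "0 < x" for x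
    by (rule exp_average_props(3)[OF \<psi>c \<psi>b C6 that])
  have A4: "(exp_average \<psi> \<longlongrightarrow> exp_average \<psi> 0) (at_right 0)"
    by (rule exp_average_props(4)[OF \<psi>c \<psi>b C6])
  have Av: "exp_average \<psi> x = v x" if x: "0 < x" for x
  proof -
    \<comment> \<open>\<open>exp_average \<psi>\<close> and v solve the same equation u' = u -
      \<psi>, so they differ by a multiple of the exponential, which polynomial growth
      excludes.\<close>
    define D where "D y = exp (- y) * (exp_average \<psi> y - v y)" for y
    have dD: "(D has_real_derivative 0) (at y)" if "0 < y" for y
      unfolding D_def using A3[OF that] v(1)[OF that]
      by (auto intro!: derivative_eq_intros simp: \<psi>_def algebra_simps)
    have "\<exists>k. \<forall>y\<in>{0<..}. D y = k"
      by (rule has_field_derivative_zero_constant) (auto intro!: has_field_derivative_at_within dD)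
    then have const: "D y = D x" if "0 < y" for y using that x by auto
    have Db: "norm (D y) \<le> 30 * Cq * (y ^ 0 * exp (- y)) + 14 * Cq * (y ^ 2 * exp (- y))" if "0 < y" for y
    proof -
      have "\<bar>exp_average \<psi> y - v y\<bar> \<le> (6 * Cq) * (5 + 2 * y\<^sup>2) + 2 * Cq * y\<^sup>2"
        using A2[of y] vb[of y] that by linarith
      from mult_left_mono[OF this, of "exp (- y)"]
      have "exp (- y) * \<bar>exp_average \<psi> y - v y\<bar> \<le> 30 * Cq * (y ^ 0 * exp (- y)) + 14 * Cq * (y ^ 2 * exp (- y))"
        by (simp add: algebra_simps)
      moreover have "norm (D y) = exp (- y) * \<bar>exp_average \<psi> y - v y\<bar>" by (simp add: D_def abs_mult)
      ultimately show ?thesis by (simp only:)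
    qed
    have t: "((\<lambda>x::real. x ^ k * exp (- x)) \<longlongrightarrow> 0) at_top" for k
      using tendsto_power_div_exp_0[of k] by (simp add: exp_minus field_simps)
    have "(D \<longlongrightarrow> 0) at_top"
    proof (rule Lim_null_comparison)
      show "\<forall>\<^sub>F y in at_top. norm (D y) \<le> 30 * Cq * (y ^ 0 * exp (- y)) + 14 * Cq * (y ^ 2 * exp (- y))"
        using eventually_gt_at_top[of 0] by eventually_elim (rule Db)
      have "((\<lambda>y. 30 * Cq * (y ^ 0 * exp (- y)) + 14 * Cq * (y ^ 2 * exp (- y))) \<longlongrightarrow> 30 * Cq * 0 + 14 * Cq * 0) at_top"
        by (intro tendsto_add tendsto_mult tendsto_const t)
      then show "((\<lambda>y. 30 * Cq * (y ^ 0 * exp (- y)) + 14 * Cq * (y ^ 2 * exp (- y))) \<longlongrightarrow> 0) at_top" by simp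
    qed
    moreover have "(D \<longlongrightarrow> D x) at_top"
    proof (rule tendsto_eventually)
      show "\<forall>\<^sub>F y in at_top. D y = D x" using eventually_gt_at_top[of 0] by eventually_elim (rule const)
    qed
    ultimately have "D x = 0" using tendsto_unique[OF trivial_limit_at_top_linorder] by blast
    then show ?thesis by (simp add: D_def)
  qed
  have "(exp_average \<psi> \<longlongrightarrow> 0) (at_right 0)"
  proof (rule Lim_transform_eventually[OF v(2)])
    show "\<forall>\<^sub>F x in at_right 0. v x = exp_average \<psi> x" using Av by (auto simp: eventually_at_right_field intro!: exI[of _ 1])
  qed
  then have A0: "exp_average \<psi> 0 = 0" using tendsto_unique[OF _ A4] by fastforce
  have Q: "- x * \<psi>' x - \<psi> x + 2 * v x = x * r x + (1 - x) * w x + v x" for x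
    by (simp add: \<psi>'_def \<psi>_def algebra_simps)
  show ?thesis
  proof (rule that[of \<psi> \<psi>' v])
    show "(\<psi> has_real_derivative \<psi>' x) (at x)" if "0 < x" for x
      unfolding \<psi>_def \<psi>'_def using v(1)[OF that] w(1)[OF that] by (auto intro!: derivative_eq_intros)
    show "continuous_on {0<..} \<psi>'" unfolding \<psi>'_def by (intro continuous_intros wc rc)
    show "\<bar>\<psi>' x\<bar> \<le> 4 * Cq * (1 + ln (1 + x))" if "0 < x" for x
      unfolding \<psi>'_def using wb[OF that] rb1[OF that] by (simp add: distrib_left)
    show "(\<psi> \<longlongrightarrow> 0) (at_right 0)" unfolding \<psi>_def using tendsto_diff[OF v(2) w(2)] by simp
    show "integrable lborel (\<lambda>y. exp_profile y * \<psi> (x + y))" if "0 < x" for x using A1[of x] that by simp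
    show "integrable lborel (\<lambda>y. exp_profile y * \<psi> y)" using A1[of 0] by simp
    show "exp_average \<psi> x = v x" if "0 < x" for x by (rule Av[OF that])
    show "exp_average \<psi> 0 = 0" by (rule A0)
    show "((\<lambda>x. - x * \<psi>' x - \<psi> x + 2 * v x) has_real_derivative q x) (at x)" if x: "0 < x" for x
      unfolding Q using dr[OF x] w(1)[OF x] v(1)[OF x] rq[OF x]
      by (auto intro!: derivative_eq_intros simp: algebra_simps)
    have l: "((\<lambda>x. x * r x) \<longlongrightarrow> 0) (at_right 0)"
    proof (rule Lim_null_comparison)
      show "\<forall>\<^sub>F x in at_right 0. norm (x * r x) \<le> x * (4 * Cq)"
        using rb1 by (auto simp: eventually_at_right_field abs_mult intro!: exI[of _ 1])
      show "((\<lambda>x. x * (4 * Cq)) \<longlongrightarrow> 0) (at_right 0)" by (auto intro!: tendsto_eq_intros)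
    qed
    have m: "((\<lambda>x. 1 - x) \<longlongrightarrow> 1 - 0) (at_right (0::real))" by (intro tendsto_intros)
    show "((\<lambda>x. - x * \<psi>' x - \<psi> x + 2 * v x) \<longlongrightarrow> 0) (at_right 0)"
      unfolding Q using tendsto_add[OF tendsto_add[OF l tendsto_mult[OF m w(2)]] v(2)] by simp
  qed
qed

text \<open>For the constant kernel and the exponential profile the operator is \<open>- x * \<psi>'
  x - \<psi> x + 2 * (exp_average \<psi> x - exp_average \<psi> 0)\<close>. The summand
  \<open>\<psi>a\<close> absorbs \<open>\<phi>\<close>, transport and loss; what it leaves, twice an
  average of \<open>\<psi>a\<close>, can be differentiated and becomes the right-hand side for
  \<open>\<psi>b\<close>. The summands stay separate because only \<open>\<psi>a\<close> is
  multiplied by \<open>V\<close>: \<open>\<psi>b\<close> is O(x) at 0 and tames \<open>V\<close>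
  without help. The constant C must not depend on \<open>V\<close> or \<open>\<phi>\<close>.\<close>

lemma solve_adjoint:
  fixes \<alpha> CV b :: real
  assumes \<alpha>: "0 \<le> \<alpha>" "\<alpha> < 1" and CV: "0 \<le> CV" and b: "0 < b" "b \<le> 1"
  shows "\<exists>C\<ge>1. \<forall>V \<phi>. continuous_on {0<..} V \<longrightarrow> (\<forall>x>0. 0 \<le> V x \<and> V x \<le> CV * (1 + x powr (- \<alpha>))) \<longrightarrow>
    continuous_on {0<..} \<phi> \<longrightarrow> (\<forall>x>0. \<bar>\<phi> x\<bar> \<le> 1 + x) \<longrightarrow>
    (\<exists>\<psi>a \<psi>b \<psi>' c. (\<forall>x>0. ((\<lambda>x. \<psi>a x + \<psi>b x) has_real_derivative \<psi>' x) (at x)) \<and> continuous_on {0<..} \<psi>' \<and>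
      (\<forall>x>0. \<bar>\<psi>' x\<bar> \<le> C * (x powr (- 1 - \<alpha>) + x powr b)) \<and>
      (\<forall>x>0. \<bar>\<psi>a x\<bar> \<le> 1 + x) \<and> (\<forall>x>0. \<bar>\<psi>b x\<bar> \<le> C * (x + x powr (1 + b))) \<and>
      (\<forall>x>0. \<bar>\<psi>a x + \<psi>b x\<bar> \<le> C * (1 + x powr (1 + b))) \<and>
      (\<forall>x>0. integrable lborel (\<lambda>y. exp_profile y * ((\<psi>a (x + y) + \<psi>b (x + y)) - (\<psi>a x + \<psi>b x) - (\<psi>a y + \<psi>b y)))) \<and>
      (\<forall>x>0. (\<psi>a x + \<psi>b x) - x * \<psi>' x +
         2 * (\<integral>y. exp_profile y * ((\<psi>a (x + y) + \<psi>b (x + y)) - (\<psi>a x + \<psi>b x) - (\<psi>a y + \<psi>b y)) \<partial>lborel)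
         = \<phi> x + V x * \<psi>a x - c * x))"
proof -
  define C1 where "C1 = 4 + 4 * CV"
  define Cu where "Cu = C1 + 5"
  define Cq where "Cq = 4 * Cu"
  define C2 where "C2 = C1 + 8 * Cq / b"
  define C where "C = 2 + 2 * C2"
  have C1: "4 \<le> C1" using CV by (simp add: C1_def)
  have Cu: "0 \<le> Cu" "C1 \<le> Cu" "5 \<le> Cu" using C1 by (auto simp: Cu_def)
  have Cq: "0 \<le> Cq" using Cu by (simp add: Cq_def)
  have C2: "C1 \<le> C2" "8 * Cq / b \<le> C2" "0 \<le> C2" using C1 Cq b by (auto simp: C2_def)
  have CC: "1 \<le> C" "C2 \<le> C" using C2 by (auto simp: C_def)
  show ?thesis
  proof (intro exI[of _ C] conjI allI impI)
    fix V \<phi> :: "real \<Rightarrow> real"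
    assume Vc: "continuous_on {0<..} V" and V: "\<forall>x>0. 0 \<le> V x \<and> V x \<le> CV * (1 + x powr (- \<alpha>))"
      and \<phi>c: "continuous_on {0<..} \<phi>" and \<phi>b: "\<forall>x>0. \<bar>\<phi> x\<bar> \<le> 1 + x"
    obtain \<psi>a \<psi>a' where a: "\<And>x. 0 < x \<Longrightarrow> (\<psi>a has_real_derivative \<psi>a' x) (at x)" "continuous_on {0<..} \<psi>a'"
      "\<And>x. 0 < x \<Longrightarrow> - x * \<psi>a' x - \<psi>a x = \<phi> x + V x * \<psi>a x"
      "\<And>x. 0 < x \<Longrightarrow> \<bar>\<psi>a x\<bar> \<le> 1 + x"
      "\<And>x. 0 < x \<Longrightarrow> \<bar>\<psi>a' x\<bar> \<le> C1 * x powr (- 1 - \<alpha>) \<or> 1 \<le> x"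
      "\<And>x. 1 \<le> x \<Longrightarrow> \<bar>\<psi>a' x\<bar> \<le> C1"
      using solve_transport[OF \<alpha> CV Vc _ _ \<phi>c] V \<phi>b unfolding C1_def by blast
    have ac: "continuous_on {0<..} \<psi>a" using a(1) by (auto intro!: continuous_at_imp_continuous_on DERIV_isCont)
    have ab2: "\<bar>\<psi>a t\<bar> \<le> 2 * (1 + t\<^sup>2)" if "0 < t" for t
    proof -
      have "0 \<le> (t - 1)\<^sup>2" by simp
      then have "2 * t \<le> 1 + t\<^sup>2" by (simp add: power2_eq_square algebra_simps)
      moreover have "1 + t \<le> 2 * (1 + s)" if "2 * t \<le> 1 + s" "0 \<le> s" for s using that by simp
      ultimately have "1 + t \<le> 2 * (1 + t\<^sup>2)" using zero_le_power2 by blast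
      then show ?thesis by (rule order_trans[OF a(4)[OF that]])
    qed
    have A1: "integrable lborel (\<lambda>y. exp_profile y * \<psi>a (x + y))" if "0 \<le> x" for x
      by (rule exp_average_props(1)[OF ac ab2 _ that]) auto
    have A3: "(exp_average \<psi>a has_real_derivative exp_average \<psi>a x - \<psi>a x) (at x)" if "0 < x" for x
      by (rule exp_average_props(3)[OF ac ab2 _ that]) auto
    have A4: "(exp_average \<psi>a \<longlongrightarrow> exp_average \<psi>a 0) (at_right 0)"
      by (rule exp_average_props(4)[OF ac ab2]) auto
    define U where "U = exp_average \<psi>a"
    have Uc: "continuous_on {0<..} U" using A3 unfolding U_def by (auto intro!: continuous_at_imp_continuous_on DERIV_isCont)
    \<comment> \<open>\<open>U x - \<psi>a x\<close> is the average of the increments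
      \<open>\<psi>a (x + y) - \<psi>a x\<close>. It stays bounded although \<open>U\<close> and
      \<open>\<psi>a\<close> may grow linearly, because the derivative of \<open>\<psi>a\<close> is
      bounded for x \<ge> 1; for x < 1 the sup bounds suffice.\<close>
    have ub: "\<bar>U x - \<psi>a x\<bar> \<le> Cu" if x: "0 < x" for x
    proof (cases "1 \<le> x")
      case False
      have "\<bar>\<psi>a (x + y)\<bar> \<le> (1 + x) + 1 * y + 0 * y\<^sup>2" if "0 < y" for y
        using a(4)[of "x + y"] x that by simp
      from exp_profile_average_bound(2)[OF ac less_imp_le[OF x] this] have "\<bar>U x\<bar> \<le> 2 + x" by (simp add: U_def exp_average_def)
      then show ?thesis using a(4)[OF x] False Cu by linarith
    next
      case True
      have "\<bar>\<psi>a (x + y) - \<psi>a x\<bar> \<le> 0 + C1 * y + 0 * y\<^sup>2" if y: "0 < y" for y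
      proof -
        obtain z where "x < z" "z < x + y" "\<psi>a (x + y) - \<psi>a x = (x + y - x) * \<psi>a' z"
          using MVT2[of x "x + y" \<psi>a \<psi>a'] a(1) x y by auto
        then show ?thesis using a(6)[of z] True y by (simp add: abs_mult mult.commute mult_left_mono)
      qed
      from exp_profile_average_bound(2)[OF _ less_imp_le[OF x] this] ac
      have "\<bar>\<integral>y. exp_profile y * (\<psi>a (x + y) - \<psi>a x) \<partial>lborel\<bar> \<le> C1" by (simp add: continuous_on_diff)
      moreover have "(\<integral>y. exp_profile y * (\<psi>a (x + y) - \<psi>a x) \<partial>lborel) = U x - \<psi>a x"
        unfolding U_def exp_average_def right_diff_distrib using A1[of x] x exp_profile_integrable exp_profile_integral by simp
      ultimately show ?thesis using Cu by simp
    qed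
    define k where "k x = U x - \<psi>a x" for x
    have kc: "continuous_on {0<..} k" unfolding k_def by (intro continuous_intros Uc ac)
    have kb: "\<bar>0 + y\<bar> * \<bar>k (0 + y)\<bar> \<le> 0 + Cu * y + 0 * y\<^sup>2" if "0 < y" for y
      using ub[OF that] that by (simp add: k_def mult.commute mult_right_mono)
    have ykc: "continuous_on {0<..} (\<lambda>y. y * k y)" by (intro continuous_intros kc)
    have yk: "integrable lborel (\<lambda>y. exp_profile y * (y * k y))" "\<bar>\<integral>y. exp_profile y * (y * k y) \<partial>lborel\<bar> \<le> Cu"
      using exp_profile_average_bound[OF ykc order_refl, of 0 Cu 0] kb by (simp_all add: abs_mult)
    \<comment> \<open>Chosen to make q orthogonal to \<open>y * exp (- y)\<close>, a weight of total
      integral 1. After integration by parts this says that the right-hand side is orthogonal to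
      \<open>(x - 1) * exp (- x)\<close>, the direction in which the profile moves when its mass
      changes.\<close>
    define c where "c = - 2 * (\<integral>y. exp_profile y * (y * k y) \<partial>lborel)"
    define q where "q x = - 2 * k x - c" for x
    have qc: "continuous_on {0<..} q" unfolding q_def by (intro continuous_intros kc)
    have qb: "\<bar>q x\<bar> \<le> Cq" if "0 < x" for x
    proof -
      have "\<bar>q x\<bar> \<le> 2 * \<bar>k x\<bar> + \<bar>c\<bar>" unfolding q_def by linarith
      moreover have "\<bar>c\<bar> \<le> 2 * Cu" using yk(2) by (simp add: c_def abs_mult)
      moreover have "\<bar>k x\<bar> \<le> Cu" using ub[OF that] by (simp add: k_def)
      ultimately show ?thesis unfolding Cq_def by linarith
    qed
    have q0: "(\<integral>y. exp_profile y * (y * q y) \<partial>lborel) = 0"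
    proof -
      have "exp_profile y * (y * q y) = - 2 * (exp_profile y * (y * k y)) - c * (exp_profile y * y)" for y
        by (simp add: q_def algebra_simps)
      then show ?thesis using yk(1) exp_profile_first_moment by (simp add: c_def)
    qed
    obtain \<psi>b \<psi>b' v where bb:
      "\<And>x. 0 < x \<Longrightarrow> (\<psi>b has_real_derivative \<psi>b' x) (at x)" "continuous_on {0<..} \<psi>b'"
      "\<And>x. 0 < x \<Longrightarrow> \<bar>\<psi>b' x\<bar> \<le> 4 * Cq * (1 + ln (1 + x))"
      "(\<psi>b \<longlongrightarrow> 0) (at_right 0)"
      "\<And>x. 0 < x \<Longrightarrow> integrable lborel (\<lambda>y. exp_profile y * \<psi>b (x + y))" "integrable lborel (\<lambda>y. exp_profile y * \<psi>b y)"
      "\<And>x. 0 < x \<Longrightarrow> exp_average \<psi>b x = v x" "exp_average \<psi>b 0 = 0"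
      "\<And>x. 0 < x \<Longrightarrow> ((\<lambda>x. - x * \<psi>b' x - \<psi>b x + 2 * v x) has_real_derivative q x) (at x)"
      "((\<lambda>x. - x * \<psi>b' x - \<psi>b x + 2 * v x) \<longlongrightarrow> 0) (at_right 0)"
      using solve_laguerre[OF Cq qc qb q0] by blast
    \<comment> \<open>\<open>solve_laguerre\<close> only controls the derivative of this identity;
      the limits at 0, which vanish on both sides, fix the constant.\<close>
    have eqb: "- x * \<psi>b' x - \<psi>b x + 2 * v x = - 2 * (U x - U 0) - c * x" if x: "0 < x" for x
    proof (rule primitive_unique[OF bb(9,10) _ _ x, where R = "\<lambda>x. - 2 * (U x - U 0) - c * x"])
      show "((\<lambda>x. - 2 * (U x - U 0) - c * x) has_real_derivative q y) (at y)" if "0 < y" for y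
        using A3[OF that] unfolding q_def k_def U_def by (auto intro!: derivative_eq_intros)
      have "((\<lambda>x. - 2 * (U x - U 0) - c * x) \<longlongrightarrow> - 2 * (U 0 - U 0) - c * 0) (at_right 0)"
        using A4 unfolding U_def by (intro tendsto_intros)
      then show "((\<lambda>x. - 2 * (U x - U 0) - c * x) \<longlongrightarrow> 0) (at_right 0)" by simp
    qed
    have bb': "\<bar>\<psi>b' x\<bar> \<le> 4 * Cq / b * (1 + x powr b)" if x: "0 < x" for x
    proof -
      have "1 + ln (1 + x) \<le> 1 / b + x powr b / b" using ln_le_powr[OF x b] b by (intro add_mono) auto
      from mult_left_mono[OF this, of "4 * Cq"] bb(3)[OF x] Cq show ?thesis
        by (simp add: add_divide_distrib distrib_left)
    qed
    have bb0: "\<bar>\<psi>b x\<bar> \<le> 4 * Cq / b * (x + x powr (1 + b))" if x: "0 < x" for x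
    proof -
      have "\<bar>\<psi>b x\<bar> \<le> 4 * Cq / b * (x + x powr (1 + b) / (1 + b))"
      proof (rule primitive_bound[OF bb(1,4) _ _ bb' x, where B = "\<lambda>y. 4 * Cq / b * (y + y powr (1 + b) / (1 + b))"])
        show "((\<lambda>y. 4 * Cq / b * (y + y powr (1 + b) / (1 + b))) has_real_derivative 4 * Cq / b * (1 + y powr b)) (at y)" if "0 < y" for y
          using that b by (auto intro!: derivative_eq_intros)
        have "((\<lambda>y. y powr (1 + b)) \<longlongrightarrow> 0 powr (1 + b)) (at_right (0::real))"
          using b by (intro tendsto_powr' tendsto_intros) (auto simp: eventually_at_right_field intro!: exI[of _ 1])
        note p = this
        have "((\<lambda>y. 4 * Cq / b * (y + y powr (1 + b) / (1 + b))) \<longlongrightarrow> 4 * Cq / b * (0 + 0 powr (1 + b) / (1 + b))) (at_right 0)"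
          by (intro tendsto_mult[OF tendsto_const] tendsto_add tendsto_divide[OF p tendsto_const] tendsto_ident_at) (use b in simp)
        then show "((\<lambda>y. 4 * Cq / b * (y + y powr (1 + b) / (1 + b))) \<longlongrightarrow> 0) (at_right 0)" by simp
      qed
      also have "\<dots> \<le> 4 * Cq / b * (x + x powr (1 + b))"
        using Cq b by (intro mult_left_mono add_left_mono) (auto simp: field_simps)
      finally show ?thesis .
    qed
    have half: "4 * Cq / b \<le> C2" "2 * (4 * Cq / b) + C1 \<le> C2" using C2 Cq b C1 by (auto simp: C2_def field_simps)
    have q4: "0 \<le> 4 * Cq / b" using Cq b by simp
    show "\<exists>\<psi>a \<psi>b \<psi>' c. (\<forall>x>0. ((\<lambda>x. \<psi>a x + \<psi>b x) has_real_derivative \<psi>' x) (at x)) \<and> continuous_on {0<..} \<psi>' \<and>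
      (\<forall>x>0. \<bar>\<psi>' x\<bar> \<le> C * (x powr (- 1 - \<alpha>) + x powr b)) \<and>
      (\<forall>x>0. \<bar>\<psi>a x\<bar> \<le> 1 + x) \<and> (\<forall>x>0. \<bar>\<psi>b x\<bar> \<le> C * (x + x powr (1 + b))) \<and>
      (\<forall>x>0. \<bar>\<psi>a x + \<psi>b x\<bar> \<le> C * (1 + x powr (1 + b))) \<and>
      (\<forall>x>0. integrable lborel (\<lambda>y. exp_profile y * ((\<psi>a (x + y) + \<psi>b (x + y)) - (\<psi>a x + \<psi>b x) - (\<psi>a y + \<psi>b y)))) \<and>
      (\<forall>x>0. (\<psi>a x + \<psi>b x) - x * \<psi>' x +
         2 * (\<integral>y. exp_profile y * ((\<psi>a (x + y) + \<psi>b (x + y)) - (\<psi>a x + \<psi>b x) - (\<psi>a y + \<psi>b y)) \<partial>lborel)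
         = \<phi> x + V x * \<psi>a x - c * x)"
    proof (rule exI[of _ \<psi>a], rule exI[of _ \<psi>b], rule exI[of _ "\<lambda>x. \<psi>a' x + \<psi>b' x"], rule exI[of _ c], intro conjI allI impI)
      fix x :: real assume x: "0 < x"
      show "((\<lambda>x. \<psi>a x + \<psi>b x) has_real_derivative \<psi>a' x + \<psi>b' x) (at x)"
        using a(1)[OF x] bb(1)[OF x] by (rule DERIV_add)
      show "\<bar>\<psi>a x\<bar> \<le> 1 + x" by (rule a(4)[OF x])
      show 1: "\<bar>\<psi>b x\<bar> \<le> C * (x + x powr (1 + b))"
        using bb0[OF x] mult_right_mono[of "4 * Cq / b" C "x + x powr (1 + b)"] half CC x by simp
      have xp: "x \<le> 1 + x powr (1 + b)"
        using powr_le_sum[of x 0 1 "1 + b"] x b by simp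
      have "\<bar>\<psi>b x\<bar> \<le> C2 * (x + x powr (1 + b))"
        using bb0[OF x] mult_right_mono[of "4 * Cq / b" C2 "x + x powr (1 + b)"] half x by simp
      also have "\<dots> \<le> C2 * (2 * (1 + x powr (1 + b)))"
        using xp C2 by (intro mult_left_mono) auto
      finally have 2: "\<bar>\<psi>b x\<bar> \<le> C2 * (2 * (1 + x powr (1 + b)))" .
      have "1 + x \<le> 2 * (1 + p)" if "x \<le> 1 + p" "0 \<le> p" for p using that by simp
      then have "1 + x \<le> 2 * (1 + x powr (1 + b))" using xp powr_ge_zero by blast
      then have "\<bar>\<psi>a x\<bar> \<le> 2 * (1 + x powr (1 + b))" by (rule order_trans[OF a(4)[OF x]])
      then have "\<bar>\<psi>a x + \<psi>b x\<bar> \<le> 2 * (1 + x powr (1 + b)) + C2 * (2 * (1 + x powr (1 + b)))"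
        using 2 by (intro order_trans[OF abs_triangle_ineq] add_mono)
      also have "\<dots> = C * (1 + x powr (1 + b))" unfolding C_def by (simp only: algebra_simps)
      finally show "\<bar>\<psi>a x + \<psi>b x\<bar> \<le> C * (1 + x powr (1 + b))" .
      show "\<bar>\<psi>a' x + \<psi>b' x\<bar> \<le> C * (x powr (- 1 - \<alpha>) + x powr b)"
      proof -
        have "\<bar>\<psi>a' x + \<psi>b' x\<bar> \<le> C2 * (x powr (- 1 - \<alpha>) + x powr b)"
        proof (cases "1 \<le> x")
          case True
          have p: "1 \<le> x powr b" using True b by (intro ge_one_powr_ge_zero) auto
          have "C1 * 1 \<le> C1 * x powr b" using p C1 by (intro mult_left_mono) auto
          moreover have "4 * Cq / b * (1 + x powr b) \<le> 4 * Cq / b * (2 * x powr b)" using p q4 by (intro mult_left_mono) auto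
          ultimately have "\<bar>\<psi>a' x + \<psi>b' x\<bar> \<le> (C1 + 2 * (4 * Cq / b)) * x powr b"
            using a(6)[OF True] bb'[OF x] by (simp add: algebra_simps)
          also have "\<dots> \<le> C2 * x powr b" using half by (intro mult_right_mono) auto
          also have "\<dots> \<le> C2 * (x powr (- 1 - \<alpha>) + x powr b)" using C2 by (intro mult_left_mono) auto
          finally show ?thesis .
        next
          case False
          have p: "1 \<le> x powr (- 1 - \<alpha>)" using False x \<alpha> powr_mono'[of "- 1 - \<alpha>" 0 x] by simp
          have q: "x powr b \<le> 1" using False x b powr_mono'[of 0 b x] by simp
          have "4 * Cq / b * (1 + x powr b) \<le> 4 * Cq / b * (2 * x powr (- 1 - \<alpha>))" using p q q4 by (intro mult_left_mono) auto
          then have "\<bar>\<psi>a' x + \<psi>b' x\<bar> \<le> (C1 + 2 * (4 * Cq / b)) * x powr (- 1 - \<alpha>)"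
            using a(5)[OF x] False bb'[OF x] by (simp add: algebra_simps)
          also have "\<dots> \<le> C2 * x powr (- 1 - \<alpha>)" using half by (intro mult_right_mono) auto
          also have "\<dots> \<le> C2 * (x powr (- 1 - \<alpha>) + x powr b)" using C2 by (intro mult_left_mono) auto
          finally show ?thesis .
        qed
        also have "\<dots> \<le> C * (x powr (- 1 - \<alpha>) + x powr b)" using CC by (intro mult_right_mono) auto
        finally show ?thesis .
      qed
      have split: "exp_profile y * ((\<psi>a (x + y) + \<psi>b (x + y)) - (\<psi>a x + \<psi>b x) - (\<psi>a y + \<psi>b y)) =
        exp_profile y * \<psi>a (x + y) + exp_profile y * \<psi>b (x + y) - exp_profile y * (\<psi>a x + \<psi>b x) - (exp_profile y * \<psi>a y + exp_profile y * \<psi>b y)" for y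
        by (simp only: algebra_simps)
      have ints: "integrable lborel (\<lambda>y. exp_profile y * \<psi>a (x + y))" "integrable lborel (\<lambda>y. exp_profile y * \<psi>b (x + y))"
        "integrable lborel (\<lambda>y. exp_profile y * (\<psi>a x + \<psi>b x))" "integrable lborel (\<lambda>y. exp_profile y * \<psi>a y)" "integrable lborel (\<lambda>y. exp_profile y * \<psi>b y)"
        using A1[of x] A1[of 0] bb(5)[OF x] bb(6) x exp_profile_integrable by auto
      show "integrable lborel (\<lambda>y. exp_profile y * ((\<psi>a (x + y) + \<psi>b (x + y)) - (\<psi>a x + \<psi>b x) - (\<psi>a y + \<psi>b y)))"
        unfolding split by (intro Bochner_Integration.integrable_diff Bochner_Integration.integrable_add ints)
      have "(\<integral>y. exp_profile y * ((\<psi>a (x + y) + \<psi>b (x + y)) - (\<psi>a x + \<psi>b x) - (\<psi>a y + \<psi>b y)) \<partial>lborel) =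
        U x + v x - (\<psi>a x + \<psi>b x) - (U 0 + 0)"
        unfolding split using ints bb(7)[OF x] bb(8) exp_profile_integral by (simp add: U_def exp_average_def)
      then show "(\<psi>a x + \<psi>b x) - x * (\<psi>a' x + \<psi>b' x) +
         2 * (\<integral>y. exp_profile y * ((\<psi>a (x + y) + \<psi>b (x + y)) - (\<psi>a x + \<psi>b x) - (\<psi>a y + \<psi>b y)) \<partial>lborel)
         = \<phi> x + V x * \<psi>a x - c * x"
        using a(3)[OF x] eqb[OF x] by (simp add: algebra_simps)
    next
      show "continuous_on {0<..} (\<lambda>x. \<psi>a' x + \<psi>b' x)" by (intro continuous_intros a(2) bb(2))
    qed
  qed (rule CC(1))
qed

section \<open>Test functions\<close>

lemma clamp_Lipschitz:
  fixes a c u v :: real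
  shows "\<bar>max a (min c u) - max a (min c v)\<bar> \<le> \<bar>u - v\<bar>"
proof -
  have 1: "\<bar>max a r - max a t\<bar> \<le> \<bar>r - t\<bar>" for r t :: real
    by (cases "r \<le> a"; cases "t \<le> a"; simp add: max_def)
  have 2: "\<bar>min c r - min c t\<bar> \<le> \<bar>r - t\<bar>" for r t :: real
    by (cases "r \<le> c"; cases "t \<le> c"; simp add: min_def)
  show ?thesis using 1[of "min c u" "min c v"] 2[of u v] by (rule order_trans)
qed

text \<open>The bounds that \<open>solve_adjoint\<close> delivers for
  \<open>b = (1 - \<alpha>) / 2\<close>. This b is positive, as the logarithm requires, and small
  enough for \<alpha> + b \<le> 1 and 1 + b + \<alpha> \<le> 2: products with the kernel then stay
  below the weight 1 + x in one variable and within the second moment in the other.\<close>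

locale test_function =
  fixes \<alpha> C :: real and \<psi> \<psi>' :: "real \<Rightarrow> real"
  assumes alpha01: "0 \<le> \<alpha>" "\<alpha> < 1" and C1: "1 \<le> C"
    and der: "\<And>x. 0 < x \<Longrightarrow> (\<psi> has_real_derivative \<psi>' x) (at x)"
    and der_cont: "continuous_on {0<..} \<psi>'"
    and der_bound: "\<And>x. 0 < x \<Longrightarrow> \<bar>\<psi>' x\<bar> \<le> C * (x powr (- 1 - \<alpha>) + x powr ((1 - \<alpha>) / 2))"
    and bound: "\<And>x. 0 < x \<Longrightarrow> \<bar>\<psi> x\<bar> \<le> C * (1 + x powr (1 + (1 - \<alpha>) / 2))"
begin

abbreviation "b \<equiv> (1 - \<alpha>) / 2"

definition \<Delta> where "\<Delta> x y = \<psi> (x + y) - \<psi> x - \<psi> y"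

lemma b_bounds: "0 < b" "b < 1" "b \<le> 1" using alpha01 by auto

lemma psi_cont: "continuous_on {0<..} \<psi>"
  using der by (auto intro!: continuous_at_imp_continuous_on DERIV_isCont)

lemma mvt_bound:
  assumes "0 < x" "0 < y" "\<And>t. x < t \<Longrightarrow> t < x + y \<Longrightarrow> \<bar>\<psi>' t\<bar> \<le> k"
  shows "\<bar>\<psi> (x + y) - \<psi> x\<bar> \<le> y * k"
proof -
  obtain t where "x < t" "t < x + y" "\<psi> (x + y) - \<psi> x = (x + y - x) * \<psi>' t"
    using MVT2[of x "x + y" \<psi> \<psi>'] der assms(1,2) by auto
  then show ?thesis using assms(2) assms(3)[of t] by (simp add: abs_mult mult_left_mono)
qed

lemma powr_shift_le:
  assumes "0 < y" "0 \<le> x" "x \<le> 1"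
  shows "(x + y) powr (1 + b) \<le> 4 * (1 + y powr (1 + b))"
proof -
  define m where "m = max 1 y"
  have m: "1 \<le> m" by (simp add: m_def)
  have "(x + y) powr (1 + b) \<le> (2 * m) powr (1 + b)"
    using assms b_bounds by (intro powr_mono2) (auto simp: m_def)
  also have "\<dots> = 2 powr (1 + b) * m powr (1 + b)" using m by (simp add: powr_mult)
  also have "\<dots> \<le> 4 * (1 + y powr (1 + b))"
  proof (rule mult_mono)
    have "2 powr (1 + b) \<le> (2::real) powr 2" using b_bounds by (intro powr_mono) auto
    then show "2 powr (1 + b) \<le> (4::real)" by simp
    show "m powr (1 + b) \<le> 1 + y powr (1 + b)" using assms by (auto simp: m_def max_def)
  qed auto
  finally show ?thesis .
qed

lemma psi_shift_bound:
  assumes "0 < y" "0 < x" "x \<le> 1"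
  shows "\<bar>\<psi> (x + y)\<bar> \<le> 5 * C * (1 + y powr (1 + b))"
proof -
  have "\<bar>\<psi> (x + y)\<bar> \<le> C * (1 + (x + y) powr (1 + b))" using assms by (intro bound) auto
  also have "\<dots> \<le> C * (5 * (1 + y powr (1 + b)))"
  proof (rule mult_left_mono)
    have "1 + q \<le> 5 * (1 + p)" if "q \<le> 4 * (1 + p)" "0 \<le> p" for p q :: real using that by simp
    from this[OF powr_shift_le powr_ge_zero] show "1 + (x + y) powr (1 + b) \<le> 5 * (1 + y powr (1 + b))"
      using assms by simp
  qed (use C1 in simp)
  finally show ?thesis by (simp add: algebra_simps)
qed

text \<open>By the mean value theorem the increment \<open>\<psi> (x + y) - \<psi> x\<close> grows
  like the power b of x, while the bound for \<open>\<psi> x\<close> itself has 1 + b. The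
  difference leaves room for the factor \<open>x powr \<alpha>\<close> of the kernel.\<close>

lemma Delta_bound_large:
  assumes "1 \<le> x" "0 < y"
  shows "\<bar>\<Delta> x y\<bar> \<le> 5 * C * x powr b * (1 + y powr (1 + b))"
proof -
  have xb: "1 \<le> x powr b" using assms b_bounds by (intro ge_one_powr_ge_zero) auto
  have "\<bar>\<psi> (x + y) - \<psi> x\<bar> \<le> y * (C * (2 * x powr b * (1 + y powr b)))"
  proof (rule mvt_bound)
    fix t assume t: "x < t" "t < x + y"
    have "t powr (- 1 - \<alpha>) \<le> t powr 0" using t assms alpha01 by (intro powr_mono) auto
    then have 1: "t powr (- 1 - \<alpha>) \<le> 1" using t assms by simp
    have "t powr b \<le> (x + y) powr b" using t assms b_bounds by (intro powr_mono2) auto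
    also have "\<dots> \<le> x powr b + y powr b" using assms b_bounds by (intro powr_add_le) auto
    finally have "t powr (- 1 - \<alpha>) + t powr b \<le> 1 + x powr b + y powr b" using 1 by linarith
    also have "\<dots> \<le> x powr b + x powr b + x powr b * y powr b"
      using xb mult_right_mono[OF xb, of "y powr b"] by simp
    also have "\<dots> \<le> 2 * x powr b * (1 + y powr b)" by (simp add: algebra_simps)
    finally have "C * (t powr (- 1 - \<alpha>) + t powr b) \<le> C * (2 * x powr b * (1 + y powr b))"
      using C1 by (intro mult_left_mono) auto
    then show "\<bar>\<psi>' t\<bar> \<le> C * (2 * x powr b * (1 + y powr b))" using der_bound[of t] t assms by linarith
  qed (use assms in auto)
  also have "\<dots> = 2 * C * x powr b * (y + y powr (1 + b))" using assms by (simp add: powr_add algebra_simps)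
  also have "\<dots> \<le> 2 * C * x powr b * (2 * (1 + y powr (1 + b)))"
    using powr_le_sum[of y 0 1 "1 + b"] assms b_bounds C1 by (intro mult_left_mono) auto
  finally have 1: "\<bar>\<psi> (x + y) - \<psi> x\<bar> \<le> 4 * C * x powr b * (1 + y powr (1 + b))" by (simp add: algebra_simps)
  have "C * (1 + y powr (1 + b)) * 1 \<le> C * (1 + y powr (1 + b)) * x powr b"
    using xb C1 by (intro mult_left_mono) auto
  then have "\<bar>\<psi> y\<bar> \<le> C * x powr b * (1 + y powr (1 + b))" using bound[OF assms(2)] by (simp add: mult_ac)
  then show ?thesis using 1 unfolding \<Delta>_def by (simp add: algebra_simps)
qed

lemma Delta_bound:
  assumes "0 < x" "0 < y"
  shows "\<bar>\<Delta> x y\<bar> \<le> 8 * C * (1 + x) * (1 + y powr (1 + b))"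
proof (cases "1 \<le> x")
  case True
  have "\<bar>\<Delta> x y\<bar> \<le> 5 * C * x powr b * (1 + y powr (1 + b))" by (rule Delta_bound_large[OF True assms(2)])
  also have "\<dots> \<le> 8 * C * (1 + x) * (1 + y powr (1 + b))"
    using powr_le_one_plus[of x b] assms b_bounds C1 by (intro mult_right_mono mult_mono) auto
  finally show ?thesis .
next
  case False
  then have x: "x \<le> 1" by simp
  define Y where "Y = 1 + y powr (1 + b)"
  have Y: "1 \<le> Y" by (simp add: Y_def)
  have "x powr (1 + b) \<le> 1" using powr_mono'[of 0 "1 + b" x] assms x b_bounds by simp
  then have "C * (1 + x powr (1 + b)) \<le> C * 2" using C1 by (intro mult_left_mono) auto
  also have "\<dots> \<le> 2 * C * Y" using Y C1 by simp
  finally have "\<bar>\<psi> x\<bar> \<le> 2 * C * Y" using bound[OF assms(1)] by linarith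
  then have "\<bar>\<Delta> x y\<bar> \<le> 8 * C * Y"
    using psi_shift_bound[OF assms(2,1) x] bound[OF assms(2)] unfolding \<Delta>_def Y_def by linarith
  also have "\<dots> \<le> 8 * C * (1 + x) * Y" using assms C1 Y by (intro mult_right_mono) auto
  finally show ?thesis by (simp add: Y_def)
qed

text \<open>Regularity in the integration variable is what weak closeness needs. The singularity of
  the derivative at 0 is kept away by d, and the dependence on x is linear, so that division by 1 +
  x gives a uniform family.\<close>

lemma Delta_Lipschitz:
  assumes "0 < x" "0 < d" "d \<le> L" "y \<in> {d..L}" "z \<in> {d..L}"
  shows "\<bar>\<Delta> x y - \<Delta> x z\<bar> \<le> (1 + x) * (C * (2 * d powr (- 1 - \<alpha>) + 1 + 2 * L powr b)) * \<bar>y - z\<bar>"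
proof -
  define k where "k = C * (2 * d powr (- 1 - \<alpha>) + 1 + 2 * L powr b)"
  have *: "\<bar>\<Delta> x y - \<Delta> x z\<bar> \<le> (1 + x) * k * \<bar>y - z\<bar>" if yz: "d \<le> y" "y < z" "z \<le> L" for y z
  proof -
    have dd: "((\<lambda>y. \<Delta> x y) has_real_derivative \<psi>' (x + t) - \<psi>' t) (at t)" if "0 < t" for t
    proof -
      have "((\<lambda>y. \<psi> (x + y)) has_real_derivative \<psi>' (x + t)) (at t)"
        using der[of "x + t"] that assms by (simp add: DERIV_shift add.commute)
      then show ?thesis unfolding \<Delta>_def using der[OF that] by (auto intro!: derivative_eq_intros)
    qed
    obtain t where t: "y < t" "t < z" "\<Delta> x z - \<Delta> x y = (z - y) * (\<psi>' (x + t) - \<psi>' t)"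
      using MVT2[of y z "\<Delta> x" "\<lambda>t. \<psi>' (x + t) - \<psi>' t"] dd yz assms by auto
    have t0: "d \<le> t" "t \<le> L" "0 < t" using t yz assms by auto
    have p1: "(x + t) powr (- 1 - \<alpha>) \<le> d powr (- 1 - \<alpha>)" "t powr (- 1 - \<alpha>) \<le> d powr (- 1 - \<alpha>)"
      using t0 assms alpha01 by (auto intro!: powr_mono2')
    have p2: "t powr b \<le> L powr b" using t0 b_bounds by (intro powr_mono2) auto
    have "(x + t) powr b \<le> x powr b + t powr b" using t0 assms b_bounds by (intro powr_add_le) auto
    also have "\<dots> \<le> (1 + x) + L powr b" using p2 powr_le_one_plus[of x b] assms b_bounds by auto
    finally have p3: "(x + t) powr b \<le> (1 + x) + L powr b" .
    have "\<bar>\<psi>' (x + t) - \<psi>' t\<bar> \<le> C * ((x + t) powr (- 1 - \<alpha>) + (x + t) powr b) + C * (t powr (- 1 - \<alpha>) + t powr b)"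
      using der_bound[of "x + t"] der_bound[of t] t0 assms by linarith
    also have "\<dots> \<le> C * (d powr (- 1 - \<alpha>) + ((1 + x) + L powr b)) + C * (d powr (- 1 - \<alpha>) + L powr b)"
      using p1 p2 p3 C1 by (intro add_mono mult_left_mono) auto
    also have "\<dots> = C * (2 * d powr (- 1 - \<alpha>) + (1 + x) + 2 * L powr b)" by (simp add: algebra_simps)
    also have "\<dots> \<le> C * ((1 + x) * (2 * d powr (- 1 - \<alpha>) + 1 + 2 * L powr b))"
      using C1 assms by (intro mult_left_mono) (auto simp: algebra_simps)
    also have "\<dots> = (1 + x) * k" by (simp add: k_def)
    finally have "(z - y) * \<bar>\<psi>' (x + t) - \<psi>' t\<bar> \<le> (z - y) * ((1 + x) * k)" using yz by (intro mult_left_mono) auto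
    moreover have "\<bar>\<Delta> x y - \<Delta> x z\<bar> = (z - y) * \<bar>\<psi>' (x + t) - \<psi>' t\<bar>"
      using t(3) yz by (subst abs_minus_commute) (simp add: abs_mult)
    ultimately show ?thesis using yz by (simp add: mult_ac)
  qed
  show ?thesis using *[of y z] *[of z y] assms(4,5) unfolding k_def
    by (cases y z rule: linorder_cases) (auto simp: abs_minus_commute)
qed

lemma Delta_cont: assumes "0 < x" shows "continuous_on {0<..} (\<Delta> x)"
  unfolding \<Delta>_def using assms
  by (intro continuous_intros psi_cont continuous_on_compose2[OF psi_cont]) auto

text \<open>For d > 0 it vanishes outside [d, L] and equals 1 on [2 d, L - 1].\<close>

definition cut :: "real \<Rightarrow> real \<Rightarrow> real \<Rightarrow> real" where
  "cut d L y = max 0 (min 1 (y / d - 1)) * max 0 (min 1 (L - y))"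

lemma cut_bounds: "0 \<le> cut d L y" "cut d L y \<le> 1"
  unfolding cut_def by (intro mult_nonneg_nonneg max.cobounded1) (intro mult_le_one; simp)

lemma cut_Lipschitz: assumes "0 < d" shows "\<bar>cut d L y - cut d L z\<bar> \<le> (1 / d + 1) * \<bar>y - z\<bar>"
proof -
  define p where "p y = max 0 (min 1 (y / d - 1))" for y
  define q where "q y = max 0 (min 1 (L - y))" for y
  have "\<bar>p y - p z\<bar> \<le> \<bar>(y / d - 1) - (z / d - 1)\<bar>"
    unfolding p_def by (rule clamp_Lipschitz)
  also have "\<dots> = \<bar>(y - z) / d\<bar>" by (simp only: diff_divide_distrib diff_diff_eq2 diff_add_cancel algebra_simps)
  also have "\<dots> = \<bar>y - z\<bar> / d"
    unfolding abs_divide using assms by (simp only: abs_of_pos)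
  finally have p: "\<bar>p y - p z\<bar> \<le> \<bar>y - z\<bar> / d" .
  have "\<bar>q y - q z\<bar> \<le> \<bar>(L - y) - (L - z)\<bar>"
    unfolding q_def by (rule clamp_Lipschitz)
  also have "\<dots> = \<bar>y - z\<bar>" by (subst abs_minus_commute) (simp only: algebra_simps diff_diff_eq2 add_diff_cancel_left)
  finally have q: "\<bar>q y - q z\<bar> \<le> \<bar>y - z\<bar>" .
  have b: "0 \<le> p z" "p z \<le> 1" "0 \<le> q y" "q y \<le> 1" unfolding p_def q_def by simp_all
  have "p y * q y - p z * q z = (p y - p z) * q y + p z * (q y - q z)"
    by (simp only: algebra_simps)
  also have "\<bar>\<dots>\<bar> \<le> \<bar>p y - p z\<bar> * q y + p z * \<bar>q y - q z\<bar>"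
    using abs_triangle_ineq[of "(p y - p z) * q y" "p z * (q y - q z)"] b by (simp only: abs_mult abs_of_nonneg)
  also have "\<dots> \<le> \<bar>y - z\<bar> / d * 1 + 1 * \<bar>y - z\<bar>" by (intro add_mono mult_mono p q b) (use b assms in simp_all)
  finally have "\<bar>p y * q y - p z * q z\<bar> \<le> (1 / d + 1) * \<bar>y - z\<bar>" by (simp only: distrib_right mult_1 mult_1_right times_divide_eq_left)
  then show ?thesis unfolding cut_def p_def q_def .
qed

end

text \<open>The integrand is split by \<open>cut\<close>. The middle part, divided by 1 + x, obeys
  bounds independent of x and \<open>\<psi>\<close>, so \<open>weak_closeness\<close> applies with
  \<eta> / 2. The two ends get \<eta> / 4 each: below 2 d there is little mass by
  \<open>near_zero\<close>, and beyond M the weight \<open>y powr (1 + b)\<close> is at most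
  \<open>M powr (b - 1)\<close> times y^2.\<close>

lemma weak_closeness_test:
  fixes \<alpha> \<eta> C :: real
  assumes \<alpha>: "0 \<le> \<alpha>" "\<alpha> < 1" and \<eta>: "0 < \<eta>" and C: "1 \<le> C"
  shows "\<exists>e>0. \<forall>\<epsilon> K f \<psi> \<psi>' x. coag_profile \<alpha> \<epsilon> K f \<longrightarrow> \<epsilon> \<le> e \<longrightarrow> test_function \<alpha> C \<psi> \<psi>' \<longrightarrow> 0 < x \<longrightarrow>
    \<bar>\<integral>y. (f y - exp_profile y) * (\<psi> (x + y) - \<psi> x - \<psi> y) \<partial>lborel\<bar> \<le> \<eta> * (1 + x)"
proof -
  define b where "b = (1 - \<alpha>) / 2"
  have b: "0 < b" "b < 1" using \<alpha> by (auto simp: b_def)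
  \<comment> \<open>The end near 0 will cost 8 * C * 28 * d = 224 * C * d, and 900 exceeds 4 * 224.
    In the same way 320 = 4 * 8 * 10 belongs to the end at infinity.\<close>
  define d where "d = min (1 / 2) (\<eta> / (900 * C))"
  have d: "0 < d" "d \<le> 1 / 2" "8 * C * (28 * d) \<le> \<eta> / 4"
  proof -
    show "0 < d" "d \<le> 1 / 2" using \<eta> C by (auto simp: d_def)
    have "d \<le> \<eta> / (900 * C)" by (simp add: d_def)
    then have "224 * C * d \<le> 224 * C * (\<eta> / (900 * C))" using C by (intro mult_left_mono) auto
    then have "8 * C * (28 * d) \<le> 224 * C * (\<eta> / (900 * C))" by simp
    also have "\<dots> \<le> \<eta> / 4" using C \<eta> by (simp add: field_simps)
    finally show "8 * C * (28 * d) \<le> \<eta> / 4" .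
  qed
  obtain M where M: "1 \<le> M" "M powr (b - 1) \<le> \<eta> / (320 * C)"
  proof -
    have "((\<lambda>M::real. M powr (b - 1)) \<longlongrightarrow> 0) at_top"
      using b by (intro tendsto_neg_powr filterlim_ident) auto
    then have "\<forall>\<^sub>F M in at_top. M powr (b - 1) < \<eta> / (320 * C)"
      using \<eta> C by (intro order_tendstoD(2)) auto
    then have "\<forall>\<^sub>F M in at_top. 1 \<le> M \<and> M powr (b - 1) < \<eta> / (320 * C)"
      using eventually_ge_at_top[of "1::real"] by eventually_elim auto
    then obtain M where "1 \<le> M" "M powr (b - 1) < \<eta> / (320 * C)"
      by (auto simp: eventually_at_top_linorder)
    then show ?thesis using that[of M] by simp
  qed
  define L where "L = M + 1"
  have L: "2 \<le> L" "d \<le> L" using M d by (auto simp: L_def)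
  define H where "H = 8 * C * (1 + L powr (1 + b))"
  define \<Lambda>0 where "\<Lambda>0 = C * (2 * d powr (- 1 - \<alpha>) + 1 + 2 * L powr b)"
  define \<Lambda> where "\<Lambda> = \<Lambda>0 + H * (1 / d + 1) + H"
  have H: "0 \<le> H" "0 \<le> \<Lambda>0" using C by (auto simp: H_def \<Lambda>0_def)
  have \<Lambda>: "0 \<le> \<Lambda>" "H \<le> \<Lambda>" "\<Lambda>0 + H * (1 / d + 1) \<le> \<Lambda>" using H d by (auto simp: \<Lambda>_def)
  obtain e1 where e1: "0 < e1" "\<And>\<epsilon> K f h. coag_profile \<alpha> \<epsilon> K f \<Longrightarrow> \<epsilon> \<le> e1 \<Longrightarrow> h \<in> borel_measurable borel \<Longrightarrow>
    (\<forall>y\<ge>0. \<bar>h y\<bar> \<le> \<Lambda>) \<Longrightarrow> (\<forall>y\<ge>0. \<forall>z\<ge>0. \<bar>h y - h z\<bar> \<le> \<Lambda> * \<bar>y - z\<bar>) \<Longrightarrow> (\<forall>y\<ge>L. h y = 0) \<Longrightarrow>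
    \<bar>\<integral>x. (f x - exp_profile x) * h x \<partial>lborel\<bar> \<le> \<eta> / 2"
    using weak_closeness[OF \<alpha>, of "\<eta> / 2" \<Lambda> L] \<eta> \<Lambda> L by auto
  define e2 where "e2 = 2 * d / (541 * (1 + 1 / (2 * d)) ^ 3)"
  have e2: "0 < e2" unfolding e2_def using d by (intro divide_pos_pos mult_pos_pos zero_less_power add_pos_pos) auto
  define e where "e = min e1 (min e2 ((1 - \<alpha>) / 36))"
  show ?thesis
  proof (intro exI[of _ e] conjI allI impI)
    show "0 < e" using e1 e2 \<alpha> by (simp add: e_def)
    fix \<epsilon> K f \<psi> \<psi>' and x :: real
    assume P: "coag_profile \<alpha> \<epsilon> K f" and "\<epsilon> \<le> e" and T: "test_function \<alpha> C \<psi> \<psi>'" and x: "0 < x"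
    interpret coag_profile \<alpha> \<epsilon> K f by (rule P)
    interpret T: test_function \<alpha> C \<psi> \<psi>' by (rule T)
    have ee: "\<epsilon> \<le> e1" "\<epsilon> \<le> e2" "36 * \<epsilon> \<le> 1 - \<alpha>" using \<open>\<epsilon> \<le> e\<close> by (auto simp: e_def)
    have tau: "541 * \<epsilon> * (1 + 1 / (2 * d)) ^ 3 \<le> 2 * d"
    proof -
      have "0 < (1 + 1 / (2 * d)) ^ 3" using d by (simp add: add_pos_pos)
      then show ?thesis using ee(2) unfolding e2_def by (simp add: pos_le_divide_eq mult_ac)
    qed
    define D where "D y = (if y \<in> {0<..} then T.\<Delta> x y else 0)" for y
    have [measurable]: "D \<in> borel_measurable borel"
      unfolding D_def by (intro borel_measurable_continuous_on_if T.Delta_cont x continuous_on_const) auto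
    have Db: "\<bar>D y\<bar> \<le> 8 * C * (1 + x) * (1 + y powr (1 + b))" for y
      using T.Delta_bound[OF x, of y] x C by (auto simp: D_def b_def)
    have [measurable]: "T.cut d L \<in> borel_measurable borel" unfolding T.cut_def by measurable
    define h where "h y = T.cut d L y * D y / (1 + x)" for y
    have [measurable]: "h \<in> borel_measurable borel" unfolding h_def by measurable
    have hb: "\<bar>h y\<bar> \<le> H" if "y \<le> L" for y
    proof (cases "0 < y")
      case True
      have "\<bar>h y\<bar> = T.cut d L y * (\<bar>D y\<bar> / (1 + x))" using x T.cut_bounds[of d L y] by (simp add: h_def abs_mult)
      also have "\<dots> \<le> 1 * (8 * C * (1 + y powr (1 + b)))"
        using T.cut_bounds[of d L y] Db[of y] x C by (intro mult_mono) (auto simp: field_simps)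
      also have "\<dots> \<le> H" unfolding H_def using True that b C by (auto intro!: mult_left_mono powr_mono2)
      finally show ?thesis .
    qed (use H in \<open>simp add: h_def D_def\<close>)
    have h0: "h y = 0" if "y \<le> d \<or> L \<le> y" for y
    proof -
      have "y \<le> d \<Longrightarrow> y / d - 1 \<le> 0" using d by simp
      then have "T.cut d L y = 0" using that unfolding T.cut_def by (auto simp: max_def min_def)
      then show ?thesis by (simp add: h_def)
    qed
    \<comment> \<open>Projection onto [d, L]. As \<open>h\<close> vanishes at d and beyond, and at L
      and beyond, it factors through this projection, so the Lipschitz bound on [d, L] extends to
      the whole line.\<close>
    define pr where "pr y = max d (min L y)" for y
    have pr: "pr y \<in> {d..L}" "\<bar>pr y - pr z\<bar> \<le> \<bar>y - z\<bar>" for y z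
      using L clamp_Lipschitz[of d L y z] by (auto simp: pr_def)
    have hpr: "h y = h (pr y)" for y
    proof -
      consider "y < d" | "L < y" | "d \<le> y" "y \<le> L" by linarith
      then show ?thesis
        using h0[of y] h0[of d] h0[of L] L by cases (simp_all add: pr_def)
    qed
    have hlip: "\<bar>h y - h z\<bar> \<le> \<Lambda> * \<bar>y - z\<bar>" if y: "y \<in> {d..L}" and z: "z \<in> {d..L}" for y z
    proof -
      have pos: "0 < y" "0 < z" using y z d by auto
      have "h y - h z = (T.cut d L y * (D y - D z) + D z * (T.cut d L y - T.cut d L z)) / (1 + x)"
        unfolding h_def diff_divide_distrib[symmetric]
        by (rule arg_cong[where f = "\<lambda>t. t / (1 + x)"]) (simp only: algebra_simps)
      also have "\<bar>\<dots>\<bar> \<le> (1 * ((1 + x) * \<Lambda>0 * \<bar>y - z\<bar>) + ((1 + x) * H) * ((1 / d + 1) * \<bar>y - z\<bar>)) / (1 + x)"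
      proof -
        have "\<bar>D y - D z\<bar> \<le> (1 + x) * \<Lambda>0 * \<bar>y - z\<bar>"
          using T.Delta_Lipschitz[OF x d(1) L(2) y z] pos by (simp add: D_def \<Lambda>0_def b_def)
        then have 1: "\<bar>T.cut d L y * (D y - D z)\<bar> \<le> 1 * ((1 + x) * \<Lambda>0 * \<bar>y - z\<bar>)"
          unfolding abs_mult using T.cut_bounds[of d L y] by (intro mult_mono) auto
        have "8 * C * (1 + x) * (1 + z powr (1 + b)) \<le> 8 * C * (1 + x) * (1 + L powr (1 + b))"
          using z pos b x C by (intro mult_left_mono add_left_mono powr_mono2) auto
        also have "\<dots> = (1 + x) * H" unfolding H_def by (simp only: mult_ac)
        finally have "\<bar>D z\<bar> \<le> (1 + x) * H" using Db[of z] by linarith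
        then have 2: "\<bar>D z * (T.cut d L y - T.cut d L z)\<bar> \<le> ((1 + x) * H) * ((1 / d + 1) * \<bar>y - z\<bar>)"
          unfolding abs_mult using T.cut_Lipschitz[OF d(1)] x H by (intro mult_mono) auto
        have x1: "\<bar>1 + x\<bar> = 1 + x" using x by simp
        show ?thesis unfolding abs_divide x1 using x
          by (intro divide_right_mono order_trans[OF abs_triangle_ineq] add_mono 1 2) simp
      qed
      also have "\<dots> = (\<Lambda>0 + H * (1 / d + 1)) * \<bar>y - z\<bar>"
      proof -
        have "1 * ((1 + x) * \<Lambda>0 * \<bar>y - z\<bar>) + ((1 + x) * H) * ((1 / d + 1) * \<bar>y - z\<bar>) = ((\<Lambda>0 + H * (1 / d + 1)) * \<bar>y - z\<bar>) * (1 + x)"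
          by (simp only: algebra_simps)
        then show ?thesis using x by (simp only:) simp
      qed
      also have "\<dots> \<le> \<Lambda> * \<bar>y - z\<bar>" using \<Lambda> by (intro mult_right_mono) auto
      finally show ?thesis .
    qed
    have A: "\<bar>\<integral>y. (f y - exp_profile y) * h y \<partial>lborel\<bar> \<le> \<eta> / 2"
    proof (rule e1(2)[OF P ee(1)])
      show "\<forall>y\<ge>0. \<bar>h y\<bar> \<le> \<Lambda>"
      proof (intro allI impI)
        fix y show "\<bar>h y\<bar> \<le> \<Lambda>" using hb[of "pr y"] pr(1)[of y] \<Lambda> hpr[of y] by auto
      qed
      show "\<forall>y\<ge>0. \<forall>z\<ge>0. \<bar>h y - h z\<bar> \<le> \<Lambda> * \<bar>y - z\<bar>"
      proof (intro allI impI)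
        fix y z
        have "\<bar>h y - h z\<bar> \<le> \<Lambda> * \<bar>pr y - pr z\<bar>" unfolding hpr[of y] hpr[of z] by (rule hlip) (rule pr)+
        also have "\<dots> \<le> \<Lambda> * \<bar>y - z\<bar>" using pr(2) \<Lambda> by (intro mult_left_mono) auto
        finally show "\<bar>h y - h z\<bar> \<le> \<Lambda> * \<bar>y - z\<bar>" .
      qed
      show "\<forall>y\<ge>L. h y = 0" using h0 by auto
    qed simp
    define Y where "Y y = 2 * indicator {..2 * d} y + 2 * M powr (b - 1) * y\<^sup>2" for y :: real
    have Yb: "(1 - T.cut d L y) * (1 + y powr (1 + b)) \<le> Y y" if y: "0 < y" for y
    proof -
      consider "y \<le> 2 * d" | "2 * d < y" "y < M" | "2 * d < y" "M \<le> y" by linarith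
      then show ?thesis
      proof cases
        case 1
        have "y powr (1 + b) \<le> 1" using powr_mono'[of 0 "1 + b" y] 1 d y b by simp
        then have "(1 - T.cut d L y) * (1 + y powr (1 + b)) \<le> 1 * 2"
          using T.cut_bounds[of d L y] by (intro mult_mono) auto
        then show ?thesis using 1 by (simp add: Y_def add_increasing2)
      next
        case 2
        then have "1 \<le> y / d - 1" "1 \<le> L - y" using d by (simp_all add: L_def field_simps)
        then have "T.cut d L y = 1" unfolding T.cut_def by (simp add: min_absorb1)
        then show ?thesis by (simp add: Y_def)
      next
        case 3
        have y1: "1 \<le> y" using 3 M by simp
        have "(1 - T.cut d L y) * (1 + y powr (1 + b)) \<le> 1 * (1 + y powr (1 + b))"
          using T.cut_bounds[of d L y] by (intro mult_right_mono) auto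
        also have "\<dots> \<le> 2 * y powr (1 + b)" using y1 b ge_one_powr_ge_zero[of y "1 + b"] by simp
        also have "\<dots> \<le> 2 * (y\<^sup>2 * M powr (b - 1))"
        proof -
          have "y powr (1 + b) = y powr (2 + (b - 1))" by simp
          also have "\<dots> = y powr 2 * y powr (b - 1)" by (rule powr_add)
          also have "\<dots> = y\<^sup>2 * y powr (b - 1)" using y by simp
          also have "\<dots> \<le> y\<^sup>2 * M powr (b - 1)" using 3 M b by (intro mult_left_mono powr_mono2') auto
          finally show ?thesis by simp
        qed
        finally have "(1 - T.cut d L y) * (1 + y powr (1 + b)) \<le> 2 * (y\<^sup>2 * M powr (b - 1))" .
        then show ?thesis by (simp add: Y_def mult_ac add_increasing)
      qed
    qed
    have fY: "integrable lborel (\<lambda>y. (f y + exp_profile y) * Y y)" "(\<integral>y. (f y + exp_profile y) * Y y \<partial>lborel) \<le> 28 * d + 10 * M powr (b - 1)"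
    proof -
      have d2: "0 < 2 * d" using d by simp
      note nz = near_zero[OF ee(3) d2]
      have Ei: "integrable lborel (\<lambda>y. exp_profile y * indicator {..2 * d} y)"
        using integrable_mult_indicator[OF _ exp_profile_integrable, of "{..2 * d}"] by (simp add: mult.commute)
      have "(\<integral>y. exp_profile y * indicator {..2 * d} y \<partial>lborel) \<le> (\<integral>y. indicator {0..2 * d} y \<partial>lborel)"
        using d by (intro integral_mono Ei integrable_real_indicator) (auto simp: exp_profile_def split: split_indicator)
      then have E2: "(\<integral>y. exp_profile y * indicator {..2 * d} y \<partial>lborel) \<le> 2 * d" using d by simp
      have eq: "(f y + exp_profile y) * Y y = 2 * (f y * indicator {..2 * d} y) + 2 * (exp_profile y * indicator {..2 * d} y)
        + 2 * M powr (b - 1) * (f y * y\<^sup>2) + 2 * M powr (b - 1) * (exp_profile y * y\<^sup>2)" for y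
        by (simp add: Y_def algebra_simps)
      show "integrable lborel (\<lambda>y. (f y + exp_profile y) * Y y)" unfolding eq
        using nz(1) Ei second_moment[OF ee(3)] exp_profile_second_moment by simp
      have "(\<integral>y. (f y + exp_profile y) * Y y \<partial>lborel) = 2 * (\<integral>y. f y * indicator {..2 * d} y \<partial>lborel) + 2 * (\<integral>y. exp_profile y * indicator {..2 * d} y \<partial>lborel)
        + 2 * M powr (b - 1) * (\<integral>y. f y * y\<^sup>2 \<partial>lborel) + 2 * M powr (b - 1) * 2"
        unfolding eq using nz(1) Ei second_moment[OF ee(3)] exp_profile_second_moment by simp
      also have "\<dots> \<le> 2 * (3 * (2 * d + 2 * d)) + 2 * (2 * d) + 2 * M powr (b - 1) * 3 + 2 * M powr (b - 1) * 2"
        using nz(2) tau E2 second_moment(2)[OF ee(3)] by (intro add_mono mult_left_mono) auto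
      also have "\<dots> = 28 * d + 10 * M powr (b - 1)" by simp
      finally show "(\<integral>y. (f y + exp_profile y) * Y y \<partial>lborel) \<le> 28 * d + 10 * M powr (b - 1)" .
    qed
    have rest: "\<bar>(f y - exp_profile y) * ((1 - T.cut d L y) * D y)\<bar> \<le> 8 * C * (1 + x) * ((f y + exp_profile y) * Y y)" for y
    proof (cases "0 < y")
      case True
      have "\<bar>f y - exp_profile y\<bar> \<le> f y + exp_profile y" using f_nonneg[of y] exp_profile_nonneg[of y] by linarith
      moreover have "\<bar>(1 - T.cut d L y) * D y\<bar> \<le> 8 * C * (1 + x) * Y y"
      proof -
        have "\<bar>(1 - T.cut d L y) * D y\<bar> \<le> (1 - T.cut d L y) * (8 * C * (1 + x) * (1 + y powr (1 + b)))"
          unfolding abs_mult using T.cut_bounds[of d L y] Db[of y] by (intro mult_mono) auto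
        also have "\<dots> = 8 * C * (1 + x) * ((1 - T.cut d L y) * (1 + y powr (1 + b)))" by (simp only: mult_ac)
        also have "\<dots> \<le> 8 * C * (1 + x) * Y y" using Yb[OF True] C x by (intro mult_left_mono) auto
        finally show ?thesis .
      qed
      ultimately have "\<bar>f y - exp_profile y\<bar> * \<bar>(1 - T.cut d L y) * D y\<bar> \<le> (f y + exp_profile y) * (8 * C * (1 + x) * Y y)"
        using f_nonneg[of y] exp_profile_nonneg[of y] by (intro mult_mono) auto
      then show ?thesis by (simp only: abs_mult mult_ac)
    qed (simp add: f_zero exp_profile_def)
    have ri: "integrable lborel (\<lambda>y. (f y - exp_profile y) * ((1 - T.cut d L y) * D y))"
    proof (rule Bochner_Integration.integrable_bound[OF integrable_mult_right[OF fY(1), of "8 * C * (1 + x)"]])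
      have "(\<lambda>y. 1 - T.cut d L y) \<in> borel_measurable borel" by measurable
      then show "(\<lambda>y. (f y - exp_profile y) * ((1 - T.cut d L y) * D y)) \<in> borel_measurable lborel" by measurable
      show "AE y in lborel. norm ((f y - exp_profile y) * ((1 - T.cut d L y) * D y)) \<le> norm (8 * C * (1 + x) * ((f y + exp_profile y) * Y y))"
      proof (rule AE_I2)
        fix y
        show "norm ((f y - exp_profile y) * ((1 - T.cut d L y) * D y)) \<le> norm (8 * C * (1 + x) * ((f y + exp_profile y) * Y y))"
          unfolding real_norm_def by (rule order_trans[OF rest[of y] abs_ge_self])
      qed
    qed
    define J where "J = (\<integral>y. (f y - exp_profile y) * ((1 - T.cut d L y) * D y) \<partial>lborel)"
    have J1: "\<bar>J\<bar> \<le> (\<integral>y. 8 * C * (1 + x) * ((f y + exp_profile y) * Y y) \<partial>lborel)"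
      unfolding J_def
      by (rule order_trans[OF integral_abs_bound integral_mono[OF integrable_abs[OF ri] integrable_mult_right[OF fY(1)] rest]])
    have J2: "(\<integral>y. 8 * C * (1 + x) * ((f y + exp_profile y) * Y y) \<partial>lborel) \<le> 8 * C * (1 + x) * (28 * d + 10 * M powr (b - 1))"
      unfolding integral_mult_right_zero by (rule mult_left_mono[OF fY(2)]) (use C x in simp)
    have "8 * C * (10 * M powr (b - 1)) \<le> 8 * C * (10 * (\<eta> / (320 * C)))" using M C by (intro mult_left_mono) auto
    also have "\<dots> = \<eta> / 4" using C by simp
    finally have "(8 * C * (28 * d) + 8 * C * (10 * M powr (b - 1))) * (1 + x) \<le> (\<eta> / 4 + \<eta> / 4) * (1 + x)"
      using d(3) x by (intro mult_right_mono add_mono) auto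
    moreover have "8 * C * (1 + x) * (28 * d + 10 * M powr (b - 1)) = (8 * C * (28 * d) + 8 * C * (10 * M powr (b - 1))) * (1 + x)"
      by (simp only: algebra_simps)
    ultimately have B: "\<bar>J\<bar> \<le> (\<eta> / 4 + \<eta> / 4) * (1 + x)" using order_trans[OF J1 J2] by (simp only:)
    have hi: "integrable lborel (\<lambda>y. (f y - exp_profile y) * h y)"
    proof (rule diff_integrable)
      show "\<bar>h y\<bar> \<le> H" for y using hb[of "pr y"] pr(1)[of y] hpr[of y] by auto
    qed measurable
    have pt: "(f y - exp_profile y) * (\<psi> (x + y) - \<psi> x - \<psi> y) = (1 + x) * ((f y - exp_profile y) * h y) + (f y - exp_profile y) * ((1 - T.cut d L y) * D y)" for y
    proof (cases "0 < y")
      case True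
      have "(1 + x) * h y = T.cut d L y * D y" using x by (simp add: h_def)
      then have "(1 + x) * ((f y - exp_profile y) * h y) = (f y - exp_profile y) * (T.cut d L y * D y)" by (simp only: mult.left_commute[of "1 + x"])
      moreover have "\<psi> (x + y) - \<psi> x - \<psi> y = D y" using True by (simp add: D_def T.\<Delta>_def)
      ultimately show ?thesis by (simp only:) (simp only: algebra_simps)
    qed (simp add: f_zero exp_profile_def)
    define I where "I = (\<integral>y. (f y - exp_profile y) * h y \<partial>lborel)"
    have A': "\<bar>I\<bar> \<le> \<eta> / 2" unfolding I_def by (rule A)
    have IJ: "(\<integral>y. (f y - exp_profile y) * (\<psi> (x + y) - \<psi> x - \<psi> y) \<partial>lborel) = (1 + x) * I + J"
      unfolding pt I_def J_def
      by (subst Bochner_Integration.integral_add[OF integrable_mult_right[OF hi] ri]) (simp only: integral_mult_right_zero)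
    have "\<bar>(1 + x) * I + J\<bar> \<le> (1 + x) * \<bar>I\<bar> + \<bar>J\<bar>"
      using abs_triangle_ineq[of "(1 + x) * I" J] x by (simp add: abs_mult)
    also have "\<dots> \<le> (1 + x) * (\<eta> / 2) + (\<eta> / 4 + \<eta> / 4) * (1 + x)"
      by (rule add_mono[OF mult_left_mono[OF A'] B]) (use x in simp)
    also have "\<dots> = \<eta> * (1 + x)" by (simp add: algebra_simps)
    finally show "\<bar>\<integral>y. (f y - exp_profile y) * (\<psi> (x + y) - \<psi> x - \<psi> y) \<partial>lborel\<bar> \<le> \<eta> * (1 + x)"
      unfolding IJ .
  qed
qed

section \<open>Estimates for a pair of profiles\<close>

definition moment_bound :: "real \<Rightarrow> real" where
  "moment_bound \<alpha> = 8 * ((1 - \<alpha>) / 40) powr (- \<alpha>) / (1 - \<alpha>) + 3"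

text \<open>Dominates every power with exponent between - \<alpha> and 2, hence every moment in the
  estimates for a pair. Its integral against a profile is bounded in terms of \<alpha>
  alone.\<close>

definition wt :: "real \<Rightarrow> real \<Rightarrow> real" where "wt \<alpha> y = y powr (- \<alpha>) + y\<^sup>2"

lemma wt_measurable [measurable]: "wt \<alpha> \<in> borel_measurable borel" unfolding wt_def by measurable

lemma powr_le_wt: assumes "0 < y" "- \<alpha> \<le> a" "a \<le> 2" shows "y powr a \<le> wt \<alpha> y"
  using powr_le_sum[of y "- \<alpha>" a 2] assms by (simp add: wt_def)

lemma one_le_wt: assumes "0 < y" "0 \<le> \<alpha>" shows "1 \<le> wt \<alpha> y"
  using powr_le_wt[of y \<alpha> 0] assms by simp

locale coag_pair = f1: coag_profile \<alpha> \<epsilon> K f1 + f2: coag_profile \<alpha> \<epsilon> K f2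
  for \<alpha> \<epsilon> :: real and K and f1 f2 +
  assumes small: "541 * \<epsilon> * (1 + 40 / (1 - \<alpha>)) ^ 3 \<le> (1 - \<alpha>) / 40"
begin

abbreviation "B \<equiv> moment_bound \<alpha>"
abbreviation "\<mu> \<equiv> wt \<alpha>"

text \<open>With the mean \<open>s\<close> and the difference \<open>g\<close>, the quadratic
  expression in \<open>f1\<close> minus that in \<open>f2\<close> is bilinear in \<open>g\<close>
  and \<open>s\<close>: a a' - c c' is the symmetrised product of difference and mean.\<close>

definition s where "s x = (f1 x + f2 x) / 2"
definition g where "g x = f1 x - f2 x"

lemmas alpha = f1.alpha and eps = f1.eps

lemma s_measurable [measurable]: "s \<in> borel_measurable borel" unfolding s_def by measurable
lemma g_measurable [measurable]: "g \<in> borel_measurable borel" unfolding g_def by measurable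
lemma s_nonneg: "0 \<le> s x" using f1.f_nonneg f2.f_nonneg by (simp add: s_def)
lemma s_zero: "x \<le> 0 \<Longrightarrow> s x = 0" by (simp add: s_def f1.f_zero f2.f_zero)
lemma g_zero: "x \<le> 0 \<Longrightarrow> g x = 0" by (simp add: g_def f1.f_zero f2.f_zero)

lemma profile_wt:
  assumes "coag_profile \<alpha> \<epsilon> K f"
  shows "integrable lborel (\<lambda>x. f x * \<mu> x)" "(\<integral>x. f x * \<mu> x \<partial>lborel) \<le> B"
proof -
  interpret coag_profile \<alpha> \<epsilon> K f by (rule assms)
  note n = negative_moment[OF small]
  note m = second_moment[OF n(1)]
  have e: "f x * \<mu> x = f x * x powr (- \<alpha>) + f x * x\<^sup>2" for x by (simp add: wt_def algebra_simps)
  show "integrable lborel (\<lambda>x. f x * \<mu> x)" unfolding e using n(2) m(1) by simp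
  show "(\<integral>x. f x * \<mu> x \<partial>lborel) \<le> B" unfolding e moment_bound_def using n(2,3) m by simp
qed

lemma f1_wt: "integrable lborel (\<lambda>x. f1 x * \<mu> x)" "(\<integral>x. f1 x * \<mu> x \<partial>lborel) \<le> B"
  by (rule profile_wt[OF f1.coag_profile_axioms])+

lemma f2_wt: "integrable lborel (\<lambda>x. f2 x * \<mu> x)" "(\<integral>x. f2 x * \<mu> x \<partial>lborel) \<le> B"
  by (rule profile_wt[OF f2.coag_profile_axioms])+

lemma s_wt: "integrable lborel (\<lambda>x. s x * \<mu> x)" "(\<integral>x. s x * \<mu> x \<partial>lborel) \<le> B"
proof -
  have e: "s x * \<mu> x = (f1 x * \<mu> x) / 2 + (f2 x * \<mu> x) / 2" for x by (simp add: s_def field_simps)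
  show "integrable lborel (\<lambda>x. s x * \<mu> x)" unfolding e using f1_wt f2_wt by simp
  show "(\<integral>x. s x * \<mu> x \<partial>lborel) \<le> B" unfolding e using f1_wt f2_wt by simp
qed

lemma B_ge: "3 \<le> B" using alpha by (simp add: moment_bound_def)

lemma s_bound:
  assumes [measurable]: "h \<in> borel_measurable borel" and le: "\<And>y. 0 < y \<Longrightarrow> \<bar>h y\<bar> \<le> k * \<mu> y" and k: "0 \<le> k"
  shows "integrable lborel (\<lambda>y. s y * h y)" "\<bar>\<integral>y. s y * h y \<partial>lborel\<bar> \<le> k * B"
proof -
  have b: "\<bar>s y * h y\<bar> \<le> k * (s y * \<mu> y)" for y
  proof (cases "0 < y")
    case True
    from mult_left_mono[OF le[OF this] s_nonneg[of y]] show ?thesis using s_nonneg[of y] by (simp add: abs_mult mult_ac)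
  qed (simp add: s_zero)
  have d: "integrable lborel (\<lambda>y. k * (s y * \<mu> y))" using s_wt by simp
  show i: "integrable lborel (\<lambda>y. s y * h y)"
    by (rule Bochner_Integration.integrable_bound[OF d]) (use b in \<open>auto intro!: order_trans[OF b]\<close>)
  have "(\<integral>y. k * (s y * \<mu> y) \<partial>lborel) \<le> k * B"
    unfolding integral_mult_right_zero by (rule mult_left_mono[OF s_wt(2) k])
  then show "\<bar>\<integral>y. s y * h y \<partial>lborel\<bar> \<le> k * B"
    by (rule order_trans[OF order_trans[OF integral_abs_bound integral_mono[OF integrable_abs[OF i] d b]]])
qed

text \<open>The shift by \<epsilon> makes the perturbation nonnegative, so that its loss rate
  \<open>V\<close> has a sign. The subtracted \<epsilon> is a multiple of the constant kernel and is
  estimated separately.\<close>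

definition W where "W x y = (if 0 < x \<and> 0 < y then K x y - 2 + \<epsilon> else 0)"

definition pw where "pw x y = (x / y) powr \<alpha> + (y / x) powr \<alpha>"

lemma pw_ge_1: assumes "0 < x" "0 < y" shows "1 \<le> pw x y"
proof (cases "x \<le> y")
  case True
  then have "1 \<le> (y / x) powr \<alpha>" using assms alpha by (intro ge_one_powr_ge_zero) auto
  then show ?thesis by (simp add: pw_def add_increasing)
next
  case False
  then have "1 \<le> (x / y) powr \<alpha>" using assms alpha by (intro ge_one_powr_ge_zero) auto
  then show ?thesis by (simp add: pw_def add_increasing2)
qed

lemma pw_eq: assumes "0 < x" "0 < y"
  shows "pw x y = x powr \<alpha> * y powr (- \<alpha>) + x powr (- \<alpha>) * y powr \<alpha>"
  using assms by (simp add: pw_def powr_divide powr_minus field_simps)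

lemma W_nonneg: "0 \<le> W x y" using f1.K_lower[of x y] by (cases "0 < x \<and> 0 < y") (auto simp: W_def)

lemma W_upper: assumes "0 < x" "0 < y" shows "W x y \<le> 2 * \<epsilon> * pw x y"
proof -
  have "W x y \<le> \<epsilon> * (1 + pw x y)" using f1.K_upper[OF assms] assms by (simp add: W_def pw_def algebra_simps)
  also have "\<dots> \<le> \<epsilon> * (2 * pw x y)" using pw_ge_1[OF assms] eps by (intro mult_left_mono) auto
  finally show ?thesis by simp
qed

lemma K_upper_pw: assumes "0 < x" "0 < y" shows "K x y \<le> 3 * pw x y"
proof -
  have "\<epsilon> * pw x y \<le> 1 * pw x y" using eps pw_ge_1[OF assms] by (intro mult_right_mono) auto
  then show ?thesis using f1.K_upper[OF assms, folded pw_def] pw_ge_1[OF assms] by linarith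
qed

lemma pw_measurable [measurable (raw)]:
  assumes [measurable]: "h \<in> borel_measurable M" "k \<in> borel_measurable M"
  shows "(\<lambda>x. pw (h x) (k x)) \<in> borel_measurable M"
  unfolding pw_def by measurable

lemma W_measurable [measurable (raw)]:
  assumes [measurable]: "h \<in> borel_measurable M" "k \<in> borel_measurable M"
  shows "(\<lambda>x. W (h x) (k x)) \<in> borel_measurable M"
  unfolding W_def by measurable

definition V where "V x = (\<integral>y. s y * W x y \<partial>lborel)"

lemma W_wt: assumes "0 < x" "0 < y" shows "\<bar>W x y\<bar> \<le> 2 * \<epsilon> * (x powr \<alpha> + x powr (- \<alpha>)) * \<mu> y"
proof -
  have "pw x y \<le> x powr \<alpha> * \<mu> y + x powr (- \<alpha>) * \<mu> y"
    unfolding pw_eq[OF assms] using assms alpha by (intro add_mono mult_left_mono powr_le_wt) auto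
  then have "2 * \<epsilon> * pw x y \<le> 2 * \<epsilon> * ((x powr \<alpha> + x powr (- \<alpha>)) * \<mu> y)"
    using eps by (intro mult_left_mono) (auto simp: distrib_right)
  then show ?thesis using W_upper[OF assms] W_nonneg[of x y] by (simp add: mult_ac)
qed

lemma V_integrable: assumes "0 < x" shows "integrable lborel (\<lambda>y. s y * W x y)"
  by (rule s_bound(1)[OF _ W_wt[OF assms]]) (use eps in auto)

lemma V_bounds: assumes "0 < x" shows "0 \<le> V x" "V x \<le> 2 * \<epsilon> * (x powr \<alpha> + x powr (- \<alpha>)) * B"
proof -
  show "0 \<le> V x" unfolding V_def using s_nonneg W_nonneg by (intro Bochner_Integration.integral_nonneg) auto
  have "\<bar>V x\<bar> \<le> 2 * \<epsilon> * (x powr \<alpha> + x powr (- \<alpha>)) * B" unfolding V_def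
    by (rule s_bound(2)[OF _ W_wt[OF assms]]) (use eps in auto)
  then show "V x \<le> 2 * \<epsilon> * (x powr \<alpha> + x powr (- \<alpha>)) * B" by simp
qed

text \<open>The loss rate becomes a coefficient of the differential equation in
  \<open>solve_transport\<close>, which asks for continuity. Dominated convergence applies because
  \<open>W_wt\<close> is uniform for arguments between x / 2 and 2 x.\<close>

lemma V_cont: "continuous_on {0<..} V"
proof (rule continuous_at_imp_continuous_on, rule ballI)
  fix x :: real assume "x \<in> {0<..}"
  then have x: "0 < x" by simp
  show "isCont V x" unfolding continuous_at_sequentially
  proof (intro allI impI)
    fix u assume u: "u \<longlonglongrightarrow> x"
    define k where "k = 2 * \<epsilon> * ((2 * x) powr \<alpha> + (x / 2) powr (- \<alpha>))"
    have ev: "\<forall>\<^sub>F n in sequentially. x / 2 < u n \<and> u n < 2 * x"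
      using order_tendstoD(1)[OF u, of "x / 2"] order_tendstoD(2)[OF u, of "2 * x"] x by (simp add: eventually_conj)
    then obtain N where N: "\<And>n. N \<le> n \<Longrightarrow> x / 2 < u n \<and> u n < 2 * x" by (auto simp: eventually_sequentially)
    have "(\<lambda>n. V (u (n + N))) \<longlonglongrightarrow> V x"
      unfolding V_def
    proof (rule integral_dominated_convergence)
      show "integrable lborel (\<lambda>y. k * (s y * \<mu> y))" using s_wt by simp
      show "AE y in lborel. (\<lambda>n. s y * W (u (n + N)) y) \<longlonglongrightarrow> s y * W x y"
      proof (rule AE_I2, intro tendsto_mult tendsto_const)
        fix y :: real
        show "(\<lambda>n. W (u (n + N)) y) \<longlonglongrightarrow> W x y"
        proof (cases "0 < y")
          case True
          have "isCont (\<lambda>p. K (fst p) (snd p)) (x, y)"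
          proof (rule continuous_on_interior[OF f1.K_cont])
            have "interior ({0<..} \<times> {0<..}) = {0::real<..} \<times> {0::real<..}"
              by (intro interior_open open_Times open_greaterThan)
            then show "(x, y) \<in> interior ({0<..} \<times> {0<..})" using x True by simp
          qed
          moreover have "(\<lambda>n. (u (n + N), y)) \<longlonglongrightarrow> (x, y)"
            by (rule tendsto_Pair[OF LIMSEQ_ignore_initial_segment[OF u] tendsto_const])
          ultimately have "(\<lambda>n. K (u (n + N)) y) \<longlonglongrightarrow> K x y"
            using isCont_tendsto_compose[of "(x, y)" "\<lambda>p. K (fst p) (snd p)" "\<lambda>n. (u (n + N), y)"] by simp
          then have "(\<lambda>n. K (u (n + N)) y - 2 + \<epsilon>) \<longlonglongrightarrow> K x y - 2 + \<epsilon>"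
            by (intro tendsto_add tendsto_diff tendsto_const)
          moreover have "0 < u (n + N)" for n using N[of "n + N"] x by simp
          ultimately show ?thesis using x True by (simp add: W_def)
        qed (simp add: W_def)
      qed
      show "AE y in lborel. norm (s y * W (u (n + N)) y) \<le> k * (s y * \<mu> y)" for n
      proof (rule AE_I2)
        fix y :: real
        show "norm (s y * W (u (n + N)) y) \<le> k * (s y * \<mu> y)"
        proof (cases "0 < y")
          case True
          define t where "t = u (n + N)"
          have t: "x / 2 < t" "t < 2 * x" "0 < t" using N[of "n + N"] x by (auto simp: t_def)
          have "2 * \<epsilon> * (t powr \<alpha> + t powr (- \<alpha>)) \<le> k"
            unfolding k_def using t x alpha eps by (intro mult_left_mono add_mono powr_mono2 powr_mono2') auto
          then have "2 * \<epsilon> * (t powr \<alpha> + t powr (- \<alpha>)) * \<mu> y \<le> k * \<mu> y"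
            using one_le_wt[OF True alpha(1)] by (intro mult_right_mono) auto
          then have "\<bar>W t y\<bar> \<le> k * \<mu> y" using W_wt[OF t(3) True] by linarith
          from mult_left_mono[OF this s_nonneg[of y]] show ?thesis
            using s_nonneg[of y] by (simp add: t_def abs_mult mult_ac)
        qed (simp add: s_zero)
      qed
    qed measurable
    then have "(\<lambda>n. V (u n)) \<longlonglongrightarrow> V x" by (rule LIMSEQ_offset)
    then show "(V \<circ> u) \<longlonglongrightarrow> V x" by (simp add: o_def)
  qed
qed

text \<open>Cutting \<open>V\<close> off at infinity keeps only the loss that is singular at the origin; at large sizes the loss is
  compensated by the gain.\<close>
definition VT where "VT x = min 1 (1 / x) * V x"

lemma VT_cont: "continuous_on {0<..} VT"
  unfolding VT_def by (intro continuous_intros V_cont) auto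

lemma V_le_small: assumes "0 < x" "x \<le> 1" shows "V x \<le> 4 * \<epsilon> * B * x powr (- \<alpha>)"
proof -
  have "x powr \<alpha> \<le> x powr (- \<alpha>)" using assms alpha by (intro powr_mono') auto
  then have "2 * \<epsilon> * (x powr \<alpha> + x powr (- \<alpha>)) * B \<le> 2 * \<epsilon> * (2 * x powr (- \<alpha>)) * B"
    using eps B_ge by (intro mult_right_mono mult_left_mono) auto
  then show ?thesis using V_bounds[OF assms(1)] by (simp add: mult_ac)
qed

lemma VT_bounds: assumes "0 < x" shows "0 \<le> VT x" "VT x \<le> 4 * \<epsilon> * B * (1 + x powr (- \<alpha>))"
proof -
  show "0 \<le> VT x" unfolding VT_def using assms V_bounds[OF assms] by (intro mult_nonneg_nonneg) auto
  show "VT x \<le> 4 * \<epsilon> * B * (1 + x powr (- \<alpha>))"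
  proof (cases "x \<le> 1")
    case True
    have "VT x = V x" using True assms by (simp add: VT_def)
    also have "\<dots> \<le> 4 * \<epsilon> * B * x powr (- \<alpha>)" by (rule V_le_small[OF assms True])
    also have "\<dots> \<le> 4 * \<epsilon> * B * (1 + x powr (- \<alpha>))" using eps B_ge by (intro mult_left_mono) auto
    finally show ?thesis .
  next
    case False
    have p: "x powr (- \<alpha>) \<le> x" "x powr \<alpha> \<le> x"
      using False alpha powr_mono[of "- \<alpha>" 1 x] powr_mono[of \<alpha> 1 x] by auto
    have "VT x = V x / x" using False assms by (simp add: VT_def min_def)
    also have "\<dots> \<le> 2 * \<epsilon> * (x + x) * B / x"
    proof (rule divide_right_mono)
      have "2 * \<epsilon> * (x powr \<alpha> + x powr (- \<alpha>)) * B \<le> 2 * \<epsilon> * (x + x) * B"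
        using p eps B_ge assms by (intro mult_right_mono mult_left_mono add_mono) auto
      then show "V x \<le> 2 * \<epsilon> * (x + x) * B" using V_bounds[OF assms] by linarith
    qed (use assms in simp)
    also have "\<dots> = 4 * \<epsilon> * B * 1" using assms by simp
    also have "\<dots> \<le> 4 * \<epsilon> * B * (1 + x powr (- \<alpha>))" using eps B_ge by (intro mult_left_mono) auto
    finally show ?thesis .
  qed
qed

end

section \<open>Kernel estimates against a test function\<close>

locale coag_pair_test = coag_pair \<alpha> \<epsilon> K f1 f2 + test_function \<alpha> C \<psi> \<psi>'
  for \<alpha> \<epsilon> K f1 f2 C \<psi> \<psi>'
begin


lemma b_arith: "- \<alpha> \<le> 1 + b" "1 + b \<le> 2" "1 + b + \<alpha> \<le> 2" "0 \<le> 1 + b" "\<alpha> + b \<le> 1" "- \<alpha> \<le> \<alpha> + b" "\<alpha> + b \<le> 2" "0 \<le> b"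
  using alpha by (auto simp: field_simps)

lemma wt_nonneg: "0 \<le> \<mu> y" by (simp add: wt_def)

lemma Delta_wt: assumes "0 < x" "0 < y" shows "\<bar>\<Delta> x y\<bar> \<le> (16 * C * (1 + x)) * \<mu> y"
proof -
  have "1 + y powr (1 + b) \<le> 2 * \<mu> y"
    using powr_le_wt[OF assms(2), of \<alpha> "1 + b"] one_le_wt[OF assms(2) alpha(1)] b_arith by linarith
  then have "8 * C * (1 + x) * (1 + y powr (1 + b)) \<le> 8 * C * (1 + x) * (2 * \<mu> y)"
    using C1 assms by (intro mult_left_mono) auto
  then show ?thesis using Delta_bound[OF assms] by linarith
qed

lemma powr_mult_wt:
  assumes "0 < y" "\<bar>a\<bar> \<le> \<alpha>" "0 \<le> k" "k \<le> 1 + b"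
  shows "y powr a * (1 + y powr k) \<le> 2 * \<mu> y"
proof -
  have "y powr a * (1 + y powr k) = y powr a + y powr (a + k)" by (simp add: powr_add distrib_left)
  also have "\<dots> \<le> \<mu> y + \<mu> y"
  proof (intro add_mono powr_le_wt)
    show "0 < y" "0 < y" "- \<alpha> \<le> a" "a \<le> 2" "- \<alpha> \<le> a + k" "a + k \<le> 2" using assms alpha b_arith by linarith+
  qed
  finally show ?thesis by simp
qed

text \<open>The largest exponents that occur are 1 + \<alpha> in x and 1 + b + \<alpha> in y, both
  at most 2. The resulting product form makes the double integrals of \<open>KD\<close> against two
  profiles finite.\<close>

lemma ratio_Delta_weight: assumes "0 < x" "0 < y" shows "pw x y * \<bar>\<Delta> x y\<bar> \<le> 64 * C * \<mu> x * \<mu> y"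
proof -
  define X where "X = 1 + x"
  define Y where "Y = 1 + y powr (1 + b)"
  have X: "x powr \<alpha> * X \<le> 2 * \<mu> x" "x powr (- \<alpha>) * X \<le> 2 * \<mu> x"
    using powr_mult_wt[of x \<alpha> 1] powr_mult_wt[of x "- \<alpha>" 1] assms alpha b_arith by (auto simp: X_def)
  have Y: "y powr \<alpha> * Y \<le> 2 * \<mu> y" "y powr (- \<alpha>) * Y \<le> 2 * \<mu> y"
    using powr_mult_wt[of y \<alpha> "1 + b"] powr_mult_wt[of y "- \<alpha>" "1 + b"] assms alpha b_arith by (auto simp: Y_def)
  have XY: "0 \<le> X" "0 \<le> Y" using assms by (auto simp: X_def Y_def)
  have "pw x y * (X * Y) = (x powr \<alpha> * X) * (y powr (- \<alpha>) * Y) + (x powr (- \<alpha>) * X) * (y powr \<alpha> * Y)"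
    unfolding pw_eq[OF assms] by (simp only: algebra_simps)
  also have "\<dots> \<le> (2 * \<mu> x) * (2 * \<mu> y) + (2 * \<mu> x) * (2 * \<mu> y)"
    by (rule add_mono[OF mult_mono[OF X(1) Y(2)] mult_mono[OF X(2) Y(1)]]) (simp_all add: XY wt_nonneg)
  finally have 1: "pw x y * (X * Y) \<le> 8 * (\<mu> x * \<mu> y)" by simp
  have "\<bar>\<Delta> x y\<bar> \<le> 8 * C * (X * Y)" using Delta_bound[OF assms] by (simp add: X_def Y_def mult.assoc)
  then have "pw x y * \<bar>\<Delta> x y\<bar> \<le> pw x y * (8 * C * (X * Y))"
    using pw_ge_1[OF assms] by (intro mult_left_mono) auto
  also have "\<dots> = 8 * C * (pw x y * (X * Y))" by (simp only: mult_ac)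
  also have "\<dots> \<le> 8 * C * (8 * (\<mu> x * \<mu> y))" using 1 C1 by (intro mult_left_mono) auto
  finally show ?thesis by (simp add: mult.assoc)
qed

definition KD where "KD x y = K x y * \<Delta> x y"

lemma KD_wt: "\<bar>KD x y\<bar> \<le> 192 * C * (\<mu> x * \<mu> y)"
proof (cases "0 < x \<and> 0 < y")
  case True
  have "\<bar>KD x y\<bar> = K x y * \<bar>\<Delta> x y\<bar>" using f1.K_nonneg by (simp add: KD_def abs_mult)
  also have "\<dots> \<le> 3 * pw x y * \<bar>\<Delta> x y\<bar>" using True by (intro mult_right_mono K_upper_pw) auto
  also have "\<dots> \<le> 3 * (64 * C * \<mu> x * \<mu> y)" using ratio_Delta_weight[of x y] True by simp
  finally show ?thesis by (simp add: mult.assoc)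
next
  case False
  then have "KD x y = 0" using f1.K_zero[of x y] by (simp add: KD_def)
  then show ?thesis using wt_nonneg C1 by simp
qed

lemma KD_sym: "KD x y = KD y x" by (simp add: KD_def \<Delta>_def f1.K_sym[of x y] add.commute)

text \<open>Nothing is known about \<open>\<psi>\<close> on the negative axis; the extension by zero
  makes integrands over the whole line measurable, and profiles vanish there anyway.\<close>

definition \<psi>0 where "\<psi>0 x = (if x \<in> {0<..} then \<psi> x else 0)"

lemma psi0_measurable [measurable]: "\<psi>0 \<in> borel_measurable borel"
  unfolding \<psi>0_def by (intro borel_measurable_continuous_on_if psi_cont continuous_on_const) auto

definition D0 where "D0 x y = (if 0 < y then \<psi>0 (x + y) - \<psi>0 x - \<psi>0 y else 0)"

lemma D0_measurable [measurable]: "D0 x \<in> borel_measurable borel" unfolding D0_def by measurable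

lemma D0_eq: "0 < x \<Longrightarrow> 0 < y \<Longrightarrow> D0 x y = \<Delta> x y" by (simp add: D0_def \<psi>0_def \<Delta>_def)

lemma KD_eq: "KD x y = K x y * (\<psi>0 (x + y) - \<psi>0 x - \<psi>0 y)"
  using f1.K_zero[of x y] by (cases "0 < x \<and> 0 < y") (auto simp: KD_def \<psi>0_def \<Delta>_def)

lemma KD_measurable [measurable (raw)]:
  assumes [measurable]: "h \<in> borel_measurable M" "k \<in> borel_measurable M"
  shows "(\<lambda>x. KD (h x) (k x)) \<in> borel_measurable M"
  unfolding KD_eq by measurable

lemma KD_integrable:
  assumes a: "integrable lborel (\<lambda>x. a x * \<mu> x)" and c: "integrable lborel (\<lambda>x. c x * \<mu> x)"
    and [measurable]: "a \<in> borel_measurable borel" "c \<in> borel_measurable borel"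
  shows "integrable lborel2 (\<lambda>(y, z). a y * c z * KD y z)"
proof (rule Bochner_Integration.integrable_bound[OF integrable_mult_right[OF integral_product(1)[OF a c], of "192 * C"]])
  show "AE q in lborel2. norm (case q of (y, z) \<Rightarrow> a y * c z * KD y z) \<le> norm (192 * C * (case q of (y, z) \<Rightarrow> a y * \<mu> y * (c z * \<mu> z)))"
  proof (rule AE_I2)
    fix q :: "real \<times> real"
    obtain y z where q: "q = (y, z)" by (cases q)
    have "\<bar>a y * c z\<bar> * \<bar>KD y z\<bar> \<le> \<bar>a y * c z\<bar> * (192 * C * (\<mu> y * \<mu> z))"
      by (rule mult_left_mono[OF KD_wt]) simp
    also have "\<dots> = \<bar>192 * C * (a y * \<mu> y * (c z * \<mu> z))\<bar>"
      using C1 wt_nonneg by (simp add: abs_mult mult_ac)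
    finally show "norm (case q of (y, z) \<Rightarrow> a y * c z * KD y z) \<le> norm (192 * C * (case q of (y, z) \<Rightarrow> a y * \<mu> y * (c z * \<mu> z)))"
      by (simp add: q abs_mult)
  qed
qed measurable

lemma g_wt: "integrable lborel (\<lambda>x. g x * \<mu> x)"
proof -
  have e: "g x * \<mu> x = f1 x * \<mu> x - f2 x * \<mu> x" for x by (simp add: g_def algebra_simps)
  show ?thesis unfolding e by (rule Bochner_Integration.integrable_diff[OF f1_wt(1) f2_wt(1)])
qed

lemma transport_wt: assumes "0 < x" shows "\<bar>\<psi> x - x * \<psi>' x\<bar> \<le> 4 * C * \<mu> x"
proof -
  have "x * \<bar>\<psi>' x\<bar> \<le> x * (C * (x powr (- 1 - \<alpha>) + x powr b))"
    using der_bound[OF assms] assms by (intro mult_left_mono) auto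
  also have "\<dots> = C * (x powr (- \<alpha>) + x powr (1 + b))"
  proof -
    have "x * x powr (- 1 - \<alpha>) = x powr (1 + (- 1 - \<alpha>))" using assms by (subst powr_add) simp
    moreover have "x * x powr b = x powr (1 + b)" using assms by (subst powr_add) simp
    ultimately show ?thesis by (simp add: algebra_simps)
  qed
  finally have 1: "x * \<bar>\<psi>' x\<bar> \<le> C * (x powr (- \<alpha>) + x powr (1 + b))" .
  have "\<bar>\<psi> x - x * \<psi>' x\<bar> \<le> \<bar>\<psi> x\<bar> + x * \<bar>\<psi>' x\<bar>"
    using abs_triangle_ineq4[of "\<psi> x" "x * \<psi>' x"] assms by (simp add: abs_mult)
  also have "\<dots> \<le> C * (1 + x powr (1 + b)) + C * (x powr (- \<alpha>) + x powr (1 + b))"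
    using 1 bound[OF assms] by (rule add_mono[rotated])
  also have "\<dots> \<le> C * (\<mu> x + \<mu> x) + C * (\<mu> x + \<mu> x)"
    using C1 assms alpha by (intro add_mono mult_left_mono powr_le_wt one_le_wt b_arith) auto
  finally show ?thesis by simp
qed

lemma profile_transport_integrable:
  assumes "coag_profile \<alpha> \<epsilon> K f"
  shows "integrable lborel (\<lambda>x. f x * (\<psi> x - x * \<psi>' x))"
proof -
  interpret F: coag_profile \<alpha> \<epsilon> K f by (rule assms)
  define k where "k x = (if x \<in> {0<..} then \<psi> x - x * \<psi>' x else 0)" for x
  have [measurable]: "k \<in> borel_measurable borel" unfolding k_def
    by (intro borel_measurable_continuous_on_if continuous_intros psi_cont der_cont) auto
  have e: "f x * (\<psi> x - x * \<psi>' x) = f x * k x" for x using F.f_zero[of x] by (cases "0 < x") (auto simp: k_def)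
  show ?thesis unfolding e
  proof (rule Bochner_Integration.integrable_bound[OF integrable_mult_right[OF profile_wt(1)[OF assms], of "4 * C"]])
    show "AE x in lborel. norm (f x * k x) \<le> norm (4 * C * (f x * \<mu> x))"
    proof (rule AE_I2)
      fix x
      show "norm (f x * k x) \<le> norm (4 * C * (f x * \<mu> x))"
      proof (cases "0 < x")
        case True
        from mult_left_mono[OF transport_wt[OF this] F.f_nonneg[of x]] show ?thesis
          using True C1 F.f_nonneg[of x] wt_nonneg by (simp add: k_def abs_mult mult_ac)
      qed (simp add: F.f_zero)
    qed
  qed measurable
qed

lemma profile_weak:
  assumes "coag_profile \<alpha> \<epsilon> K f"
  shows "2 * (\<integral>x. f x * (\<psi> x - x * \<psi>' x) \<partial>lborel) = - (\<integral>(y, z). f y * f z * KD y z \<partial>lborel2)"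
proof -
  interpret F: coag_profile \<alpha> \<epsilon> K f by (rule assms)
  have e: "K y z * f y * f z * (\<psi> y + \<psi> z - \<psi> (y + z)) = - (f y * f z * KD y z)" for y z
    by (simp add: KD_def \<Delta>_def algebra_simps)
  have "2 * (\<integral>x. f x * (\<psi> x - x * \<psi>' x) \<partial>lborel) = (\<integral>(y, z). K y z * f y * f z * (\<psi> y + \<psi> z - \<psi> (y + z)) \<partial>lborel2)"
    by (rule F.weak_form(2)[OF der der_cont profile_transport_integrable[OF assms]])
  then show ?thesis unfolding e by (simp add: case_prod_unfold)
qed

text \<open>The weak equations of the two profiles are subtracted. Symmetry of \<open>KD\<close>
  cancels the mixed terms, so the difference of the quadratic terms is exactly twice the bilinear
  term in \<open>g\<close> and \<open>s\<close>.\<close>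

lemma adjoint_identity:
  "integrable lborel (\<lambda>x. g x * (\<psi> x - x * \<psi>' x))"
  "integrable lborel (\<lambda>x. g x * (\<integral>y. s y * KD x y \<partial>lborel))"
  "(\<integral>x. g x * (\<psi> x - x * \<psi>' x) \<partial>lborel) + (\<integral>x. g x * (\<integral>y. s y * KD x y \<partial>lborel) \<partial>lborel) = 0"
proof -
  note P1 = f1.coag_profile_axioms and P2 = f2.coag_profile_axioms
  note t1 = profile_transport_integrable[OF P1] and t2 = profile_transport_integrable[OF P2]
  have e: "g x * (\<psi> x - x * \<psi>' x) = f1 x * (\<psi> x - x * \<psi>' x) - f2 x * (\<psi> x - x * \<psi>' x)" for x
    by (simp add: g_def left_diff_distrib)
  show "integrable lborel (\<lambda>x. g x * (\<psi> x - x * \<psi>' x))"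
    unfolding e by (rule Bochner_Integration.integrable_diff[OF t1 t2])
  have G: "(\<integral>x. g x * (\<psi> x - x * \<psi>' x) \<partial>lborel) =
     (\<integral>x. f1 x * (\<psi> x - x * \<psi>' x) \<partial>lborel) - (\<integral>x. f2 x * (\<psi> x - x * \<psi>' x) \<partial>lborel)"
    unfolding e by (rule Bochner_Integration.integral_diff[OF t1 t2])
  have gs: "integrable lborel2 (\<lambda>(y, z). g y * s z * KD y z)"
    by (rule KD_integrable[OF g_wt s_wt(1)]) measurable
  have gs': "(\<integral>z. g y * s z * KD y z \<partial>lborel) = g y * (\<integral>z. s z * KD y z \<partial>lborel)" for y
    by (subst integral_mult_right_zero[symmetric]) (simp only: mult.assoc)
  show "integrable lborel (\<lambda>x. g x * (\<integral>y. s y * KD x y \<partial>lborel))"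
    using lborel_pair.integrable_fst[OF gs] unfolding gs' .
  have S: "(\<integral>x. g x * (\<integral>y. s y * KD x y \<partial>lborel) \<partial>lborel) = (\<integral>(y, z). g y * s z * KD y z \<partial>lborel2)"
    using lborel_pair.integral_fst[OF gs] unfolding gs' .
  define H where "H a c = (\<lambda>(y, z). a y * c z * KD y z)" for a c :: "real \<Rightarrow> real"
  have i: "integrable lborel2 (H f1 f1)" "integrable lborel2 (H f1 f2)" "integrable lborel2 (H f2 f1)" "integrable lborel2 (H f2 f2)"
    unfolding H_def by (rule KD_integrable; (rule f1_wt f2_wt | measurable))+
  have sw: "(\<integral>q. H f1 f2 q \<partial>lborel2) = (\<integral>q. H f2 f1 q \<partial>lborel2)"
  proof -
    have "(\<lambda>(x, y). H f2 f1 (y, x)) = H f1 f2" by (auto simp: H_def KD_sym mult_ac)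
    then show ?thesis using lborel_pair.integral_product_swap[of "H f2 f1"] i by auto
  qed
  have "(\<lambda>(y, z). g y * s z * KD y z) = (\<lambda>q. (H f1 f1 q + H f1 f2 q - H f2 f1 q - H f2 f2 q) / 2)"
    by (auto simp: H_def g_def s_def algebra_simps add_divide_distrib diff_divide_distrib)
  then have "(\<integral>(y, z). g y * s z * KD y z \<partial>lborel2) = ((\<integral>q. H f1 f1 q \<partial>lborel2) - (\<integral>q. H f2 f2 q \<partial>lborel2)) / 2"
    using i sw by simp
  moreover have "2 * (\<integral>x. f1 x * (\<psi> x - x * \<psi>' x) \<partial>lborel) = - (\<integral>q. H f1 f1 q \<partial>lborel2)"
    "2 * (\<integral>x. f2 x * (\<psi> x - x * \<psi>' x) \<partial>lborel) = - (\<integral>q. H f2 f2 q \<partial>lborel2)"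
    unfolding H_def by (rule profile_weak[OF P1], rule profile_weak[OF P2])
  ultimately show "(\<integral>x. g x * (\<psi> x - x * \<psi>' x) \<partial>lborel) + (\<integral>x. g x * (\<integral>y. s y * KD x y \<partial>lborel) \<partial>lborel) = 0"
    unfolding G S by (simp add: field_simps)
qed

text \<open>For y > x the kernel may be as large as \<open>(y / x) powr \<alpha>\<close>, but the
  shift is at most x times a derivative near y, and x times the kernel is only of order
  \<open>x powr (1 - \<alpha>)\<close>: this is the gain of a derivative at work. For y \<le> x the
  singularity of the kernel is in y, where the negative moment absorbs it, and the sup bound of
  \<open>\<psi>\<close> suffices.\<close>

lemma small_shift:
  assumes "0 < x" "x \<le> 1" "0 < y"
  shows "W x y * \<bar>\<psi> (x + y) - \<psi> y\<bar> \<le> 28 * \<epsilon> * C * \<mu> y"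
proof (cases "y \<le> x")
  case True
  have "(y / x) powr \<alpha> \<le> 1" using True assms alpha powr_mono2[of \<alpha> "y / x" 1] by simp
  moreover have "1 \<le> (x / y) powr \<alpha>" using True assms alpha by (intro ge_one_powr_ge_zero) auto
  ultimately have "pw x y \<le> 2 * (x / y) powr \<alpha>" unfolding pw_def by linarith
  also have "(x / y) powr \<alpha> = x powr \<alpha> * y powr (- \<alpha>)" using assms by (simp add: powr_divide powr_minus field_simps)
  also have "2 * (x powr \<alpha> * y powr (- \<alpha>)) \<le> 2 * (1 * \<mu> y)"
  proof (intro mult_left_mono mult_mono)
    show "x powr \<alpha> \<le> 1" using assms alpha powr_mono2[of \<alpha> x 1] by simp
    show "y powr (- \<alpha>) \<le> \<mu> y" using assms alpha by (intro powr_le_wt) auto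
  qed auto
  finally have "pw x y \<le> 2 * \<mu> y" by simp
  then have "2 * \<epsilon> * pw x y \<le> 2 * \<epsilon> * (2 * \<mu> y)" using eps by (intro mult_left_mono) auto
  then have "W x y \<le> 2 * \<epsilon> * (2 * \<mu> y)" by (rule order_trans[OF W_upper[OF assms(1,3)]])
  moreover have "\<bar>\<psi> (x + y) - \<psi> y\<bar> \<le> 7 * C"
  proof -
    have p: "t powr (1 + b) \<le> 1" if "0 < t" "t \<le> 1" for t using that alpha powr_mono2[of "1 + b" t 1] by simp
    have "(x + y) powr (1 + b) \<le> 2 powr 2"
    proof -
      have "(x + y) powr (1 + b) \<le> 2 powr (1 + b)" using assms True alpha by (intro powr_mono2) auto
      also have "\<dots> \<le> 2 powr 2" using alpha by (intro powr_mono) auto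
      finally show ?thesis .
    qed
    then have "C * (1 + (x + y) powr (1 + b)) \<le> C * 5" using C1 by (intro mult_left_mono) auto
    then have 1: "\<bar>\<psi> (x + y)\<bar> \<le> C * 5" using bound[of "x + y"] assms by linarith
    have "C * (1 + y powr (1 + b)) \<le> C * 2" using C1 p[of y] assms True by (intro mult_left_mono) auto
    then have "\<bar>\<psi> y\<bar> \<le> C * 2" using bound[of y] assms by linarith
    then show ?thesis using 1 by linarith
  qed
  ultimately have "W x y * \<bar>\<psi> (x + y) - \<psi> y\<bar> \<le> 2 * \<epsilon> * (2 * \<mu> y) * (7 * C)"
    using W_nonneg C1 eps wt_nonneg by (intro mult_mono) auto
  then show ?thesis by (simp add: mult_ac)
next
  case False
  have "(x / y) powr \<alpha> \<le> 1" using False assms alpha powr_mono2[of \<alpha> "x / y" 1] by simp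
  moreover have "1 \<le> (y / x) powr \<alpha>" using False assms alpha by (intro ge_one_powr_ge_zero) auto
  ultimately have pw2: "pw x y \<le> 2 * (y / x) powr \<alpha>" unfolding pw_def by linarith
  have "\<bar>\<psi> (y + x) - \<psi> y\<bar> \<le> x * (C * (y powr (- 1 - \<alpha>) + 2 * y powr b))"
  proof (rule mvt_bound)
    fix t assume t: "y < t" "t < y + x"
    have "t powr (- 1 - \<alpha>) \<le> y powr (- 1 - \<alpha>)" using t assms alpha by (intro powr_mono2') auto
    moreover have "t powr b \<le> 2 * y powr b"
    proof -
      have "t powr b \<le> (2 * y) powr b" using t assms False alpha by (intro powr_mono2) auto
      also have "\<dots> = 2 powr b * y powr b" using assms by (simp add: powr_mult)
      also have "\<dots> \<le> 2 * y powr b"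
        using alpha powr_mono[of b 1 2] by (intro mult_right_mono) auto
      finally show ?thesis .
    qed
    ultimately have "C * (t powr (- 1 - \<alpha>) + t powr b) \<le> C * (y powr (- 1 - \<alpha>) + 2 * y powr b)"
      using C1 by (intro mult_left_mono) auto
    then show "\<bar>\<psi>' t\<bar> \<le> C * (y powr (- 1 - \<alpha>) + 2 * y powr b)" using der_bound[of t] t assms by linarith
  qed (use assms in auto)
  then have sh: "\<bar>\<psi> (x + y) - \<psi> y\<bar> \<le> x * (C * (y powr (- 1 - \<alpha>) + 2 * y powr b))" by (simp only: add.commute[of x y])
  have "2 * \<epsilon> * pw x y \<le> 2 * \<epsilon> * (2 * (y / x) powr \<alpha>)" using eps pw2 by (intro mult_left_mono) auto
  then have "W x y \<le> 2 * \<epsilon> * (2 * (y / x) powr \<alpha>)" by (rule order_trans[OF W_upper[OF assms(1,3)]])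
  then have "W x y * \<bar>\<psi> (x + y) - \<psi> y\<bar> \<le> 2 * \<epsilon> * (2 * (y / x) powr \<alpha>) * (x * (C * (y powr (- 1 - \<alpha>) + 2 * y powr b)))"
    using sh W_nonneg eps by (intro mult_mono) auto
  also have "\<dots> = 4 * \<epsilon> * C * ((x * (y / x) powr \<alpha>) * (y powr (- 1 - \<alpha>) + 2 * y powr b))" by simp
  also have "x * (y / x) powr \<alpha> = x powr (1 - \<alpha>) * y powr \<alpha>"
    using assms by (simp add: powr_divide powr_diff)
  also have "4 * \<epsilon> * C * ((x powr (1 - \<alpha>) * y powr \<alpha>) * (y powr (- 1 - \<alpha>) + 2 * y powr b)) \<le> 4 * \<epsilon> * C * (3 * \<mu> y)"
  proof (rule mult_left_mono)
    \<comment> \<open>The two bounds serve the two powers of the derivative bound: replacing x by y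
      compensates the singular power \<open>y powr (- 1 - \<alpha>)\<close>, leaving
      \<open>y powr (- \<alpha>)\<close>; against \<open>y powr b\<close> the bound 1 is
      enough.\<close>
    have x1: "x powr (1 - \<alpha>) \<le> 1" using assms alpha powr_mono2[of "1 - \<alpha>" x 1] by simp
    have x2: "x powr (1 - \<alpha>) \<le> y powr (1 - \<alpha>)" using assms alpha False by (intro powr_mono2) auto
    have "(x powr (1 - \<alpha>) * y powr \<alpha>) * (y powr (- 1 - \<alpha>) + 2 * y powr b) =
       x powr (1 - \<alpha>) * (y powr \<alpha> * y powr (- 1 - \<alpha>)) + x powr (1 - \<alpha>) * (2 * (y powr \<alpha> * y powr b))"
      by (simp only: algebra_simps)
    also have "\<dots> \<le> y powr (1 - \<alpha>) * (y powr \<alpha> * y powr (- 1 - \<alpha>)) + 1 * (2 * (y powr \<alpha> * y powr b))"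
      using x1 x2 by (intro add_mono mult_right_mono) auto
    also have "\<dots> = y powr (1 - \<alpha> + (\<alpha> + (- 1 - \<alpha>))) + 2 * y powr (\<alpha> + b)"
      by (simp only: powr_add mult_1)
    also have "\<dots> \<le> \<mu> y + 2 * \<mu> y"
      using assms alpha by (intro add_mono mult_left_mono powr_le_wt b_arith) auto
    finally show "(x powr (1 - \<alpha>) * y powr \<alpha>) * (y powr (- 1 - \<alpha>) + 2 * y powr b) \<le> 3 * \<mu> y" by simp
  qed (use eps C1 in simp)
  also have "\<dots> \<le> 28 * \<epsilon> * C * \<mu> y" using eps C1 wt_nonneg by (simp add: mult_right_mono)
  finally show ?thesis .
qed

text \<open>The kernel contributes at most \<open>x powr \<alpha>\<close> and the test function
  \<open>x powr b\<close>; since \<alpha> + b \<le> 1 the product stays below the weight x. No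
  separation of the loss is needed here.\<close>

lemma large_shift:
  assumes "1 \<le> x" "0 < y"
  shows "W x y * \<bar>\<Delta> x y\<bar> \<le> 40 * \<epsilon> * C * x * \<mu> y"
proof -
  define Y where "Y = 1 + y powr (1 + b)"
  have x: "0 < x" using assms by simp
  have Y: "y powr \<alpha> * Y \<le> 2 * \<mu> y" "y powr (- \<alpha>) * Y \<le> 2 * \<mu> y" "0 \<le> Y"
    using powr_mult_wt[of y \<alpha> "1 + b"] powr_mult_wt[of y "- \<alpha>" "1 + b"] assms alpha b_arith by (auto simp: Y_def)
  have xa: "x powr (- \<alpha>) \<le> x powr \<alpha>" using assms alpha by (intro powr_mono) auto
  have xb: "x powr \<alpha> * x powr b \<le> x"
  proof -
    have "x powr \<alpha> * x powr b = x powr (\<alpha> + b)" by (simp add: powr_add)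
    also have "\<dots> \<le> x powr 1" using assms by (intro powr_mono b_arith) auto
    finally show ?thesis using x by simp
  qed
  have "pw x y \<le> x powr \<alpha> * y powr (- \<alpha>) + x powr \<alpha> * y powr \<alpha>"
    unfolding pw_eq[OF x assms(2)] using xa by (intro add_mono mult_right_mono) auto
  then have "2 * \<epsilon> * pw x y \<le> 2 * \<epsilon> * (x powr \<alpha> * y powr (- \<alpha>) + x powr \<alpha> * y powr \<alpha>)"
    using eps by (intro mult_left_mono) auto
  then have "W x y \<le> 2 * \<epsilon> * (x powr \<alpha> * y powr (- \<alpha>) + x powr \<alpha> * y powr \<alpha>)"
    by (rule order_trans[OF W_upper[OF x assms(2)]])
  then have "W x y * \<bar>\<Delta> x y\<bar> \<le> 2 * \<epsilon> * (x powr \<alpha> * y powr (- \<alpha>) + x powr \<alpha> * y powr \<alpha>) * (5 * C * x powr b * Y)"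
    using Delta_bound_large[OF assms] W_nonneg eps unfolding Y_def by (intro mult_mono) auto
  also have "\<dots> = 10 * \<epsilon> * C * ((x powr \<alpha> * x powr b) * (y powr (- \<alpha>) * Y + y powr \<alpha> * Y))"
    by (simp add: algebra_simps)
  also have "\<dots> \<le> 10 * \<epsilon> * C * (x * (2 * \<mu> y + 2 * \<mu> y))"
    by (rule mult_left_mono[OF mult_mono[OF xb add_mono[OF Y(2) Y(1)]]]) (use x Y(3) eps C1 in simp_all)
  finally show ?thesis by (simp add: mult_ac)
qed

text \<open>For x \<le> 1 the integrand is a small shift minus \<open>W x y * \<psi> x\<close>. The
  latter integrates to \<open>V x * (\<psi>a x + \<psi>b x)\<close>: its first part is cancelled by
  \<open>VT x * \<psi>a x\<close>, as \<open>VT\<close> and \<open>V\<close> agree there, and the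
  second is bounded because \<open>\<psi>b\<close> is O(x). This gives 28 + 8 = 36. For x > 1
  \<open>large_shift\<close> bounds the whole integral and \<open>VT\<close> itself is small, which
  gives 40 + 8 = 48.\<close>

lemma singular_error:
  assumes split: "\<And>x. 0 < x \<Longrightarrow> \<psi> x = \<psi>a x + \<psi>b x" and a: "\<And>x. 0 < x \<Longrightarrow> \<bar>\<psi>a x\<bar> \<le> 1 + x"
    and bb: "\<And>x. 0 < x \<Longrightarrow> \<bar>\<psi>b x\<bar> \<le> C * (x + x powr (1 + b))" and x: "0 < x"
  shows "integrable lborel (\<lambda>y. s y * (W x y * D0 x y))"
    and "\<bar>VT x * \<psi>a x + (\<integral>y. s y * (W x y * D0 x y) \<partial>lborel)\<bar> \<le> 48 * \<epsilon> * C * B * (1 + x)"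
proof -
  have WD: "\<bar>W x y * D0 x y\<bar> \<le> (128 * \<epsilon> * C * \<mu> x) * \<mu> y" if y: "0 < y" for y
  proof -
    have "\<bar>W x y * D0 x y\<bar> = W x y * \<bar>\<Delta> x y\<bar>" using W_nonneg x y by (simp add: abs_mult D0_eq)
    also have "\<dots> \<le> 2 * \<epsilon> * pw x y * \<bar>\<Delta> x y\<bar>" by (rule mult_right_mono[OF W_upper[OF x y]]) simp
    also have "\<dots> = 2 * \<epsilon> * (pw x y * \<bar>\<Delta> x y\<bar>)" by simp
    also have "\<dots> \<le> 2 * \<epsilon> * (64 * C * \<mu> x * \<mu> y)" using ratio_Delta_weight[OF x y] eps by (intro mult_left_mono) auto
    finally show ?thesis by (simp add: mult_ac)
  qed
  have nn: "0 \<le> 128 * \<epsilon> * C * \<mu> x" using eps C1 wt_nonneg by simp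
  show i: "integrable lborel (\<lambda>y. s y * (W x y * D0 x y))"
    by (rule s_bound(1)[OF _ WD nn]) measurable
  define I where "I = (\<integral>y. s y * (W x y * D0 x y) \<partial>lborel)"
  have eCB: "0 \<le> \<epsilon> * C * B" using eps C1 B_ge by simp
  show "\<bar>VT x * \<psi>a x + (\<integral>y. s y * (W x y * D0 x y) \<partial>lborel)\<bar> \<le> 48 * \<epsilon> * C * B * (1 + x)"
    unfolding I_def[symmetric]
  proof (cases "x \<le> 1")
    case True
    define S where "S y = W x y * D0 x y + W x y * \<psi> x" for y
    have Sb: "\<bar>S y\<bar> \<le> (28 * \<epsilon> * C) * \<mu> y" if y: "0 < y" for y
    proof -
      have "S y = W x y * (\<psi> (x + y) - \<psi> y)" unfolding S_def D0_eq[OF x y] \<Delta>_def by (simp add: algebra_simps)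
      then show ?thesis using small_shift[OF x True y] W_nonneg[of x y] by (simp add: abs_mult)
    qed
    have [measurable]: "S \<in> borel_measurable borel" unfolding S_def by measurable
    have nn2: "0 \<le> 28 * \<epsilon> * C" using eps C1 by simp
    have Sint: "\<bar>\<integral>y. s y * S y \<partial>lborel\<bar> \<le> 28 * \<epsilon> * C * B"
      by (rule s_bound(2)[OF _ Sb nn2]) measurable
    have "s y * S y = s y * (W x y * D0 x y) + \<psi> x * (s y * W x y)" for y
      by (simp add: S_def algebra_simps)
    then have "(\<integral>y. s y * S y \<partial>lborel) = I + \<psi> x * V x"
      unfolding I_def V_def using i V_integrable[OF x] by simp
    then have 1: "\<bar>I + \<psi> x * V x\<bar> \<le> 28 * \<epsilon> * C * B" using Sint by (simp only:)
    have VTx: "VT x = V x" using True x by (simp add: VT_def)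
    have "VT x * \<psi>a x + I = (I + \<psi> x * V x) - V x * \<psi>b x"
      unfolding VTx split[OF x] by (simp add: algebra_simps)
    moreover have "\<bar>V x * \<psi>b x\<bar> \<le> 8 * \<epsilon> * C * B"
    proof -
      have "\<bar>V x * \<psi>b x\<bar> = V x * \<bar>\<psi>b x\<bar>" using V_bounds[OF x] by (simp add: abs_mult)
      also have "\<dots> \<le> (4 * \<epsilon> * B * x powr (- \<alpha>)) * (C * (x + x powr (1 + b)))"
        using V_le_small[OF x True] bb[OF x] V_bounds[OF x] eps B_ge by (intro mult_mono) auto
      also have "\<dots> \<le> (4 * \<epsilon> * B * x powr (- \<alpha>)) * (C * (x + x))"
      proof -
        have "x powr (1 + b) \<le> x powr 1" using True x alpha by (intro powr_mono') auto
        then show ?thesis using eps B_ge C1 x by (intro mult_left_mono) auto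
      qed
      also have "\<dots> = 8 * \<epsilon> * C * B * (x powr (- \<alpha>) * x powr 1)" using x by simp
      also have "x powr (- \<alpha>) * x powr 1 = x powr (1 - \<alpha>)" by (simp add: powr_add[symmetric] del: powr_one')
      also have "8 * \<epsilon> * C * B * x powr (1 - \<alpha>) \<le> 8 * \<epsilon> * C * B * 1"
        using eCB x True alpha powr_mono2[of "1 - \<alpha>" x 1] by (intro mult_left_mono) (auto simp: mult.assoc)
      finally show ?thesis by simp
    qed
    ultimately have "\<bar>VT x * \<psi>a x + I\<bar> \<le> 36 * (\<epsilon> * C * B)" using 1 by linarith
    also have "\<dots> \<le> (48 * (\<epsilon> * C * B)) * (1 + x)"
      using eCB x mult_nonneg_nonneg[of "\<epsilon> * C * B" x] by (simp add: algebra_simps)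
    finally show "\<bar>VT x * \<psi>a x + I\<bar> \<le> 48 * \<epsilon> * C * B * (1 + x)" by (simp add: mult.assoc)
  next
    case False
    then have x1: "1 \<le> x" by simp
    have WD2: "\<bar>W x y * D0 x y\<bar> \<le> (40 * \<epsilon> * C * x) * \<mu> y" if y: "0 < y" for y
      using large_shift[OF x1 y] W_nonneg[of x y] by (simp add: abs_mult D0_eq[OF x y])
    have nn2: "0 \<le> 40 * \<epsilon> * C * x" using eps C1 x by simp
    have 1: "\<bar>I\<bar> \<le> 40 * \<epsilon> * C * x * B"
      unfolding I_def by (rule s_bound(2)[OF _ WD2 nn2]) measurable
    have p: "x powr (- \<alpha>) \<le> 1" using x1 alpha powr_mono[of "- \<alpha>" 0 x] by simp
    have "4 * \<epsilon> * B * (1 + x powr (- \<alpha>)) \<le> 4 * \<epsilon> * B * 2"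
      using p eps B_ge by (intro mult_left_mono) auto
    then have "VT x \<le> 8 * (\<epsilon> * B)" using VT_bounds[OF x] by linarith
    then have "\<bar>VT x * \<psi>a x\<bar> \<le> 8 * (\<epsilon> * B) * (1 + x)"
      unfolding abs_mult using VT_bounds[OF x] a[OF x] x by (intro mult_mono) auto
    also have "\<dots> \<le> 8 * (\<epsilon> * B * C) * (1 + x)"
    proof -
      have "\<epsilon> * B * 1 \<le> \<epsilon> * B * C" using eps B_ge C1 by (intro mult_left_mono) auto
      then show ?thesis using x by (intro mult_right_mono) auto
    qed
    finally have 2: "\<bar>VT x * \<psi>a x\<bar> \<le> 8 * (\<epsilon> * C * B) * (1 + x)" by (simp only: mult_ac)
    have "40 * \<epsilon> * C * x * B = 40 * (\<epsilon> * C * B) * x" by simp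
    then have "\<bar>VT x * \<psi>a x + I\<bar> \<le> 8 * (\<epsilon> * C * B) * (1 + x) + 40 * (\<epsilon> * C * B) * x" using 1 2 by linarith
    also have "\<dots> \<le> 48 * (\<epsilon> * C * B) * (1 + x)"
    proof -
      have "8 * e * (1 + x) + 40 * e * x \<le> 48 * e * (1 + x)" if "0 \<le> e" for e
        using that by (simp add: distrib_left)
      then show ?thesis using eCB by blast
    qed
    finally show "\<bar>VT x * \<psi>a x + I\<bar> \<le> 48 * \<epsilon> * C * B * (1 + x)" by (simp add: mult.assoc)
  qed
qed

end

section \<open>Uniqueness\<close>

text \<open>The constant C is taken from \<open>solve_adjoint\<close> for loss rates up to
  \<open>4 * B * (1 + x powr (- \<alpha>))\<close>, a bound that \<open>VT\<close> satisfies for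
  every admissible \<epsilon>; so \<epsilon> can be chosen after C. Testing \<open>g\<close> with
  the resulting \<open>\<psi>\<close> turns its integral against \<open>\<phi>\<close> into minus
  the integral against the error, since the term c x vanishes for equal masses.\<close>

lemma contraction:
  fixes \<alpha> :: real
  assumes \<alpha>: "0 \<le> \<alpha>" "\<alpha> < 1"
  shows "\<exists>e>0. \<forall>\<epsilon> K f1 f2 \<phi>. coag_profile \<alpha> \<epsilon> K f1 \<longrightarrow> coag_profile \<alpha> \<epsilon> K f2 \<longrightarrow> \<epsilon> \<le> e \<longrightarrow>
    continuous_on {0<..} \<phi> \<longrightarrow> \<phi> \<in> borel_measurable borel \<longrightarrow> (\<forall>x>0. \<bar>\<phi> x\<bar> \<le> 1 + x) \<longrightarrow>
    \<bar>\<integral>x. (f1 x - f2 x) * \<phi> x \<partial>lborel\<bar> \<le> 1 / 2 * (\<integral>x. \<bar>f1 x - f2 x\<bar> * (1 + x) \<partial>lborel)"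
proof -
  define B where "B = moment_bound \<alpha>"
  have B3: "3 \<le> B" using \<alpha> by (simp add: B_def moment_bound_def)
  define b where "b = (1 - \<alpha>) / 2"
  have b: "0 < b" "b \<le> 1" using \<alpha> by (auto simp: b_def)
  obtain C where C: "1 \<le> C" and solve: "\<And>V \<phi>. continuous_on {0<..} V \<Longrightarrow> (\<forall>x>0. 0 \<le> V x \<and> V x \<le> 4 * B * (1 + x powr (- \<alpha>))) \<Longrightarrow>
    continuous_on {0<..} \<phi> \<Longrightarrow> (\<forall>x>0. \<bar>\<phi> x\<bar> \<le> 1 + x) \<Longrightarrow>
    (\<exists>\<psi>a \<psi>b \<psi>' c. (\<forall>x>0. ((\<lambda>x. \<psi>a x + \<psi>b x) has_real_derivative \<psi>' x) (at x)) \<and> continuous_on {0<..} \<psi>' \<and>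
      (\<forall>x>0. \<bar>\<psi>' x\<bar> \<le> C * (x powr (- 1 - \<alpha>) + x powr b)) \<and>
      (\<forall>x>0. \<bar>\<psi>a x\<bar> \<le> 1 + x) \<and> (\<forall>x>0. \<bar>\<psi>b x\<bar> \<le> C * (x + x powr (1 + b))) \<and>
      (\<forall>x>0. \<bar>\<psi>a x + \<psi>b x\<bar> \<le> C * (1 + x powr (1 + b))) \<and>
      (\<forall>x>0. integrable lborel (\<lambda>y. exp_profile y * ((\<psi>a (x + y) + \<psi>b (x + y)) - (\<psi>a x + \<psi>b x) - (\<psi>a y + \<psi>b y)))) \<and>
      (\<forall>x>0. (\<psi>a x + \<psi>b x) - x * \<psi>' x +
         2 * (\<integral>y. exp_profile y * ((\<psi>a (x + y) + \<psi>b (x + y)) - (\<psi>a x + \<psi>b x) - (\<psi>a y + \<psi>b y)) \<partial>lborel)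
         = \<phi> x + V x * \<psi>a x - c * x))"
    using solve_adjoint[OF \<alpha> _ b, of "4 * B"] B3 by auto
  have e8: "0 < (1 / 8 :: real)" by simp
  obtain e1 where e1: "0 < e1" and close: "\<And>\<epsilon> K f \<psi> \<psi>' x. coag_profile \<alpha> \<epsilon> K f \<Longrightarrow> \<epsilon> \<le> e1 \<Longrightarrow> test_function \<alpha> C \<psi> \<psi>' \<Longrightarrow> 0 < x \<Longrightarrow>
    \<bar>\<integral>y. (f y - exp_profile y) * (\<psi> (x + y) - \<psi> x - \<psi> y) \<partial>lborel\<bar> \<le> 1 / 8 * (1 + x)"
    using weak_closeness_test[OF \<alpha> e8 C] by blast
  define A where "A = (1 + 40 / (1 - \<alpha>)) ^ 3"
  have A: "0 < A" unfolding A_def using \<alpha> by (intro zero_less_power add_pos_pos) auto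
  define e2 where "e2 = (1 - \<alpha>) / 40 / (541 * A)"
  \<comment> \<open>Ensures 64 * \<epsilon> * C * B \<le> 1 / 4, where 64 is the 48 of
    \<open>singular_error\<close> plus 16 for the constant shift by \<epsilon>. Together with twice
    1 / 8 from weak closeness the error factor is 1 / 2.\<close>
  define e3 where "e3 = 1 / (256 * C * B)"
  have e23: "0 < e2" "0 < e3" using \<alpha> A C B3 by (auto simp: e2_def e3_def)
  define e where "e = min e1 (min e2 e3)"
  show ?thesis
  proof (intro exI[of _ e] conjI allI impI)
    show "0 < e" using e1 e23 by (simp add: e_def)
    fix \<epsilon> K f1 f2 and \<phi> :: "real \<Rightarrow> real"
    assume P1: "coag_profile \<alpha> \<epsilon> K f1" and P2: "coag_profile \<alpha> \<epsilon> K f2" and "\<epsilon> \<le> e"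
      and \<phi>c: "continuous_on {0<..} \<phi>" and [measurable]: "\<phi> \<in> borel_measurable borel" and \<phi>b: "\<forall>x>0. \<bar>\<phi> x\<bar> \<le> 1 + x"
    have ee: "\<epsilon> \<le> e1" "\<epsilon> \<le> e2" "\<epsilon> \<le> e3" using \<open>\<epsilon> \<le> e\<close> by (auto simp: e_def)
    have "\<epsilon> * (541 * A) \<le> (1 - \<alpha>) / 40" using ee(2) A unfolding e2_def by (simp only: pos_le_divide_eq mult_pos_pos zero_less_numeral)
    then have small: "541 * \<epsilon> * (1 + 40 / (1 - \<alpha>)) ^ 3 \<le> (1 - \<alpha>) / 40" unfolding A_def by (simp only: mult_ac)
    have eCB: "64 * (\<epsilon> * C * B) \<le> 1 / 4"
    proof -
      have "\<epsilon> * (256 * C * B) \<le> 1" using ee(3) C B3 unfolding e3_def by (simp add: pos_le_divide_eq)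
      then show ?thesis by (simp add: mult_ac)
    qed
    interpret coag_pair \<alpha> \<epsilon> K f1 f2 by (intro coag_pair.intro coag_pair_axioms.intro P1 P2 small)
    have VTb: "\<forall>x>0. 0 \<le> VT x \<and> VT x \<le> 4 * B * (1 + x powr (- \<alpha>))"
    proof (intro allI impI conjI)
      fix x :: real assume x: "0 < x"
      show "0 \<le> VT x" by (rule VT_bounds(1)[OF x])
      have "4 * \<epsilon> * B * (1 + x powr (- \<alpha>)) \<le> 4 * B * (1 + x powr (- \<alpha>))"
        using eps B3 by (intro mult_right_mono) auto
      then show "VT x \<le> 4 * B * (1 + x powr (- \<alpha>))" using VT_bounds(2)[OF x] unfolding B_def by linarith
    qed
    from solve[OF VT_cont VTb \<phi>c \<phi>b] obtain \<psi>a \<psi>b \<psi>' c where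
      d: "\<And>x. 0 < x \<Longrightarrow> ((\<lambda>x. \<psi>a x + \<psi>b x) has_real_derivative \<psi>' x) (at x)" and dc: "continuous_on {0<..} \<psi>'"
      and db: "\<And>x. 0 < x \<Longrightarrow> \<bar>\<psi>' x\<bar> \<le> C * (x powr (- 1 - \<alpha>) + x powr b)"
      and ab: "\<And>x. 0 < x \<Longrightarrow> \<bar>\<psi>a x\<bar> \<le> 1 + x" and bb: "\<And>x. 0 < x \<Longrightarrow> \<bar>\<psi>b x\<bar> \<le> C * (x + x powr (1 + b))"
      and pb: "\<And>x. 0 < x \<Longrightarrow> \<bar>\<psi>a x + \<psi>b x\<bar> \<le> C * (1 + x powr (1 + b))"
      and Ei: "\<And>x. 0 < x \<Longrightarrow> integrable lborel (\<lambda>y. exp_profile y * ((\<psi>a (x + y) + \<psi>b (x + y)) - (\<psi>a x + \<psi>b x) - (\<psi>a y + \<psi>b y)))"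
      and sol: "\<And>x. 0 < x \<Longrightarrow> (\<psi>a x + \<psi>b x) - x * \<psi>' x +
         2 * (\<integral>y. exp_profile y * ((\<psi>a (x + y) + \<psi>b (x + y)) - (\<psi>a x + \<psi>b x) - (\<psi>a y + \<psi>b y)) \<partial>lborel)
         = \<phi> x + VT x * \<psi>a x - c * x" by blast
    define \<psi> where "\<psi> x = \<psi>a x + \<psi>b x" for x
    have d': "(\<psi> has_real_derivative \<psi>' x) (at x)" if "0 < x" for x
      using d[OF that] by (simp add: \<psi>_def[abs_def])
    have T: "test_function \<alpha> C \<psi> \<psi>'"
      by unfold_locales (use \<alpha> C d' dc db pb in \<open>auto simp: \<psi>_def b_def\<close>)
    interpret T: coag_pair_test \<alpha> \<epsilon> K f1 f2 C \<psi> \<psi>'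
      by (intro coag_pair_test.intro coag_pair_axioms T)
    \<comment> \<open>The remainder after \<open>K x y = 2 - \<epsilon> + W x y\<close> and after
      writing 2 s as twice the exponential plus the two deviations from it. Only the exponential
      part with kernel 2 and the loss \<open>VT\<close> acting on \<open>\<psi>a\<close> are
      inverted exactly.\<close>
    define err where "err x = (VT x * \<psi>a x + (\<integral>y. s y * (W x y * T.D0 x y) \<partial>lborel))
       + (\<integral>y. (f1 y - exp_profile y) * T.D0 x y \<partial>lborel) + (\<integral>y. (f2 y - exp_profile y) * T.D0 x y \<partial>lborel) - \<epsilon> * (\<integral>y. s y * T.D0 x y \<partial>lborel)" for x
    have ED: "exp_profile y * T.D0 x y = exp_profile y * ((\<psi>a (x + y) + \<psi>b (x + y)) - (\<psi>a x + \<psi>b x) - (\<psi>a y + \<psi>b y))" if "0 < x" for x y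
      using T.D0_eq[OF that, of y] by (cases "0 < y") (auto simp: exp_profile_def T.\<Delta>_def \<psi>_def)
    have EDi: "integrable lborel (\<lambda>y. exp_profile y * T.D0 x y)" if "0 < x" for x
      unfolding ED[OF that] by (rule Ei[OF that])
    have D0b: "\<bar>T.D0 x y\<bar> \<le> (16 * C * (1 + x)) * wt \<alpha> y" if "0 < x" "0 < y" for x y
      using T.Delta_wt[OF that] T.D0_eq[OF that] by simp
    have fDi: "integrable lborel (\<lambda>y. f y * T.D0 x y)" if x: "0 < x" and P: "coag_profile \<alpha> \<epsilon> K f" for x f
    proof -
      interpret F: coag_profile \<alpha> \<epsilon> K f by (rule P)
      show ?thesis
      proof (rule Bochner_Integration.integrable_bound[OF integrable_mult_right[OF profile_wt(1)[OF P], of "16 * C * (1 + x)"]])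
        show "AE y in lborel. norm (f y * T.D0 x y) \<le> norm (16 * C * (1 + x) * (f y * wt \<alpha> y))"
        proof (rule AE_I2)
          fix y
          show "norm (f y * T.D0 x y) \<le> norm (16 * C * (1 + x) * (f y * wt \<alpha> y))"
          proof (cases "0 < y")
            case True
            from mult_left_mono[OF D0b[OF x this] F.f_nonneg[of y]] show ?thesis
              using C x F.f_nonneg[of y] T.wt_nonneg[of y] by (simp add: abs_mult mult_ac)
          qed (simp add: F.f_zero)
        qed
      qed measurable
    qed
    have sDi: "integrable lborel (\<lambda>y. s y * T.D0 x y)" and sDb: "\<bar>\<integral>y. s y * T.D0 x y \<partial>lborel\<bar> \<le> 16 * C * (1 + x) * B" if x: "0 < x" for x
      using s_bound[OF T.D0_measurable D0b[OF x]] C x unfolding B_def by auto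
    have decomp: "\<psi> x - x * \<psi>' x + (\<integral>y. s y * T.KD x y \<partial>lborel) = \<phi> x - c * x + err x" if x: "0 < x" for x
    proof -
      have pt: "s y * T.KD x y = 2 * (exp_profile y * T.D0 x y) + (f1 y - exp_profile y) * T.D0 x y + (f2 y - exp_profile y) * T.D0 x y
          - \<epsilon> * (s y * T.D0 x y) + s y * (W x y * T.D0 x y)" for y
      proof (cases "0 < y")
        case True
        have K: "K x y = 2 - \<epsilon> + W x y" using x True by (simp add: W_def)
        have "s y * T.KD x y = s y * ((2 - \<epsilon> + W x y) * T.D0 x y)" by (simp add: T.KD_def K T.D0_eq[OF x True])
        then show ?thesis by (simp add: s_def algebra_simps)
      qed (simp add: s_zero exp_profile_def f1.f_zero f2.f_zero)
      have i1: "integrable lborel (\<lambda>y. (f1 y - exp_profile y) * T.D0 x y)" and i2: "integrable lborel (\<lambda>y. (f2 y - exp_profile y) * T.D0 x y)"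
        unfolding left_diff_distrib by (intro Bochner_Integration.integrable_diff fDi EDi x P1 P2)+
      have i3: "integrable lborel (\<lambda>y. s y * (W x y * T.D0 x y))"
        by (rule T.singular_error(1)[of \<psi>a \<psi>b]) (use ab bb x in \<open>auto simp: \<psi>_def b_def\<close>)
      have "(\<integral>y. s y * T.KD x y \<partial>lborel) = 2 * (\<integral>y. exp_profile y * T.D0 x y \<partial>lborel) + (\<integral>y. (f1 y - exp_profile y) * T.D0 x y \<partial>lborel)
         + (\<integral>y. (f2 y - exp_profile y) * T.D0 x y \<partial>lborel) - \<epsilon> * (\<integral>y. s y * T.D0 x y \<partial>lborel) + (\<integral>y. s y * (W x y * T.D0 x y) \<partial>lborel)"
        unfolding pt using EDi[OF x] i1 i2 sDi[OF x] i3 by simp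
      moreover have "\<psi> x - x * \<psi>' x + 2 * (\<integral>y. exp_profile y * T.D0 x y \<partial>lborel) = \<phi> x + VT x * \<psi>a x - c * x"
        unfolding ED[OF x] \<psi>_def by (rule sol[OF x])
      ultimately show ?thesis unfolding err_def by linarith
    qed
    have err: "\<bar>err x\<bar> \<le> 1 / 2 * (1 + x)" if x: "0 < x" for x
    proof -
      define I1 where "I1 = VT x * \<psi>a x + (\<integral>y. s y * (W x y * T.D0 x y) \<partial>lborel)"
      define I2 where "I2 = (\<integral>y. (f1 y - exp_profile y) * T.D0 x y \<partial>lborel)"
      define I3 where "I3 = (\<integral>y. (f2 y - exp_profile y) * T.D0 x y \<partial>lborel)"
      define I4 where "I4 = (\<integral>y. s y * T.D0 x y \<partial>lborel)"
      have 1: "\<bar>I1\<bar> \<le> 48 * \<epsilon> * C * B * (1 + x)" unfolding I1_def B_def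
        by (rule T.singular_error(2)) (use ab bb x in \<open>auto simp: \<psi>_def b_def\<close>)
      have fD: "\<bar>\<integral>y. (f y - exp_profile y) * T.D0 x y \<partial>lborel\<bar> \<le> 1 / 8 * (1 + x)" if P: "coag_profile \<alpha> \<epsilon> K f" for f
      proof -
        interpret F: coag_profile \<alpha> \<epsilon> K f by (rule P)
        have pt: "(f y - exp_profile y) * T.D0 x y = (f y - exp_profile y) * (\<psi> (x + y) - \<psi> x - \<psi> y)" for y
          using T.D0_eq[OF x, of y] by (cases "0 < y") (auto simp: T.\<Delta>_def exp_profile_def F.f_zero)
        show ?thesis unfolding pt by (rule close[OF P ee(1) T x])
      qed
      have 4: "\<bar>\<epsilon> * I4\<bar> \<le> \<epsilon> * (16 * C * (1 + x) * B)"
        unfolding abs_mult I4_def using sDb[OF x] eps by (intro mult_mono) auto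
      have "\<bar>err x\<bar> \<le> \<bar>I1\<bar> + \<bar>I2\<bar> + \<bar>I3\<bar> + \<bar>\<epsilon> * I4\<bar>"
        unfolding err_def I1_def[symmetric] I2_def[symmetric] I3_def[symmetric] I4_def[symmetric] by linarith
      also have "\<dots> \<le> 48 * \<epsilon> * C * B * (1 + x) + 1 / 8 * (1 + x) + 1 / 8 * (1 + x) + \<epsilon> * (16 * C * (1 + x) * B)"
        by (intro add_mono 1 4) (auto simp only: I2_def I3_def intro!: fD P1 P2)
      also have "\<dots> = (64 * (\<epsilon> * C * B) + 1 / 4) * (1 + x)" by (simp add: algebra_simps)
      also have "\<dots> \<le> (1 / 4 + 1 / 4) * (1 + x)" using eCB x by (intro mult_right_mono) auto
      finally show ?thesis by simp
    qed
    have gx: "integrable lborel (\<lambda>x. g x * x)" "(\<integral>x. g x * x \<partial>lborel) = 0"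
    proof -
      have pt: "g x * x = x * f1 x - x * f2 x" for x by (simp add: g_def algebra_simps)
      show "integrable lborel (\<lambda>x. g x * x)" unfolding pt
        by (rule Bochner_Integration.integrable_diff[OF f1.x_f_integrable f2.x_f_integrable])
      show "(\<integral>x. g x * x \<partial>lborel) = 0" unfolding pt
        using f1.x_f_integrable f2.x_f_integrable f1.x_f_integral f2.x_f_integral by simp
    qed
    have gi: "integrable lborel g" unfolding g_def using f1.f_integrable f2.f_integrable by simp
    have gw: "integrable lborel (\<lambda>x. \<bar>g x\<bar> * (1 + x))"
    proof -
      have pt: "\<bar>g x\<bar> * (1 + x) = \<bar>g x\<bar> + \<bar>g x * x\<bar>" for x
        using g_zero[of x] by (cases "0 < x") (auto simp: abs_mult distrib_left)
      show ?thesis unfolding pt using gi gx by simp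
    qed
    have g\<phi>: "integrable lborel (\<lambda>x. g x * \<phi> x)"
    proof (rule Bochner_Integration.integrable_bound[OF gw])
      show "AE x in lborel. norm (g x * \<phi> x) \<le> norm (\<bar>g x\<bar> * (1 + x))"
      proof (rule AE_I2)
        fix x show "norm (g x * \<phi> x) \<le> norm (\<bar>g x\<bar> * (1 + x))"
        proof (cases "0 < x")
          case True
          then have "\<bar>g x\<bar> * \<bar>\<phi> x\<bar> \<le> \<bar>g x\<bar> * (1 + x)" using \<phi>b by (intro mult_left_mono) auto
          then show ?thesis using True by (simp add: abs_mult)
        qed (simp add: g_zero)
      qed
    qed measurable
    define q where "q x = g x * (\<psi> x - x * \<psi>' x) + g x * (\<integral>y. s y * T.KD x y \<partial>lborel)" for x
    have qi: "integrable lborel q" and q0: "(\<integral>x. q x \<partial>lborel) = 0"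
      unfolding q_def using T.adjoint_identity by (simp_all add: Bochner_Integration.integral_add)
    have qe: "q x = g x * \<phi> x - c * (g x * x) + g x * err x" for x
    proof (cases "0 < x")
      case True
      show ?thesis unfolding q_def distrib_left[symmetric] decomp[OF True] by (simp add: algebra_simps)
    qed (simp add: q_def g_zero)
    have ge: "g x * err x = q x - g x * \<phi> x + c * (g x * x)" for x using qe[of x] by simp
    have gei: "integrable lborel (\<lambda>x. g x * err x)" unfolding ge using qi g\<phi> gx by simp
    have geI: "(\<integral>x. g x * err x \<partial>lborel) = - (\<integral>x. g x * \<phi> x \<partial>lborel)"
      unfolding ge using qi g\<phi> gx q0 by simp
    have geb: "\<bar>g x * err x\<bar> \<le> 1 / 2 * (\<bar>g x\<bar> * (1 + x))" for x
    proof (cases "0 < x")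
      case True
      from mult_left_mono[OF err[OF this], of "\<bar>g x\<bar>"] show ?thesis by (simp add: abs_mult)
    qed (simp add: g_zero)
    have "\<bar>\<integral>x. g x * err x \<partial>lborel\<bar> \<le> (\<integral>x. 1 / 2 * (\<bar>g x\<bar> * (1 + x)) \<partial>lborel)"
      by (rule order_trans[OF integral_abs_bound integral_mono[OF integrable_abs[OF gei] integrable_mult_right[OF gw] geb]])
    then have "\<bar>\<integral>x. g x * \<phi> x \<partial>lborel\<bar> \<le> 1 / 2 * (\<integral>x. \<bar>g x\<bar> * (1 + x) \<partial>lborel)"
      unfolding geI integral_mult_right_zero by simp
    then show "\<bar>\<integral>x. (f1 x - f2 x) * \<phi> x \<partial>lborel\<bar> \<le> 1 / 2 * (\<integral>x. \<bar>f1 x - f2 x\<bar> * (1 + x) \<partial>lborel)"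
      unfolding g_def .
  qed
qed

text \<open>The adjoint equation is solved for continuous right-hand sides only, whereas the
  weighted norm of \<open>g\<close> is attained at its sign. Truncation to [-1, 1] does not move the
  limits because the sign lies in that interval.\<close>

lemma continuous_sign_approximation:
  fixes g :: "real \<Rightarrow> real"
  assumes [measurable]: "g \<in> borel_measurable borel"
  obtains \<theta> where "\<And>n. continuous_on UNIV (\<theta> n)" "\<And>n x. \<bar>\<theta> n x\<bar> \<le> (1::real)"
    "AE x in lborel. (\<lambda>n::nat. \<theta> n x) \<longlonglongrightarrow> sgn (g x)"
proof -
  have "(\<lambda>x. sgn (g x)) \<in> borel_measurable lebesgue"
    by (rule measurable_completion) measurable
  then have "(\<lambda>x. sgn (g x)) measurable_on UNIV"
    by (rule lebesgue_measurable_imp_measurable_on_real) simp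
  then obtain N h where N: "negligible N" and h: "\<And>n. continuous_on UNIV (h n)"
    and lim: "\<And>x. x \<notin> N \<Longrightarrow> (\<lambda>n. h n x) \<longlonglongrightarrow> sgn (g x)"
    unfolding measurable_on_def by auto
  show ?thesis
  proof (rule that[of "\<lambda>n x. max (- 1) (min 1 (h n x))"])
    show "continuous_on UNIV (\<lambda>x. max (- 1) (min 1 (h n x)))" for n by (intro continuous_intros h)
    show "\<bar>max (- 1) (min 1 (h n x))\<bar> \<le> 1" for n x by (auto simp: max_def min_def)
    have cl: "max (- 1) (min 1 (sgn r)) = sgn r" for r :: real by (auto simp: sgn_if)
    have conv: "(\<lambda>n. max (- 1) (min 1 (h n x))) \<longlonglongrightarrow> sgn (g x)" if "x \<notin> N" for x
      using tendsto_max[OF tendsto_const[of "- 1"] tendsto_min[OF tendsto_const[of 1] lim[OF that]]] by (simp only: cl)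
    have "AE x in lebesgue. x \<notin> N" using N by (simp add: negligible_iff_null_sets AE_not_in)
    then have "AE x in lborel. x \<notin> N" by (simp add: AE_completion_iff)
    then show "AE x in lborel. (\<lambda>n. max (- 1) (min 1 (h n x))) \<longlonglongrightarrow> sgn (g x)"
      by eventually_elim (rule conv)
  qed
qed

text \<open>Duality: inserting 1 + x times approximations of the sign of \<open>g\<close> into
  \<open>contraction\<close> yields in the limit that the weighted norm of \<open>g\<close> is at
  most half of itself. It is finite by the zeroth and first moments, hence zero.\<close>

lemma normalized_uniqueness:
  fixes \<alpha> :: real
  assumes "0 \<le> \<alpha>" "\<alpha> < 1"
  shows "\<exists>e>0. \<forall>\<epsilon> K f1 f2. coag_profile \<alpha> \<epsilon> K f1 \<longrightarrow> coag_profile \<alpha> \<epsilon> K f2 \<longrightarrow> \<epsilon> \<le> e \<longrightarrow>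
    (AE x in lborel. f1 x = f2 x)"
proof -
  obtain e where e: "0 < e" and contr: "\<And>\<epsilon> K f1 f2 \<phi>. coag_profile \<alpha> \<epsilon> K f1 \<Longrightarrow> coag_profile \<alpha> \<epsilon> K f2 \<Longrightarrow> \<epsilon> \<le> e \<Longrightarrow>
    continuous_on {0<..} \<phi> \<Longrightarrow> \<phi> \<in> borel_measurable borel \<Longrightarrow> (\<forall>x>0. \<bar>\<phi> x\<bar> \<le> 1 + x) \<Longrightarrow>
    \<bar>\<integral>x. (f1 x - f2 x) * \<phi> x \<partial>lborel\<bar> \<le> 1 / 2 * (\<integral>x. \<bar>f1 x - f2 x\<bar> * (1 + x) \<partial>lborel)"
    using contraction[OF assms] by blast
  show ?thesis
  proof (intro exI[of _ e] conjI allI impI)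
    fix \<epsilon> K f1 f2
    assume P1: "coag_profile \<alpha> \<epsilon> K f1" and P2: "coag_profile \<alpha> \<epsilon> K f2" and ee: "\<epsilon> \<le> e"
    interpret f1: coag_profile \<alpha> \<epsilon> K f1 by (rule P1)
    interpret f2: coag_profile \<alpha> \<epsilon> K f2 by (rule P2)
    define g where "g x = f1 x - f2 x" for x
    have [measurable]: "g \<in> borel_measurable borel" unfolding g_def by measurable
    have g0: "g x = 0" if "x \<le> 0" for x using that by (simp add: g_def f1.f_zero f2.f_zero)
    define d where "d x = \<bar>g x\<bar> * (1 + x)" for x
    have [measurable]: "d \<in> borel_measurable borel" unfolding d_def by measurable
    have d0: "0 \<le> d x" for x using g0[of x] by (cases "0 < x") (auto simp: d_def)
    have di: "integrable lborel d"
    proof -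
      have pt: "d x = \<bar>g x\<bar> + \<bar>x * f1 x - x * f2 x\<bar>" for x
      proof (cases "0 < x")
        case True
        have "x * f1 x - x * f2 x = x * g x" by (simp add: g_def right_diff_distrib)
        then show ?thesis using True by (simp add: d_def abs_mult distrib_left mult.commute)
      qed (simp add: d_def g0 f1.f_zero f2.f_zero)
      have "integrable lborel g" unfolding g_def by (rule Bochner_Integration.integrable_diff[OF f1.f_integrable f2.f_integrable])
      then show ?thesis unfolding pt[abs_def]
        by (intro Bochner_Integration.integrable_add integrable_abs Bochner_Integration.integrable_diff f1.x_f_integrable f2.x_f_integrable)
    qed
    obtain \<theta> where \<theta>: "\<And>n. continuous_on UNIV (\<theta> n)" "\<And>n x. \<bar>\<theta> n x\<bar> \<le> (1::real)"
      "AE x in lborel. (\<lambda>n::nat. \<theta> n x) \<longlonglongrightarrow> sgn (g x)"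
      using continuous_sign_approximation[of g] by auto
    have [measurable]: "\<theta> n \<in> borel_measurable borel" for n by (rule borel_measurable_continuous_onI[OF \<theta>(1)])
    define \<phi> where "\<phi> n x = (1 + x) * \<theta> n x" for n x
    have [measurable]: "\<phi> n \<in> borel_measurable borel" for n unfolding \<phi>_def by measurable
    have b: "\<bar>\<integral>x. g x * \<phi> n x \<partial>lborel\<bar> \<le> 1 / 2 * (\<integral>x. d x \<partial>lborel)" for n
      unfolding g_def d_def
    proof (rule contr[OF P1 P2 ee])
      show "continuous_on {0<..} (\<phi> n)"
        unfolding \<phi>_def by (intro continuous_intros continuous_on_subset[OF \<theta>(1)]) auto
      show "\<forall>x>0. \<bar>\<phi> n x\<bar> \<le> 1 + x"
        using \<theta>(2)[of n] by (auto simp: \<phi>_def abs_mult mult_left_le)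
    qed measurable
    have "(\<lambda>n. \<integral>x. g x * \<phi> n x \<partial>lborel) \<longlonglongrightarrow> (\<integral>x. d x \<partial>lborel)"
    proof (rule integral_dominated_convergence[OF _ _ di])
      show "AE x in lborel. (\<lambda>n. g x * \<phi> n x) \<longlonglongrightarrow> d x"
        using \<theta>(3)
      proof eventually_elim
        case (elim x)
        have "(\<lambda>n. g x * \<phi> n x) \<longlonglongrightarrow> g x * ((1 + x) * sgn (g x))"
          unfolding \<phi>_def by (intro tendsto_mult tendsto_const elim)
        moreover have "g x * ((1 + x) * sgn (g x)) = d x"
          by (simp add: d_def abs_sgn mult_ac)
        ultimately show ?case by (simp only:)
      qed
      show "AE x in lborel. norm (g x * \<phi> n x) \<le> d x" for n
      proof (rule AE_I2)
        fix x show "norm (g x * \<phi> n x) \<le> d x"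
        proof (cases "0 < x")
          case True
          have "\<bar>g x\<bar> * ((1 + x) * \<bar>\<theta> n x\<bar>) \<le> \<bar>g x\<bar> * ((1 + x) * 1)"
            using \<theta>(2)[of n x] True by (intro mult_left_mono) auto
          then show ?thesis using True by (simp add: d_def \<phi>_def abs_mult)
        qed (simp add: g0 d0)
      qed
    qed measurable
    then have "(\<integral>x. d x \<partial>lborel) \<le> 1 / 2 * (\<integral>x. d x \<partial>lborel)"
    proof (rule LIMSEQ_le_const2, intro exI allI impI)
      fix n show "(\<integral>x. g x * \<phi> n x \<partial>lborel) \<le> 1 / 2 * (\<integral>x. d x \<partial>lborel)"
        by (rule order_trans[OF abs_ge_self b])
    qed
    moreover have "0 \<le> (\<integral>x. d x \<partial>lborel)" by (rule Bochner_Integration.integral_nonneg[OF d0])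
    ultimately have "(\<integral>x. d x \<partial>lborel) = 0" by linarith
    then have "AE x in lborel. d x = 0" using integral_nonneg_eq_0_iff_AE[OF di] d0 by simp
    then show "AE x in lborel. f1 x = f2 x"
    proof eventually_elim
      case (elim x)
      then show ?case using g0[of x] by (cases "0 < x") (auto simp: d_def g_def)
    qed
  qed (rule e)
qed

section \<open>Reduction to mass one and conclusion\<close>

lemma kernel_normalization:
  assumes K: "kernel_assms \<alpha> \<epsilon> C0 K" and "0 \<le> \<alpha>" "\<alpha> < 1" "0 < \<epsilon>" "\<epsilon> \<le> 1"
  shows "coag_kernel \<alpha> \<epsilon> (\<lambda>x y. if 0 < x \<and> 0 < y then K x y else 0)"
proof
  have "continuous_on ({0<..} \<times> {0<..}) (\<lambda>(u, v). K u v)"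
  proof (rule continuous_at_imp_continuous_on, rule ballI)
    fix p :: "real \<times> real" assume "p \<in> {0<..} \<times> {0<..}"
    then obtain x y where "p = (x, y)" "0 < x" "0 < y" by auto
    then show "isCont (\<lambda>(u, v). K u v) p"
      using K unfolding kernel_assms_def by (auto intro!: differentiable_imp_continuous_within)
  qed
  then show "continuous_on ({0<..} \<times> {0<..}) (\<lambda>p. if 0 < fst p \<and> 0 < snd p then K (fst p) (snd p) else 0)"
    by (rule continuous_on_eq) auto
  show "(if 0 < x \<and> 0 < y then K x y else 0) = (if 0 < y \<and> 0 < x then K y x else 0)" for x y
    using K unfolding kernel_assms_def by auto
  fix x y :: real assume xy: "0 < x" "0 < y"
  have "K x y - 2 \<ge> - \<epsilon>" "K x y - 2 \<le> \<epsilon> * ((x / y) powr \<alpha> + (y / x) powr \<alpha>)"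
    using K xy unfolding kernel_assms_def by blast+
  then show "2 - \<epsilon> \<le> (if 0 < x \<and> 0 < y then K x y else 0)"
    "(if 0 < x \<and> 0 < y then K x y else 0) \<le> 2 + \<epsilon> * ((x / y) powr \<alpha> + (y / x) powr \<alpha>)"
    using xy by auto
qed (use assms in auto)

text \<open>The function x -> M f(M x) has mass 1 if f has mass M, and it solves the same equation
  because \<open>K\<close> is homogeneous of degree zero. Values of f at nonpositive arguments are
  arbitrary and are replaced by 0; measurability on the positive axis comes from local integrability
  on the intervals from 1 / (n + 1) to n + 1.\<close>

lemma profile_normalization:
  assumes K: "kernel_assms \<alpha> \<epsilon> C0 K" and \<alpha>: "0 \<le> \<alpha>" "\<alpha> < 1" and \<epsilon>: "0 < \<epsilon>" "\<epsilon> \<le> 1"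
    and f: "self_similar_profile K f" and M: "0 < M" "mass f = M"
  shows "(\<lambda>x. if 0 < x then f x else 0) \<in> borel_measurable borel"
    and "coag_profile \<alpha> \<epsilon> (\<lambda>x y. if 0 < x \<and> 0 < y then K x y else 0) (\<lambda>x. M * (if 0 < M * x then f (M * x) else 0))"
proof -
  define k where "k x y = (if 0 < x \<and> 0 < y then K x y else 0)" for x y
  define f0 where "f0 x = (if 0 < x then f x else 0)" for x
  interpret coag_kernel \<alpha> \<epsilon> k unfolding k_def by (rule kernel_normalization[OF K \<alpha> \<epsilon>])
  have f0_nonneg: "0 \<le> f0 x" for x using f by (simp add: f0_def self_similar_profile_def)
  have f0_measurable [measurable]: "f0 \<in> borel_measurable borel"
  proof (rule borel_measurable_LIMSEQ_real)
    show "(\<lambda>x. indicator {1 / real (Suc n)..real (Suc n)} x *\<^sub>R f x) \<in> borel_measurable borel" for n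
    proof -
      have "0 < 1 / real (Suc n)" by simp
      then have "set_integrable lborel {1 / real (Suc n)..real (Suc n)} f"
        using f unfolding self_similar_profile_def loc_integrable_pos_def by blast
      then show ?thesis unfolding set_integrable_def by (simp only: borel_measurable_integrable[of lborel, simplified])
    qed
    fix x
    show "(\<lambda>n. indicator {1 / real (Suc n)..real (Suc n)} x *\<^sub>R f x) \<longlonglongrightarrow> f0 x"
    proof (cases "0 < x")
      case True
      have "(\<lambda>n. 1 / real (Suc n)) \<longlonglongrightarrow> 0" by (intro LIMSEQ_Suc lim_1_over_n)
      then have "\<forall>\<^sub>F n in sequentially. 1 / real (Suc n) < x" using True by (rule order_tendstoD(2))
      moreover have "\<forall>\<^sub>F n in sequentially. x \<le> real (Suc n)"
        using eventually_ge_at_top[of "nat \<lceil>x\<rceil>"] by eventually_elim linarith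
      ultimately have "\<forall>\<^sub>F n in sequentially. indicator {1 / real (Suc n)..real (Suc n)} x *\<^sub>R f x = f0 x"
        by eventually_elim (use True in \<open>simp add: f0_def\<close>)
      then show ?thesis by (rule tendsto_eventually)
    next
      case False
      then have "indicator {1 / real (Suc n)..real (Suc n)} x *\<^sub>R f x = 0" for n
        using le_less_trans[of x 0 "1 / real (Suc n)"] by (auto simp: indicator_def)
      moreover have "f0 x = 0" using False by (simp add: f0_def)
      ultimately show ?thesis by (simp only: tendsto_const)
    qed
  qed
  then show "(\<lambda>x. if 0 < x then f x else 0) \<in> borel_measurable borel" by (simp add: f0_def[abs_def])
  have pt: "indicator {0<..} x * (x * f x) = x * f0 x" for x by (simp add: f0_def indicator_def)
  have m1: "has_bochner_integral lborel (\<lambda>x. x * f0 x) M"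
  proof -
    have "(\<integral>\<^sup>+x. ennreal (x * f0 x) \<partial>lborel) < \<infinity>"
      using f unfolding self_similar_profile_def pt by simp
    moreover have n: "0 \<le> x * f0 x" for x using f0_nonneg[of x] by (cases "0 < x") (auto simp: f0_def)
    ultimately have "integrable lborel (\<lambda>x. x * f0 x)"
      by (intro integrableI_bounded) (auto simp: abs_of_nonneg[OF n] simp del: abs_mult)
    moreover have "(\<integral>x. x * f0 x \<partial>lborel) = M"
      using M(2) unfolding mass_def set_lebesgue_integral_def real_scaleR_def pt .
    ultimately show ?thesis by (simp add: has_bochner_integral_iff)
  qed
  define H where "H p = k (fst p) (snd p) * fst p * f0 (fst p) * f0 (snd p)" for p
  have [measurable]: "H \<in> borel_measurable (borel \<Otimes>\<^sub>M borel)" unfolding H_def by measurable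
  have H0: "0 \<le> H p" for p
    using f0_nonneg K_nonneg K_zero[of "fst p" "snd p"] by (cases "0 < fst p") (auto simp: H_def)
  have ind_measurable [measurable]: "(\<lambda>(x, p). indicator {fst p<..<fst p + snd p} x :: ennreal) \<in> borel_measurable (borel \<Otimes>\<^sub>M lborel2)"
    unfolding greaterThanLessThan_iff indicator_def by measurable
  define R where "R x = (\<integral>\<^sup>+p. ennreal (H p) * indicator {fst p<..<fst p + snd p} x \<partial>lborel2)" for x
  have R_measurable [measurable]: "R \<in> borel_measurable borel"
    unfolding R_def by (rule lborel_pair.borel_measurable_nn_integral) measurable
  have Rit: "R x = (\<integral>\<^sup>+y. \<integral>\<^sup>+z. ennreal (H (y, z)) * indicator {y<..<y + z} x \<partial>lborel \<partial>lborel)" for x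
  proof -
    have "(\<lambda>p. ennreal (H p) * indicator {fst p<..<fst p + snd p} x) \<in> borel_measurable lborel2"
      by measurable
    from lborel.nn_integral_fst[OF this] show ?thesis by (simp add: R_def)
  qed
  have eq: "AE x in lborel. ennreal (x\<^sup>2 * f0 x) = R x"
  proof -
    have "AE x in lborel. x > 0 \<longrightarrow>
        ennreal (x\<^sup>2 * f x) =
        (\<integral>\<^sup>+ y. indicator {0<..<x} y *
           (\<integral>\<^sup>+ z. indicator {x - y<..} z * ennreal (K y z * y * f y * f z) \<partial>lborel) \<partial>lborel)"
      using f unfolding self_similar_profile_def by blast
    then show ?thesis
    proof eventually_elim
      case (elim x)
      show ?case
      proof (cases "0 < x")
        case True
        have "indicator {0<..<x} y * (\<integral>\<^sup>+ z. indicator {x - y<..} z * ennreal (K y z * y * f y * f z) \<partial>lborel) =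
          (\<integral>\<^sup>+z. ennreal (H (y, z)) * indicator {y<..<y + z} x \<partial>lborel)" for y
        proof (cases "0 < y \<and> y < x")
          case True
          then show ?thesis
            by (auto simp: H_def k_def f0_def indicator_def intro!: nn_integral_cong)
        next
          case False
          then have z: "ennreal (H (y, z)) * indicator {y<..<y + z} x = 0" for z
            by (auto simp: H_def k_def indicator_def)
          show ?thesis unfolding z using False by auto
        qed
        then show ?thesis using elim True by (simp add: Rit f0_def)
      next
        case False
        have z: "ennreal (H (y, z)) * indicator {y<..<y + z} x = 0" for y z
          using False by (auto simp: H_def k_def indicator_def)
        show ?thesis unfolding Rit z using False by (simp add: f0_def)
      qed
    qed
  qed
  define F where "F x = M * f0 (M * x)" for x
  have [measurable]: "F \<in> borel_measurable borel" unfolding F_def by measurable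
  \<comment> \<open>Substituting M y and M z gives two factors M. In \<open>H\<close> the weight
    contributes a factor M and the two values of \<open>f0\<close> a factor 1 / M each, so one
    factor M remains; it also appears on the left-hand side of the equation and cancels.\<close>
  have scale: "R (M * x) = ennreal M * (\<integral>\<^sup>+p. ennreal (k (fst p) (snd p) * fst p * F (fst p) * F (snd p)) * indicator {fst p<..<fst p + snd p} x \<partial>lborel2)" for x
  proof -
    have kM: "k (M * y) (M * z) = k y z" for y z
      using K M(1) unfolding kernel_assms_def k_def by (auto simp: zero_less_mult_iff)
    have HM: "ennreal M * (ennreal M * (ennreal (H (M * y, M * z)) * indicator {M * y<..<M * y + M * z} (M * x))) =
      ennreal M * (ennreal (k y z * y * F y * F z) * indicator {y<..<y + z} x)" for y z
    proof -
      have i: "indicator {M * y<..<M * y + M * z} (M * x) = (indicator {y<..<y + z} x :: ennreal)"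
        using M(1) by (auto simp: indicator_def distrib_left[symmetric])
      have "M * H (M * y, M * z) = k y z * y * F y * F z" by (simp add: H_def kM F_def)
      then have "ennreal M * ennreal (H (M * y, M * z)) = ennreal (k y z * y * F y * F z)"
        using M(1) H0 by (simp add: ennreal_mult[symmetric])
      then show ?thesis unfolding i by (simp add: mult.assoc[symmetric])
    qed
    have "R (M * x) = (\<integral>\<^sup>+y. \<integral>\<^sup>+z. ennreal (H (y, z)) * indicator {y<..<y + z} (M * x) \<partial>lborel \<partial>lborel)"
      by (rule Rit)
    also have "\<dots> = ennreal M * (\<integral>\<^sup>+y. \<integral>\<^sup>+z. ennreal (H (M * y, z)) * indicator {M * y<..<M * y + z} (M * x) \<partial>lborel \<partial>lborel)"
    proof -
      have "(\<lambda>y. \<integral>\<^sup>+z. ennreal (H (y, z)) * indicator {y<..<y + z} (M * x) \<partial>lborel) \<in> borel_measurable borel"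
        by (rule lborel.borel_measurable_nn_integral) (unfold greaterThanLessThan_iff indicator_def, measurable)
      from nn_integral_real_affine[OF this, of M 0] M(1) show ?thesis by simp
    qed
    also have "\<dots> = ennreal M * (\<integral>\<^sup>+y. ennreal M * (\<integral>\<^sup>+z. ennreal (H (M * y, M * z)) * indicator {M * y<..<M * y + M * z} (M * x) \<partial>lborel) \<partial>lborel)"
    proof -
      have "(\<integral>\<^sup>+z. ennreal (H (M * y, z)) * indicator {M * y<..<M * y + z} (M * x) \<partial>lborel) =
         ennreal M * (\<integral>\<^sup>+z. ennreal (H (M * y, M * z)) * indicator {M * y<..<M * y + M * z} (M * x) \<partial>lborel)" for y
      proof -
        have "(\<lambda>z. ennreal (H (M * y, z)) * indicator {M * y<..<M * y + z} (M * x)) \<in> borel_measurable borel"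
          unfolding greaterThanLessThan_iff indicator_def by measurable
        from nn_integral_real_affine[OF this, of M 0] M(1) show ?thesis by simp
      qed
      then show ?thesis by (simp only:)
    qed
    also have "\<dots> = (\<integral>\<^sup>+y. \<integral>\<^sup>+z. ennreal M * (ennreal M * (ennreal (H (M * y, M * z)) * indicator {M * y<..<M * y + M * z} (M * x))) \<partial>lborel \<partial>lborel)"
    proof -
      have m1: "(\<lambda>z. ennreal (H (M * y, M * z)) * indicator {M * y<..<M * y + M * z} (M * x)) \<in> borel_measurable lborel" for y
        unfolding greaterThanLessThan_iff indicator_def by measurable
      have m2: "(\<lambda>y. ennreal M * (\<integral>\<^sup>+z. ennreal (H (M * y, M * z)) * indicator {M * y<..<M * y + M * z} (M * x) \<partial>lborel)) \<in> borel_measurable lborel"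
        by (intro borel_measurable_times_ennreal borel_measurable_const lborel.borel_measurable_nn_integral)
           (unfold greaterThanLessThan_iff indicator_def, measurable)
      have m3: "(\<lambda>z. ennreal M * (ennreal (H (M * y, M * z)) * indicator {M * y<..<M * y + M * z} (M * x))) \<in> borel_measurable lborel" for y
        by (intro borel_measurable_times_ennreal borel_measurable_const m1)
      show ?thesis
        by (subst nn_integral_cmult[OF m2, symmetric], intro nn_integral_cong)
           (simp only: nn_integral_cmult[OF m1] nn_integral_cmult[OF m3])
    qed
    also have "\<dots> = (\<integral>\<^sup>+y. \<integral>\<^sup>+z. ennreal M * (ennreal (k y z * y * F y * F z) * indicator {y<..<y + z} x) \<partial>lborel \<partial>lborel)"
      by (simp only: HM)
    also have "\<dots> = (\<integral>\<^sup>+p. ennreal M * (ennreal (k (fst p) (snd p) * fst p * F (fst p) * F (snd p)) * indicator {fst p<..<fst p + snd p} x) \<partial>lborel2)"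
    proof -
      have "(\<lambda>p. ennreal M * (ennreal (k (fst p) (snd p) * fst p * F (fst p) * F (snd p)) * indicator {fst p<..<fst p + snd p} x)) \<in> borel_measurable lborel2"
        by measurable
      from lborel.nn_integral_fst[OF this] show ?thesis by simp
    qed
    also have "\<dots> = ennreal M * (\<integral>\<^sup>+p. ennreal (k (fst p) (snd p) * fst p * F (fst p) * F (snd p)) * indicator {fst p<..<fst p + snd p} x \<partial>lborel2)"
      by (rule nn_integral_cmult) measurable
    finally show ?thesis .
  qed
  have "coag_profile \<alpha> \<epsilon> k F"
  proof unfold_locales
    show "F \<in> borel_measurable borel" by measurable
    show "0 \<le> F x" for x using M(1) f0_nonneg by (simp add: F_def)
    show "F x = 0" if "x \<le> 0" for x
    proof -
      have "M * x \<le> 0" using that M(1) by (simp add: mult_le_0_iff)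
      then show ?thesis by (simp add: F_def f0_def)
    qed
    have "has_bochner_integral lborel (\<lambda>x. (0 + M * x) * f0 (0 + M * x)) (M /\<^sub>R \<bar>M\<bar>)"
      using m1 M(1) by (subst lborel_has_bochner_integral_real_affine_iff[symmetric]) auto
    then show "has_bochner_integral lborel (\<lambda>x. x * F x) 1"
      using M(1) by (simp add: F_def mult_ac)
    have "AE x in lborel. ennreal ((0 + M * x)\<^sup>2 * f0 (0 + M * x)) = R (0 + M * x)"
      by (rule AE_borel_affine[OF _ _ eq]) (use M(1) in simp, measurable)
    then show "AE x in lborel. ennreal (x\<^sup>2 * F x) =
      (\<integral>\<^sup>+p. ennreal (k (fst p) (snd p) * fst p * F (fst p) * F (snd p)) * indicator {fst p<..<fst p + snd p} x \<partial>lborel2)"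
    proof eventually_elim
      case (elim x)
      define I where "I = (\<integral>\<^sup>+p. ennreal (k (fst p) (snd p) * fst p * F (fst p) * F (snd p)) * indicator {fst p<..<fst p + snd p} x \<partial>lborel2)"
      have "(M * x)\<^sup>2 * f0 (M * x) = M * (x\<^sup>2 * F x)" by (simp add: F_def power2_eq_square)
      moreover have "ennreal ((M * x)\<^sup>2 * f0 (M * x)) = ennreal M * I"
        using elim scale[of x] by (simp only: I_def add_0)
      moreover have "ennreal (M * (x\<^sup>2 * F x)) = ennreal M * ennreal (x\<^sup>2 * F x)"
        using M(1) f0_nonneg[of "M * x"] by (intro ennreal_mult) (auto simp: F_def)
      ultimately have "ennreal M * ennreal (x\<^sup>2 * F x) = ennreal M * I" by (simp only:)
      then show ?case unfolding I_def[symmetric] using M(1) by (simp add: ennreal_mult_cancel_left)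
    qed
  qed
  then show "coag_profile \<alpha> \<epsilon> (\<lambda>x y. if 0 < x \<and> 0 < y then K x y else 0) (\<lambda>x. M * (if 0 < M * x then f (M * x) else 0))"
    by (simp only: k_def[abs_def] F_def[abs_def] f0_def)
qed

theorem theorem1p1:
  fixes \<alpha> C0 :: real
  assumes "0 \<le> \<alpha>" and "\<alpha> < 1" and "C0 > 0"
  shows "\<exists>\<epsilon>0>0. \<forall>\<epsilon>. 0 < \<epsilon> \<and> \<epsilon> \<le> \<epsilon>0 \<longrightarrow>
           (\<forall>K f1 f2 M. kernel_assms \<alpha> \<epsilon> C0 K \<longrightarrow>
              self_similar_profile K f1 \<longrightarrow> self_similar_profile K f2 \<longrightarrow>
              M > 0 \<longrightarrow> mass f1 = M \<longrightarrow> mass f2 = M \<longrightarrow>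
              (AE x in lborel. x > 0 \<longrightarrow> f1 x = f2 x))"
proof -
  obtain e where e: "0 < e" and uniq: "\<And>\<epsilon> K f1 f2. coag_profile \<alpha> \<epsilon> K f1 \<Longrightarrow> coag_profile \<alpha> \<epsilon> K f2 \<Longrightarrow> \<epsilon> \<le> e \<Longrightarrow>
    (AE x in lborel. f1 x = f2 x)"
    using normalized_uniqueness[OF assms(1,2)] by blast
  show ?thesis
  \<comment> \<open>The bound 1 is part of \<open>coag_kernel\<close>, where it keeps 1 - \<epsilon>
    / 2 away from 0.\<close>
  proof (intro exI[of _ "min 1 e"] conjI allI impI)
    show "0 < min 1 e" using e by simp
    fix \<epsilon> K f1 f2 M
    assume eps: "0 < \<epsilon> \<and> \<epsilon> \<le> min 1 e" and K: "kernel_assms \<alpha> \<epsilon> C0 K"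
      and f1: "self_similar_profile K f1" and f2: "self_similar_profile K f2"
      and M: "M > 0" "mass f1 = M" "mass f2 = M"
    have e1: "0 < \<epsilon>" "\<epsilon> \<le> 1" "\<epsilon> \<le> e" using eps by auto
    note P1 = profile_normalization[OF K assms(1,2) e1(1,2) f1 M(1,2)]
    note P2 = profile_normalization[OF K assms(1,2) e1(1,2) f2 M(1,3)]
    define h1 where "h1 x = (if 0 < x then f1 x else 0)" for x
    define h2 where "h2 x = (if 0 < x then f2 x else 0)" for x
    have [measurable]: "h1 \<in> borel_measurable borel" "h2 \<in> borel_measurable borel"
      using P1(1) P2(1) by (simp_all add: h1_def[abs_def] h2_def[abs_def])
    have "AE x in lborel. M * h1 (M * x) = M * h2 (M * x)"
      using uniq[OF P1(2) P2(2) e1(3)] by (simp add: h1_def h2_def)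
    \<comment> \<open>Undoes the rescaling: almost everywhere statements are preserved by the
      substitution x -> x / M.\<close>
    then have "AE x in lborel. M * h1 (M * (0 + 1 / M * x)) = M * h2 (M * (0 + 1 / M * x))"
      by (rule AE_borel_affine[rotated 2]) (use M(1) in simp, measurable)
    then show "AE x in lborel. x > 0 \<longrightarrow> f1 x = f2 x"
    proof eventually_elim
      case (elim x)
      then have "h1 x = h2 x" using M(1) by simp
      then show ?case by (simp add: h1_def h2_def split: if_splits)
    qed
  qed
qed

end
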